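(* Let $p\ge 1$ be an integer, let $\beta\in(1/3,1]$, and let $\{X_t\}_{t=-\infty}^{\infty}$ be an $\operatorname{AR}(p)$ process $X_t=\phi_1X_{t-1}+\cdots+\phi_pX_{t-p}+Z_t$, where $\{Z_t\}$ are i.i.d. with $\mathrm{E}Z_t=0$, $\mathrm{E}Z_t^2=\sigma^2$, probability density function $f$ and cumulative distribution function $F$. Assume: (i) $F\in C^{(1,\beta)}(\mathbb{R})$ and there is a constant $C_f>0$ with $0<f(z)\le C_f$ for all $z\in\mathbb{R}$. (ii) $\{X_t\}$ is strictly stationary and causal, that is, $\inf_{|z|\le1}|1-\phi_1z-\cdots-\phi_pz^p|>0$ (infimum over complex $z$). (iii) The kernel $K$ is a symmetric probability density supported on $[-1,1]$ with $K\in C^{(2)}(\mathbb{R})$. (iv) The bandwidth $h=h_n>0$ satisfies $n^{-3/8}\ll h_n\ll n^{-1/\{2(1+\beta)\}}$ as $n\to\infty$. (v) $\mathrm{E}|Z_t|^{6+3\eta}<\infty$ for some $\eta\in(6/5,+\infty)$. Let $\{a_n\}$ be a sequence with $a_n>0$, $a_n\to\infty$ and $a_n\le C_1n^{C_2}$ for some constants $C_1,C_2>0$. Then, as $n\to\infty$, $$\sup_{z\in[-a_n,a_n]}\bigl|\hat F(z)-\tilde F(z)\bigr|=o_p\bigl(n^{-1/2}\bigr),$$ where $\tilde F$ is the kernel distribution estimator based on the errors $Z_1,\dots,Z_n$ and $\hat F$ is the kernel distribution estimator based on the Yule--Walker residuals $\hat Z_1,\dots,\hat Z_n$.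
   Context: $C^{(\nu,\beta)}(\mathbb{R})$ is the set of functions $\phi:\mathbb{R}\to\mathbb{R}$ whose $\nu$-th derivative satisfies $\sup_{x\neq y}|\phi^{(\nu)}(x)-\phi^{(\nu)}(y)|/|x-y|^{\beta}<\infty$. For positive sequences, $a_n\ll b_n$ means $a_n/b_n\to0$. The observations are $\{X_t\}_{t=1-p}^n$. The Yule--Walker estimator of $(\phi_1,\dots,\phi_p)^T$ is $\hat{\boldsymbol\phi}=(\hat\phi_1,\dots,\hat\phi_p)^T=\hat{\boldsymbol\Gamma}_p^{-1}\hat{\boldsymbol\gamma}_p$, where $\hat{\boldsymbol\Gamma}_p=\{\hat\gamma(i-j)\}_{i,j=1}^p$, $\hat{\boldsymbol\gamma}_p=(\hat\gamma(1),\dots,\hat\gamma(p))^T$ and $\hat\gamma(l)=n^{-1}\sum_{i=1-p}^{n-|l|}X_iX_{i+|l|}$ for $l=0,\pm1,\dots,\pm p$. The residuals are $\hat Z_t=X_t-\hat\phi_1X_{t-1}-\cdots-\hat\phi_pX_{t-p}$, $1\le t\le n$. With $K_h(u)=h^{-1}K(u/h)$, the estimators are $$\tilde F(z)=n^{-1}\sum_{t=1}^n\int_{-\infty}^zK_h(u-Z_t)\,du,\qquad \hat F(z)=n^{-1}\sum_{t=1}^n\int_{-\infty}^zK_h(u-\hat Z_t)\,du,\qquad z\in\mathbb{R}.$$ *)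

theory Defs
  imports
    "HOL-Probability.Probability"
    "Jordan_Normal_Form.Gauss_Jordan_Elimination"
begin

definition holder_class :: "nat \<Rightarrow> real \<Rightarrow> (real \<Rightarrow> real) set" where
  "holder_class \<nu> \<beta> = {\<phi>.
     (\<forall>k<\<nu>. \<forall>x. (deriv ^^ k) \<phi> differentiable at x) \<and>
     bdd_above {\<bar>(deriv ^^ \<nu>) \<phi> x - (deriv ^^ \<nu>) \<phi> y\<bar> / \<bar>x - y\<bar> powr \<beta> | x y. x \<noteq> y}}"

definition cont_diff_class :: "nat \<Rightarrow> (real \<Rightarrow> real) set" where
  "cont_diff_class \<nu> = {\<phi>.
     (\<forall>k<\<nu>. \<forall>x. (deriv ^^ k) \<phi> differentiable at x) \<and>
     continuous_on UNIV ((deriv ^^ \<nu>) \<phi>)}"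

definition seq_ll :: "(nat \<Rightarrow> real) \<Rightarrow> (nat \<Rightarrow> real) \<Rightarrow> bool" where
  "seq_ll a b \<longleftrightarrow> (\<lambda>n. a n / b n) \<longlonglongrightarrow> 0"

(* The measurability conjunct is essential: measure assigns 0 to non-measurable sets. *)
definition small_o_prob ::
    "'a measure \<Rightarrow> (nat \<Rightarrow> 'a \<Rightarrow> real) \<Rightarrow> (nat \<Rightarrow> real) \<Rightarrow> bool" where
  "small_o_prob M Y b \<longleftrightarrow>
     (\<forall>n. Y n \<in> borel_measurable M) \<and>
     (\<forall>\<epsilon>>0. (\<lambda>n. measure M {\<omega> \<in> space M. \<bar>Y n \<omega>\<bar> > \<epsilon> * b n}) \<longlonglongrightarrow> 0)"

definition strictly_stationary :: "'a measure \<Rightarrow> (int \<Rightarrow> 'a \<Rightarrow> real) \<Rightarrow> bool" where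
  "strictly_stationary M X \<longleftrightarrow>
     (\<forall>t. X t \<in> borel_measurable M) \<and>
     (\<forall>J s. finite J \<longrightarrow>
        distr M (\<Pi>\<^sub>M t\<in>J. borel) (\<lambda>\<omega>. \<lambda>t\<in>J. X (t + s) \<omega>) =
        distr M (\<Pi>\<^sub>M t\<in>J. borel) (\<lambda>\<omega>. \<lambda>t\<in>J. X t \<omega>))"

definition ar_equation ::
    "'a measure \<Rightarrow> nat \<Rightarrow> (nat \<Rightarrow> real) \<Rightarrow> (int \<Rightarrow> 'a \<Rightarrow> real) \<Rightarrow> (int \<Rightarrow> 'a \<Rightarrow> real) \<Rightarrow> bool" where
  "ar_equation M p \<phi> X Z \<longleftrightarrow>
     (\<forall>t. AE \<omega> in M. X t \<omega> = (\<Sum>j=1..p. \<phi> j * X (t - int j) \<omega>) + Z t \<omega>)"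

definition causal_ar :: "nat \<Rightarrow> (nat \<Rightarrow> real) \<Rightarrow> bool" where
  "causal_ar p \<phi> \<longleftrightarrow>
     (INF z \<in> {z :: complex. cmod z \<le> 1}. cmod (1 - (\<Sum>j=1..p. of_real (\<phi> j) * z ^ j))) > 0"

(* Below, x (and e) is a fixed sample path of a process indexed by int. *)

definition acvf_hat :: "nat \<Rightarrow> nat \<Rightarrow> (int \<Rightarrow> real) \<Rightarrow> int \<Rightarrow> real" where
  "acvf_hat p n x l = (\<Sum>i = 1 - int p..int n - \<bar>l\<bar>. x i * x (i + \<bar>l\<bar>)) / real n"

(* Matrix and vector indices of Jordan_Normal_Form start at 0, hence the shift in gamma_vec_hat. *)
definition Gamma_hat :: "nat \<Rightarrow> nat \<Rightarrow> (int \<Rightarrow> real) \<Rightarrow> real mat" where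
  "Gamma_hat p n x = mat p p (\<lambda>(i, j). acvf_hat p n x (int i - int j))"

definition gamma_vec_hat :: "nat \<Rightarrow> nat \<Rightarrow> (int \<Rightarrow> real) \<Rightarrow> real Matrix.vec" where
  "gamma_vec_hat p n x = Matrix.vec p (\<lambda>i. acvf_hat p n x (int i + 1))"

(* The zero vector is an arbitrary default for a singular matrix. *)
definition yule_walker :: "nat \<Rightarrow> nat \<Rightarrow> (int \<Rightarrow> real) \<Rightarrow> real Matrix.vec" where
  "yule_walker p n x =
     (case mat_inverse (Gamma_hat p n x) of
        Some B \<Rightarrow> B *\<^sub>v gamma_vec_hat p n x
      | None \<Rightarrow> 0\<^sub>v p)"

definition residual :: "nat \<Rightarrow> nat \<Rightarrow> (int \<Rightarrow> real) \<Rightarrow> int \<Rightarrow> real" where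
  "residual p n x t =
     x t - (\<Sum>j=1..p. vec_index (yule_walker p n x) (j - 1) * x (t - int j))"

definition scaled_kernel :: "(real \<Rightarrow> real) \<Rightarrow> real \<Rightarrow> real \<Rightarrow> real" where
  "scaled_kernel K h u = K (u / h) / h"

definition kernel_cdf_est ::
    "(real \<Rightarrow> real) \<Rightarrow> real \<Rightarrow> nat \<Rightarrow> (int \<Rightarrow> real) \<Rightarrow> real \<Rightarrow> real" where
  "kernel_cdf_est K h n e z =
     (\<Sum>t = 1..int n. LINT u:{..z}|lborel. scaled_kernel K h (u - e t)) / real n"

definition F_tilde ::
    "(real \<Rightarrow> real) \<Rightarrow> real \<Rightarrow> nat \<Rightarrow> (int \<Rightarrow> 'a \<Rightarrow> real) \<Rightarrow> 'a \<Rightarrow> real \<Rightarrow> real" where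
  "F_tilde K h n Z \<omega> = kernel_cdf_est K h n (\<lambda>t. Z t \<omega>)"

definition F_hat ::
    "(real \<Rightarrow> real) \<Rightarrow> real \<Rightarrow> nat \<Rightarrow> nat \<Rightarrow> (int \<Rightarrow> 'a \<Rightarrow> real) \<Rightarrow> 'a \<Rightarrow> real \<Rightarrow> real" where
  "F_hat K h p n X \<omega> = kernel_cdf_est K h n (residual p n (\<lambda>t. X t \<omega>))"

definition sym_kernel :: "(real \<Rightarrow> real) \<Rightarrow> bool" where
  "sym_kernel K \<longleftrightarrow>
     (\<forall>u. 0 \<le> K u) \<and> (\<forall>u. K (- u) = K u) \<and> (\<forall>u. \<bar>u\<bar> > 1 \<longrightarrow> K u = 0) \<and>
     integrable lborel K \<and> integral\<^sup>L lborel K = 1"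

end

(*
  With E(z) and E^(z) the empirical distribution functions of the errors and of the residuals, the
  estimators are the convolutions of E and E^ with the probability density K_h, so it suffices that
  n^(1/2) |E^ - E| tends to 0 in probability uniformly on [- a_n - 1, a_n + 1]; of the bandwidth only
  h_n -> 0 matters. A residual is at most z iff Z_t <= z + d_t with d_t linear in
  X_(t-1), ..., X_(t-p) and coefficients phi^_j - phi_j = O_p(n^(-1/2)). On a grid for z and for
  n^(1/2) (phi^ - phi), the sums of 1{Z_t <= z + d_t} - 1{Z_t <= z} minus their compensators are sums
  of bounded martingale differences with conditional variance at most C_f |d_t|; an exponential
  inequality beats the polynomial number of grid points, and monotonicity of indicators fills the
  gaps. The compensator is, up to the Hoelder remainder, F'(z) times the sum of the d_t, which is
  o_p(n^(1/2)) because the sample mean of X tends to 0. Root-n consistency of the Yule-Walker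
  estimator follows from its normal equations and a lower bound on the empirical Gram matrix. All of
  this uses the causal representation of X as an absolutely convergent moving average of the errors.
*)
theory Submission
  imports
    Defs
    "Jordan_Normal_Form.Determinant"
    "HOL-Complex_Analysis.Cauchy_Integral_Formula"
    "HOL-Real_Asymp.Real_Asymp"
begin

section \<open>The causal power series\<close>

text \<open>The estimated coefficients depend on the whole sample, so the shift d_t built from them
  is not determined by the past and no martingale argument applies to it directly. Freezing n^(1/2)
  (phi^ - phi) at a deterministic vector restores this. Because that error is bounded in
  probability, a net of mesh \<rho> in a fixed box suffices, and box and mesh depend on the target
  precision but not on n: rounding costs about n^(1/2) \<rho> times an average of |X|, which is
  negligible once \<rho> is small. Only the grid for z, of mesh \<rho> n^(-1/2), grows with n. The
  exponents come from the fourth moment: n values of |X| all stay below n^(3/8) with probability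
  tending to 1, since n n^(-3/2) tends to 0; hence |d_t| <= n^(-1/8) up to a constant. With l =
  n^(-7/16) in the exponential inequality the variance term n l^2 n^(-1/8) is 1 while l n^(1/2) =
  n^(1/16), so a grid point fails with probability of order exp (- \<epsilon> n^(1/16)).\<close>

definition ar_coeff :: "nat \<Rightarrow> (nat \<Rightarrow> real) \<Rightarrow> nat \<Rightarrow> real" where
  "ar_coeff p \<phi> i = (if i = 0 then 1 else if i \<le> p then - \<phi> i else 0)"

lemma ar_poly_eq:
  "(\<Sum>i\<le>p. complex_of_real (ar_coeff p \<phi> i) * z ^ i) = 1 - (\<Sum>j=1..p. of_real (\<phi> j) * z ^ j)"
proof -
  have "{..p} = insert 0 {1..p}" by auto
  then have "(\<Sum>i\<le>p. complex_of_real (ar_coeff p \<phi> i) * z ^ i)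
      = 1 + (\<Sum>i=1..p. complex_of_real (ar_coeff p \<phi> i) * z ^ i)"
    by (simp add: ar_coeff_def)
  also have "(\<Sum>i=1..p. complex_of_real (ar_coeff p \<phi> i) * z ^ i) = - (\<Sum>j=1..p. of_real (\<phi> j) * z ^ j)"
    unfolding sum_negf [symmetric] by (intro sum.cong) (auto simp: ar_coeff_def)
  finally show ?thesis by simp
qed

text \<open>The \<psi> are the Taylor coefficients of the reciprocal of the autoregressive
  polynomial P. By compactness of the closed unit disc, P has no zero on a slightly larger disc, so
  the radius of convergence of 1/P exceeds 1 and its series converges absolutely at 1.\<close>

lemma causal_ar_inverse_summable:
  assumes "causal_ar p \<phi>"
  obtains \<psi> :: "nat \<Rightarrow> real"
  where "summable (\<lambda>j. \<bar>\<psi> j\<bar>)"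
    and "\<And>m. (\<Sum>j\<le>m. \<psi> j * ar_coeff p \<phi> (m - j)) = (if m = 0 then 1 else 0)"
proof -
  define P where "P z = (\<Sum>i\<le>p. complex_of_real (ar_coeff p \<phi> i) * z ^ i)" for z
  have nz: "P z \<noteq> 0" if "cmod z \<le> 1" for z
  proof -
    have "0 < (INF z \<in> {z :: complex. cmod z \<le> 1}. cmod (1 - (\<Sum>j=1..p. of_real (\<phi> j) * z ^ j)))"
      using assms by (simp add: causal_ar_def)
    also have "\<dots> \<le> cmod (1 - (\<Sum>j=1..p. of_real (\<phi> j) * z ^ j))"
      using that by (intro cINF_lower bdd_belowI[of _ 0]) auto
    finally show ?thesis by (auto simp: P_def ar_poly_eq)
  qed
  have "open {z. P z \<noteq> 0}"
    by (intro open_Collect_neq) (auto simp: P_def intro!: continuous_intros)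
  moreover have "cball 0 1 \<subseteq> {z. P z \<noteq> 0}" using nz by auto
  ultimately obtain e where e: "e > 0" "(\<Union>x\<in>cball 0 1. ball x e) \<subseteq> {z. P z \<noteq> 0}"
    using compact_subset_open_imp_ball_epsilon_subset[OF compact_cball] by metis
  define r where "r = 1 + e"
  have nz': "P z \<noteq> 0" if "cmod z < r" for z
  proof (cases "cmod z \<le> 1")
    case False
    \<comment> \<open>The radial projection of \<open>z\<close> to the unit circle, at distance
      \<open>cmod z - 1 < e\<close> from \<open>z\<close>.\<close>
    define w where "w = z / of_real (cmod z)"
    have "cmod w = 1" using False by (auto simp: w_def norm_divide)
    moreover have "dist w z < e"
    proof -
      have "cmod z \<noteq> 0" using False by auto
      then have "z - w = w * of_real (cmod z - 1)"
        unfolding w_def by (auto simp: divide_simps) (simp add: algebra_simps)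
      then have "dist w z = \<bar>cmod z - 1\<bar>"
        using \<open>cmod w = 1\<close> by (simp add: dist_norm norm_minus_commute[of w z] norm_mult del: of_real_diff)
      then show ?thesis using that False by (simp add: r_def)
    qed
    ultimately have "z \<in> (\<Union>x\<in>cball 0 1. ball x e)" by (intro UN_I[of w]) auto
    then show ?thesis using e(2) by blast
  qed (use nz in auto)
  define c where "c = Abs_fps (\<lambda>i. complex_of_real (ar_coeff p \<phi> i))"
  have rad: "fps_conv_radius c = \<infinity>"
  proof -
    have "eventually (\<lambda>n. fps_nth c n = 0) sequentially"
      using eventually_gt_at_top[of p] by eventually_elim (simp add: c_def ar_coeff_def)
    then have "conv_radius (fps_nth c) = conv_radius (\<lambda>_. 0 :: complex)" by (rule conv_radius_cong')
    then show ?thesis by (simp add: fps_conv_radius_def)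
  qed
  have eval: "eval_fps c z = P z" for z
  proof -
    have "(\<lambda>n. fps_nth c n * z ^ n) sums (\<Sum>n\<in>{..p}. fps_nth c n * z ^ n)"
      by (intro sums_finite) (auto simp: c_def ar_coeff_def)
    then show ?thesis by (simp add: eval_fps_def P_def c_def sums_iff)
  qed
  have "min (ereal r) (fps_conv_radius c) \<le> fps_conv_radius (inverse c)"
    using e(1) by (intro fps_conv_radius_inverse) (auto simp: eval nz' rad r_def eball_def dist_norm)
  then have rinv: "ereal r \<le> fps_conv_radius (inverse c)" by (simp add: rad)
  \<comment> \<open>Inverting over the reals gives real coefficients; uniqueness of inverses
    identifies them with those of the complex reciprocal, whose radius of convergence has just been
    bounded below.\<close>
  define ar where "ar = Abs_fps (ar_coeff p \<phi>)"
  define \<psi> where "\<psi> = fps_nth (inverse ar)"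
  have ar0: "fps_nth ar 0 \<noteq> 0" by (simp add: ar_def ar_coeff_def)
  have conv: "(\<Sum>j\<le>m. \<psi> j * ar_coeff p \<phi> (m - j)) = (if m = 0 then 1 else 0)" for m
  proof -
    have "fps_nth (inverse ar * ar) m = (if m = 0 then 1 else 0)"
      by (simp add: inverse_mult_eq_1[OF ar0])
    then show ?thesis by (simp add: fps_mult_nth \<psi>_def ar_def atMost_atLeast0)
  qed
  have "Abs_fps (\<lambda>j. complex_of_real (\<psi> j)) * c = 1"
  proof (rule fps_ext)
    fix m
    have "fps_nth (Abs_fps (\<lambda>j. complex_of_real (\<psi> j)) * c) m
        = complex_of_real (\<Sum>j\<le>m. \<psi> j * ar_coeff p \<phi> (m - j))"
      by (simp add: fps_mult_nth c_def atMost_atLeast0)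
    then show "fps_nth (Abs_fps (\<lambda>j. complex_of_real (\<psi> j)) * c) m = fps_nth 1 m"
      by (simp add: conv)
  qed
  then have "inverse c = Abs_fps (\<lambda>j. complex_of_real (\<psi> j))"
    using fps_inverse_unique[of c "Abs_fps (\<lambda>j. complex_of_real (\<psi> j))"] by (simp add: mult.commute)
  then have "conv_radius (\<lambda>j. complex_of_real (\<psi> j)) > ereal (norm (1::complex))"
    using rinv e(1)
    by (simp add: fps_conv_radius_def r_def one_ereal_def less_le_trans[of _ "ereal r"] del: norm_one)
  from abs_summable_in_conv_radius[OF this] have "summable (\<lambda>j. \<bar>\<psi> j\<bar>)" by simp
  with conv show thesis using that by blast
qed

section \<open>Kernel smoothing of empirical distribution functions\<close>

definition ecdf :: "nat \<Rightarrow> (int \<Rightarrow> real) \<Rightarrow> real \<Rightarrow> real" where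
  "ecdf n e y = (\<Sum>t = 1..int n. indicator {e t..} y) / real n"

lemma scaled_kernel_integral:
  assumes "sym_kernel K" "h > 0"
  shows "integrable lborel (scaled_kernel K h)" "integral\<^sup>L lborel (scaled_kernel K h) = 1"
proof -
  have "has_bochner_integral lborel K 1"
    using assms by (simp add: sym_kernel_def has_bochner_integral_iff)
  then have "has_bochner_integral lborel (\<lambda>u. K (0 + (1 / h) * u)) (1 /\<^sub>R \<bar>1 / h\<bar>)"
    using assms by (intro lborel_has_bochner_integral_real_affine_iff[THEN iffD1]) auto
  then have "has_bochner_integral lborel (\<lambda>u. K (u / h) / h) ((1 /\<^sub>R \<bar>1 / h\<bar>) / h)"
    by (intro has_bochner_integral_divide_zero) simp
  then show "integrable lborel (scaled_kernel K h)" "integral\<^sup>L lborel (scaled_kernel K h) = 1"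
    using assms(2) by (auto simp: scaled_kernel_def[abs_def] has_bochner_integral_iff)
qed

text \<open>The substitution u = x + w turns a smoothed jump at x into a kernel average of the sharp
  jump, evaluated at the displaced points z - w.\<close>

lemma scaled_kernel_cdf_shift:
  "(LINT u:{..z}|lborel. scaled_kernel K h (u - x))
     = (LINT w|lborel. scaled_kernel K h w * indicator {x..} (z - w))"
proof -
  have "(LINT u:{..z}|lborel. scaled_kernel K h (u - x))
      = (LINT u|lborel. indicator {..z} u * scaled_kernel K h (u - x))"
    by (simp add: set_lebesgue_integral_def)
  also have "\<dots> = (LINT w|lborel. indicator {..z} (x + 1 * w) * scaled_kernel K h (x + 1 * w - x))"
    by (subst lborel_integral_real_affine[where c = 1 and t = x]) auto
  also have "\<dots> = (LINT w|lborel. scaled_kernel K h w * indicator {x..} (z - w))"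
    by (intro Bochner_Integration.integral_cong) (auto simp: indicator_def)
  finally show ?thesis .
qed

lemma scaled_kernel_indicator_integrable:
  assumes "sym_kernel K" "h > 0"
  shows "integrable lborel (\<lambda>w. scaled_kernel K h w * indicator {x..} (z - w))"
proof -
  have "integrable lborel (\<lambda>w. indicator {..z - x} w *\<^sub>R scaled_kernel K h w)"
    using scaled_kernel_integral[OF assms] by (intro integrable_mult_indicator) auto
  moreover have "(\<lambda>w. indicator {..z - x} w *\<^sub>R scaled_kernel K h w)
      = (\<lambda>w. scaled_kernel K h w * indicator {x..} (z - w))"
    by (auto simp: indicator_def)
  ultimately show ?thesis by simp
qed

lemma kernel_cdf_est_convolution:
  assumes "sym_kernel K" "h > 0"
  shows "kernel_cdf_est K h n e z = (LINT w|lborel. scaled_kernel K h w * ecdf n e (z - w))"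
    and "integrable lborel (\<lambda>w. scaled_kernel K h w * ecdf n e (z - w))"
proof -
  note int = scaled_kernel_indicator_integrable[OF assms]
  have eq: "scaled_kernel K h w * ecdf n e (z - w)
      = (\<Sum>t = 1..int n. scaled_kernel K h w * indicator {e t..} (z - w)) / real n" for w
    by (simp add: ecdf_def sum_distrib_left)
  show "integrable lborel (\<lambda>w. scaled_kernel K h w * ecdf n e (z - w))"
    unfolding eq using int by (intro Bochner_Integration.integrable_divide_zero Bochner_Integration.integrable_sum) auto
  show "kernel_cdf_est K h n e z = (LINT w|lborel. scaled_kernel K h w * ecdf n e (z - w))"
    unfolding eq kernel_cdf_est_def scaled_kernel_cdf_shift using int
    by (subst Bochner_Integration.integral_divide_zero, subst Bochner_Integration.integral_sum) auto
qed

text \<open>Averaging against a probability density supported on [-h, h] cannot exceed the supremum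
  over that window. After this reduction only empirical distribution functions have to be
  compared.\<close>

lemma kernel_cdf_est_diff_le:
  assumes K: "sym_kernel K" and h: "h > 0"
    and D: "\<And>y. \<bar>y - z\<bar> \<le> h \<Longrightarrow> \<bar>ecdf n e y - ecdf n e' y\<bar> \<le> D"
  shows "\<bar>kernel_cdf_est K h n e z - kernel_cdf_est K h n e' z\<bar> \<le> D"
proof -
  let ?k = "scaled_kernel K h"
  note conv = kernel_cdf_est_convolution[OF K h]
  have pos: "0 \<le> ?k w" for w using K h by (simp add: scaled_kernel_def sym_kernel_def)
  have zero: "?k w = 0" if "\<bar>w\<bar> > h" for w
    using K h that by (auto simp: scaled_kernel_def sym_kernel_def field_simps)
  have "\<bar>kernel_cdf_est K h n e z - kernel_cdf_est K h n e' z\<bar>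
      = \<bar>LINT w|lborel. ?k w * (ecdf n e (z - w) - ecdf n e' (z - w))\<bar>"
    unfolding conv(1) by (subst Bochner_Integration.integral_diff[symmetric, OF conv(2) conv(2)]) (simp add: right_diff_distrib)
  also have "\<dots> \<le> (LINT w|lborel. \<bar>?k w * (ecdf n e (z - w) - ecdf n e' (z - w))\<bar>)"
    by (rule integral_abs_bound)
  also have "\<dots> \<le> (LINT w|lborel. ?k w * D)"
  proof (rule integral_mono)
    show "integrable lborel (\<lambda>w. \<bar>?k w * (ecdf n e (z - w) - ecdf n e' (z - w))\<bar>)"
      unfolding right_diff_distrib using conv(2) by (intro integrable_abs Bochner_Integration.integrable_diff) auto
    show "integrable lborel (\<lambda>w. ?k w * D)"
      using scaled_kernel_integral[OF K h] by auto
    show "\<bar>?k w * (ecdf n e (z - w) - ecdf n e' (z - w))\<bar> \<le> ?k w * D" for w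
    proof (cases "\<bar>w\<bar> > h")
      case False
      then show ?thesis using D[of "z - w"] pos[of w] by (auto simp: abs_mult intro!: mult_left_mono)
    qed (simp add: zero)
  qed
  also have "\<dots> = D" using scaled_kernel_integral[OF K h] by simp
  finally show ?thesis .
qed

lemma ecdf_bounds: "0 \<le> ecdf n e y" "ecdf n e y \<le> 1"
proof -
  show "0 \<le> ecdf n e y" unfolding ecdf_def by (intro divide_nonneg_nonneg sum_nonneg) auto
  have "(\<Sum>t = 1..int n. indicator {e t..} y :: real) \<le> (\<Sum>t = 1..int n. 1)"
    by (intro sum_mono) (auto simp: indicator_def)
  then show "ecdf n e y \<le> 1" unfolding ecdf_def by (cases "n = 0") (auto simp: divide_le_eq)
qed

lemma kernel_cdf_est_diff_le_1:
  assumes "sym_kernel K" "h > 0"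
  shows "\<bar>kernel_cdf_est K h n e z - kernel_cdf_est K h n e' z\<bar> \<le> 1"
proof (rule kernel_cdf_est_diff_le[OF assms])
  fix y
  show "\<bar>ecdf n e y - ecdf n e' y\<bar> \<le> 1"
    using ecdf_bounds[of n e y] ecdf_bounds[of n e' y] by linarith
qed

text \<open>Dominated convergence: the truncating indicators converge at every u except possibly u =
  z, a null set. Continuity is what makes the suprema over z measurable later.\<close>

lemma isCont_scaled_kernel_cdf:
  assumes "sym_kernel K" "h > 0"
  shows "isCont (\<lambda>z. LINT u:{..z}|lborel. scaled_kernel K h u) z"
  unfolding continuous_at_sequentially comp_def set_lebesgue_integral_def
proof (intro allI impI)
  fix s :: "nat \<Rightarrow> real" assume s: "s \<longlonglongrightarrow> z"
  let ?k = "scaled_kernel K h"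
  note int = scaled_kernel_integral(1)[OF assms]
  note [measurable] = borel_measurable_integrable[OF int]
  show "(\<lambda>n. LINT u|lborel. indicator {..s n} u *\<^sub>R ?k u) \<longlonglongrightarrow> (LINT u|lborel. indicator {..z} u *\<^sub>R ?k u)"
  proof (rule integral_dominated_convergence[where w = "\<lambda>u. \<bar>?k u\<bar>"])
    show "AE u in lborel. (\<lambda>n. indicator {..s n} u *\<^sub>R ?k u) \<longlonglongrightarrow> indicator {..z} u *\<^sub>R ?k u"
      using AE_lborel_singleton[of z]
    proof eventually_elim
      case (elim u)
      have "eventually (\<lambda>n. indicator {..s n} u = (indicator {..z} u :: real)) sequentially"
      proof (cases "u < z")
        case True
        then show ?thesis using order_tendstoD(1)[OF s True] by (auto elim!: eventually_mono)
      next
        case False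
        with elim have "z < u" by simp
        then show ?thesis using order_tendstoD(2)[OF s \<open>z < u\<close>] by (auto elim!: eventually_mono)
      qed
      then have "(\<lambda>n. indicator {..s n} u :: real) \<longlonglongrightarrow> indicator {..z} u"
        by (rule tendsto_eventually)
      then show ?case by (intro tendsto_intros)
    qed
    show "integrable lborel (\<lambda>u. \<bar>?k u\<bar>)" using int by simp
  qed (auto simp: indicator_def)
qed

text \<open>All dependence on the data and on z now sits in the upper limit of one fixed integral,
  so a single continuous function yields both continuity in z and measurability in the data.\<close>

lemma kernel_cdf_est_eq_shift:
  "kernel_cdf_est K h n e z
     = (\<Sum>t = 1..int n. (LINT u:{..z - e t}|lborel. scaled_kernel K h u)) / real n"
proof -
  have "(LINT u:{..z}|lborel. scaled_kernel K h (u - x)) = (LINT u:{..z - x}|lborel. scaled_kernel K h u)" for x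
    unfolding scaled_kernel_cdf_shift unfolding set_lebesgue_integral_def
    by (intro Bochner_Integration.integral_cong) (auto simp: indicator_def)
  then show ?thesis by (simp add: kernel_cdf_est_def)
qed

lemma continuous_kernel_cdf_est:
  assumes "sym_kernel K" "h > 0"
  shows "continuous_on UNIV (kernel_cdf_est K h n e)"
proof -
  have "continuous_on UNIV (\<lambda>z. LINT u:{..z}|lborel. scaled_kernel K h u)"
    using isCont_scaled_kernel_cdf[OF assms] by (simp add: continuous_on_eq_continuous_at)
  then have "continuous_on UNIV (\<lambda>z. LINT u:{..z - x}|lborel. scaled_kernel K h u)" for x
    by (rule continuous_on_compose2) (auto intro: continuous_intros)
  then show ?thesis
    unfolding kernel_cdf_est_eq_shift[abs_def] divide_inverse
    by (intro continuous_on_mult_right continuous_on_sum)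
qed

lemma borel_measurable_kernel_cdf_est:
  assumes "sym_kernel K" "h > 0" "\<And>t. t \<in> {1..int n} \<Longrightarrow> (\<lambda>\<omega>. e \<omega> t) \<in> borel_measurable M"
  shows "(\<lambda>\<omega>. kernel_cdf_est K h n (e \<omega>) z) \<in> borel_measurable M"
proof -
  have "continuous_on UNIV (\<lambda>z. LINT u:{..z}|lborel. scaled_kernel K h u)"
    using isCont_scaled_kernel_cdf[OF assms(1,2)] by (simp add: continuous_on_eq_continuous_at)
  from borel_measurable_continuous_onI[OF this] show ?thesis
    unfolding kernel_cdf_est_eq_shift using assms(3)
    by (intro borel_measurable_divide borel_measurable_sum measurable_compose[of _ M borel "\<lambda>z. LINT u:{..z}|lborel. scaled_kernel K h u"]) auto
qed

text \<open>By continuity the uncountable supremum equals one over a countable dense set, and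
  countable suprema of measurable functions are measurable.\<close>

lemma borel_measurable_cSUP_interval:
  fixes g :: "'a \<Rightarrow> real \<Rightarrow> real"
  assumes meas: "\<And>z. (\<lambda>\<omega>. g \<omega> z) \<in> borel_measurable M"
    and cont: "\<And>\<omega>. continuous_on UNIV (g \<omega>)"
    and bdd: "\<And>\<omega> z. g \<omega> z \<le> B"
  shows "(\<lambda>\<omega>. SUP z\<in>{l..u}. g \<omega> z) \<in> borel_measurable M"
proof (cases "l \<le> u")
  case True
  \<comment> \<open>Clamping to [l, u] lets all rationals serve as the dense set; the interval
    itself need not contain any when it is a single point.\<close>
  define c where "c z = max l (min u z)" for z :: real
  have "(SUP z\<in>{l..u}. g \<omega> z) = (SUP z\<in>\<rat>. g \<omega> (c z))" for \<omega>
  proof (rule antisym)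
    have bd: "bdd_above ((\<lambda>z. g \<omega> (c z)) ` \<rat>)" using bdd by (intro bdd_aboveI[of _ B]) auto
    show "(SUP z\<in>\<rat>. g \<omega> (c z)) \<le> (SUP z\<in>{l..u}. g \<omega> z)"
    proof (rule cSUP_least)
      show "(\<rat> :: real set) \<noteq> {}" using Rats_0 by blast
      show "g \<omega> (c q) \<le> (SUP z\<in>{l..u}. g \<omega> z)" for q
        using bdd True by (intro cSUP_upper bdd_aboveI[of _ B]) (auto simp: c_def)
    qed
    show "(SUP z\<in>{l..u}. g \<omega> z) \<le> (SUP z\<in>\<rat>. g \<omega> (c z))"
    proof (rule cSUP_least)
      fix z assume z: "z \<in> {l..u}"
      have "continuous_on (closure \<rat>) (\<lambda>z. g \<omega> (c z))"
        unfolding c_def using cont[of \<omega>]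
        by (intro continuous_on_compose2[OF cont] continuous_intros) auto
      moreover note Rats_closure_real
      ultimately have "g \<omega> (c z) \<le> (SUP z\<in>\<rat>. g \<omega> (c z))"
        using continuous_le_on_closure[of \<rat> "\<lambda>z. g \<omega> (c z)" z "SUP z\<in>\<rat>. g \<omega> (c z)"] cSUP_upper[OF _ bd]
        by blast
      then show "g \<omega> z \<le> (SUP z\<in>\<rat>. g \<omega> (c z))" using z by (simp add: c_def)
    qed (use True in auto)
  qed
  moreover have "(\<lambda>\<omega>. SUP z\<in>\<rat>. g \<omega> (c z)) \<in> borel_measurable M"
    using bdd by (intro borel_measurable_cSUP countable_rat meas bdd_aboveI[of _ B]) blast
  ultimately show ?thesis by simp
qed simp

section \<open>The Yule--Walker estimator\<close>

definition mean :: "nat \<Rightarrow> (int \<Rightarrow> real) \<Rightarrow> real" where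
  "mean n g = (\<Sum>t = 1..int n. g t) / real n"

lemma mean_mono: "(\<And>t. g t \<le> g' t) \<Longrightarrow> mean n g \<le> mean n g'"
  unfolding mean_def by (intro divide_right_mono sum_mono) auto

lemma mean_nonneg: "(\<And>t. 0 \<le> g t) \<Longrightarrow> 0 \<le> mean n g"
  unfolding mean_def by (intro divide_nonneg_nonneg sum_nonneg) auto

lemma mean_add: "mean n (\<lambda>t. g t + g' t) = mean n g + mean n g'"
  by (simp add: mean_def sum.distrib add_divide_distrib)

lemma mean_cmult: "mean n (\<lambda>t. a * g t) = a * mean n g"
  by (simp add: mean_def sum_distrib_left)

lemma mean_sum: "mean n (\<lambda>t. \<Sum>i\<in>I. g i t) = (\<Sum>i\<in>I. mean n (g i))"
  unfolding mean_def by (subst sum.swap) (simp add: sum_divide_distrib)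

text \<open>Peeling off one innovation at a time: the most recent innovation contributes
  \<open>v k ^ 2 * s\<close> to the mean square up to the cross terms, and deleting the summand
  \<open>v k * x (t - k)\<close> costs at most a multiple of \<open>v k ^ 2\<close>.\<close>
lemma ar_gram_form_lower_bound:
  fixes \<phi> :: "nat \<Rightarrow> real"
  assumes p: "p \<ge> 1" and s: "s > 0" and B: "B \<ge> 0"
  obtains c \<tau> where "c > 0" "\<tau> > 0"
    "\<And>n x z v. n \<ge> 1 \<Longrightarrow> (\<And>t. x t = (\<Sum>j=1..p. \<phi> j * x (t - int j)) + z t) \<Longrightarrow>
      (\<And>k. k \<in> {1..p} \<Longrightarrow> mean n (\<lambda>t. (x (t - int k))\<^sup>2) \<le> B) \<Longrightarrow>
      (\<And>k. k \<in> {1..p} \<Longrightarrow> mean n (\<lambda>t. (z (t - int k))\<^sup>2) \<ge> s) \<Longrightarrow>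
      (\<And>k i. k \<in> {1..p} \<Longrightarrow> i \<in> {1..p} \<Longrightarrow>
         \<bar>mean n (\<lambda>t. z (t - int k) * x (t - int k - int i))\<bar> \<le> \<tau>) \<Longrightarrow>
      c * (\<Sum>k=1..p. (v k)\<^sup>2) \<le> mean n (\<lambda>t. (\<Sum>i=1..p. v i * x (t - int i))\<^sup>2)"
proof -
  define C where "C = 2 * (\<Sum>i=1..p. \<bar>\<phi> i\<bar> + 1)"
  define A where "A = 2 + 2 * B / s"
  define G where "G = real p * (A + 1) ^ p / s"
  have "real p \<le> (\<Sum>i=1..p. \<bar>\<phi> i\<bar> + 1)"
    using sum_mono[of "{1..p}" "\<lambda>_. 1 :: real" "\<lambda>i. \<bar>\<phi> i\<bar> + 1"] by simp
  then have C: "C > 0" using p by (simp add: C_def)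
  have A: "A \<ge> 2" using s B by (simp add: A_def)
  have G: "G > 0" using s A p by (simp add: G_def)
  \<comment> \<open>With this choice the accumulated cross-term error \<open>G * E\<close> equals
    \<open>V / 2\<close>, which the left-hand side \<open>V\<close> absorbs at the end.\<close>
  define \<tau> where "\<tau> = 1 / (2 * G * C)"
  have \<tau>: "\<tau> > 0" using G C by (simp add: \<tau>_def)
  show thesis
  proof (rule that[of "1 / (2 * G)" \<tau>])
    fix n :: nat and x z :: "int \<Rightarrow> real" and v :: "nat \<Rightarrow> real"
    assume n: "n \<ge> 1" and ar: "\<And>t. x t = (\<Sum>j=1..p. \<phi> j * x (t - int j)) + z t"
      and xB: "\<And>k. k \<in> {1..p} \<Longrightarrow> mean n (\<lambda>t. (x (t - int k))\<^sup>2) \<le> B"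
      and zs: "\<And>k. k \<in> {1..p} \<Longrightarrow> mean n (\<lambda>t. (z (t - int k))\<^sup>2) \<ge> s"
      and zx: "\<And>k i. k \<in> {1..p} \<Longrightarrow> i \<in> {1..p} \<Longrightarrow>
         \<bar>mean n (\<lambda>t. z (t - int k) * x (t - int k - int i))\<bar> \<le> \<tau>"
    define V where "V = (\<Sum>k=1..p. (v k)\<^sup>2)"
    define w where "w k t = (\<Sum>i=k..p. v i * x (t - int i))" for k t
    define T where "T k = mean n (\<lambda>t. (w k t)\<^sup>2)" for k
    define E where "E = C * \<tau> * V"
    have V: "V \<ge> 0" unfolding V_def by (intro sum_nonneg) auto
    have E: "E \<ge> 0" using V C \<tau> by (simp add: E_def)
    have T0: "T k \<ge> 0" for k unfolding T_def by (intro mean_nonneg) auto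
    have vV: "(v k)\<^sup>2 \<le> V" if "k \<in> {1..p}" for k
      unfolding V_def by (intro member_le_sum) (use that in auto)
    have vvV: "\<bar>v k * v l\<bar> \<le> V" if "k \<in> {1..p}" "l \<in> {1..p}" for k l
    proof -
      have "2 * \<bar>v k * v l\<bar> \<le> (v k)\<^sup>2 + (v l)\<^sup>2"
        using sum_squares_bound[of "\<bar>v k\<bar>" "\<bar>v l\<bar>"] by (simp add: abs_mult mult.assoc)
      then show ?thesis using vV[OF that(1)] vV[OF that(2)] by linarith
    qed
    have w_step: "w k t = v k * x (t - int k) + w (Suc k) t" if "k \<in> {1..p}" for k t
      using that by (simp add: w_def sum.atLeast_Suc_atMost)
    have lower: "s * (v k)\<^sup>2 \<le> T k + E" if k: "k \<in> {1..p}" for k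
    proof -
      \<comment> \<open>Coefficients after \<open>x (t - k)\<close> has been expanded by its
        autoregressive equation. Besides \<open>v k * z (t - k)\<close>, only values of
        \<open>x\<close> strictly before time \<open>t - k\<close> remain, and their mean products
        with \<open>z (t - k)\<close> are at most \<tau>.\<close>
      define u where "u i = v k * \<phi> i + (if k + i \<le> p then v (k + i) else 0)" for i
      have w_eq: "w k t = v k * z (t - int k) + (\<Sum>i=1..p. u i * x (t - int k - int i))" for t
      proof -
        have "w (Suc k) t = (\<Sum>i=1..p-k. v (k + i) * x (t - int (k + i)))"
          unfolding w_def using k
          by (intro sum.reindex_bij_witness[of _ "\<lambda>i. k + i" "\<lambda>i. i - k"]) auto
        also have "\<dots> = (\<Sum>i=1..p. (if k + i \<le> p then v (k + i) else 0) * x (t - int k - int i))"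
          by (intro sum.mono_neutral_cong_left) (auto simp: algebra_simps)
        finally have "w (Suc k) t = (\<Sum>i=1..p. (if k + i \<le> p then v (k + i) else 0) * x (t - int k - int i))" .
        then show ?thesis
          unfolding w_step[OF k] ar[of "t - int k"]
          by (simp add: u_def algebra_simps sum.distrib sum_distrib_left)
      qed
      have uV: "\<bar>v k * u i\<bar> \<le> V * (\<bar>\<phi> i\<bar> + 1)" if i: "i \<in> {1..p}" for i
      proof -
        have "\<bar>v k * u i\<bar> \<le> (v k)\<^sup>2 * \<bar>\<phi> i\<bar> + \<bar>v k * (if k + i \<le> p then v (k + i) else 0)\<bar>"
          unfolding u_def distrib_left
          by (rule order_trans[OF abs_triangle_ineq]) (simp add: abs_mult power2_eq_square)
        also have "\<dots> \<le> V * \<bar>\<phi> i\<bar> + V"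
          using vV[OF k] vvV[OF k, of "k + i"] V i
          by (intro add_mono mult_right_mono) auto
        finally show ?thesis by (simp add: algebra_simps)
      qed
      \<comment> \<open>The square of the part that precedes the innovation is discarded; the
        innovation's square and the cross terms are kept.\<close>
      have "(w k t)\<^sup>2 \<ge> (v k)\<^sup>2 * (z (t - int k))\<^sup>2
          + (\<Sum>i=1..p. (2 * (v k * u i)) * (z (t - int k) * x (t - int k - int i)))" for t
      proof -
        define y where "y = (\<Sum>i=1..p. u i * x (t - int k - int i))"
        have "(v k * z (t - int k) + y)\<^sup>2 \<ge> (v k)\<^sup>2 * (z (t - int k))\<^sup>2 + 2 * (v k * z (t - int k)) * y"
          by (simp add: power2_sum power_mult_distrib)
        also have "2 * (v k * z (t - int k)) * y
            = (\<Sum>i=1..p. (2 * (v k * u i)) * (z (t - int k) * x (t - int k - int i)))"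
          by (simp add: y_def sum_distrib_left algebra_simps)
        finally show ?thesis by (simp add: w_eq y_def)
      qed
      from mean_mono[OF this]
      have "(v k)\<^sup>2 * mean n (\<lambda>t. (z (t - int k))\<^sup>2)
          + (\<Sum>i=1..p. (2 * (v k * u i)) * mean n (\<lambda>t. z (t - int k) * x (t - int k - int i))) \<le> T k"
        unfolding T_def mean_add mean_sum mean_cmult .
      moreover have "(v k)\<^sup>2 * mean n (\<lambda>t. (z (t - int k))\<^sup>2) \<ge> (v k)\<^sup>2 * s"
        using zs[OF k] by (intro mult_left_mono) auto
      moreover have "\<bar>\<Sum>i=1..p. (2 * (v k * u i)) * mean n (\<lambda>t. z (t - int k) * x (t - int k - int i))\<bar> \<le> E"
      proof -
        have "\<bar>\<Sum>i=1..p. (2 * (v k * u i)) * mean n (\<lambda>t. z (t - int k) * x (t - int k - int i))\<bar>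
           \<le> (\<Sum>i=1..p. \<bar>(2 * (v k * u i)) * mean n (\<lambda>t. z (t - int k) * x (t - int k - int i))\<bar>)"
          by (rule sum_abs)
        also have "\<dots> \<le> (\<Sum>i=1..p. (2 * (V * (\<bar>\<phi> i\<bar> + 1))) * \<tau>)"
        proof (rule sum_mono)
          fix i assume i: "i \<in> {1..p}"
          have "\<bar>2 * (v k * u i)\<bar> \<le> 2 * (V * (\<bar>\<phi> i\<bar> + 1))" using uV[OF i] by (simp add: abs_mult)
          then show "\<bar>(2 * (v k * u i)) * mean n (\<lambda>t. z (t - int k) * x (t - int k - int i))\<bar>
              \<le> (2 * (V * (\<bar>\<phi> i\<bar> + 1))) * \<tau>"
            unfolding abs_mult[of "2 * (v k * u i)"] using zx[OF k i] V by (intro mult_mono) auto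
        qed
        also have "\<dots> = E" unfolding E_def C_def by (simp add: sum_distrib_left sum_distrib_right algebra_simps)
        finally show ?thesis .
      qed
      ultimately show ?thesis by (simp add: mult.commute)
    qed
    \<comment> \<open>Carrying \<open>E\<close> along on both sides keeps the recursion purely
      multiplicative, so iterating it costs at most the factor \<open>(A + 1) ^ p\<close>.\<close>
    have step: "T (Suc k) + E \<le> (A + 1) * (T k + E)" if k: "k \<in> {1..p}" for k
    proof -
      have "(w (Suc k) t)\<^sup>2 \<le> 2 * (w k t)\<^sup>2 + (2 * (v k)\<^sup>2) * (x (t - int k))\<^sup>2" for t
      proof -
        have "(a - b)\<^sup>2 \<le> 2 * a\<^sup>2 + 2 * b\<^sup>2" for a b :: real
          using zero_le_power2[of "a + b"] unfolding power2_sum power2_diff by linarith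
        from this[of "w k t" "v k * x (t - int k)"] show ?thesis
          by (simp add: w_step[OF k] power_mult_distrib)
      qed
      from mean_mono[OF this] have "T (Suc k) \<le> 2 * T k + (2 * (v k)\<^sup>2) * mean n (\<lambda>t. (x (t - int k))\<^sup>2)"
        unfolding T_def mean_add mean_cmult .
      also have "\<dots> \<le> 2 * T k + (2 * (v k)\<^sup>2) * B"
        using xB[OF k] by (intro add_left_mono mult_left_mono) auto
      also have "(2 * (v k)\<^sup>2) * B \<le> (2 * B / s) * (T k + E)"
        using mult_left_mono[OF lower[OF k], of "2 * B / s"] s B by (simp add: mult_ac)
      finally have "T (Suc k) \<le> 2 * T k + (2 * B / s) * (T k + E)" by simp
      then show ?thesis using E T0[of k] by (simp add: A_def algebra_simps)
    qed
    have iter: "k < p \<Longrightarrow> T (Suc k) + E \<le> (A + 1) ^ k * (T 1 + E)" for k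
    proof (induction k)
      case (Suc k)
      have "T (Suc (Suc k)) + E \<le> (A + 1) * (T (Suc k) + E)" using Suc.prems by (intro step) auto
      also have "\<dots> \<le> (A + 1) * ((A + 1) ^ k * (T 1 + E))" using Suc A by (intro mult_left_mono) auto
      finally show ?case by simp
    qed simp
    have "V \<le> (\<Sum>k=1..p. (A + 1) ^ p * (T 1 + E) / s)"
      unfolding V_def
    proof (rule sum_mono)
      fix k assume k: "k \<in> {1..p}"
      have "s * (v k)\<^sup>2 \<le> T (Suc (k - 1)) + E" using lower[OF k] k by simp
      also have "\<dots> \<le> (A + 1) ^ (k - 1) * (T 1 + E)" using k by (intro iter) auto
      also have "\<dots> \<le> (A + 1) ^ p * (T 1 + E)"
        using k A E T0[of 1] by (intro mult_right_mono power_increasing) auto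
      finally show "(v k)\<^sup>2 \<le> (A + 1) ^ p * (T 1 + E) / s" using s by (simp add: field_simps)
    qed
    also have "\<dots> = G * (T 1 + E)" by (simp add: G_def)
    also have "\<dots> = G * T 1 + V / 2" using G C by (simp add: E_def \<tau>_def field_simps)
    finally have "V \<le> 2 * G * T 1" by linarith
    then show "1 / (2 * G) * (\<Sum>k=1..p. (v k)\<^sup>2) \<le> mean n (\<lambda>t. (\<Sum>i=1..p. v i * x (t - int i))\<^sup>2)"
      using G by (simp add: V_def T_def w_def field_simps)
  qed (use G \<tau> in auto)
qed

section \<open>Normal equations of the Yule--Walker estimator\<close>

definition zero_pad :: "nat \<Rightarrow> nat \<Rightarrow> (int \<Rightarrow> real) \<Rightarrow> int \<Rightarrow> real" where
  "zero_pad p n x s = (if s \<in> {1 - int p..int n} then x s else 0)"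

text \<open>The zero extension makes the range of summation independent of the lags, since the
  window contains every shift of the sample by at most p. The Toeplitz matrix of sample
  autocovariances thereby becomes the Gram matrix of shifted sequences.\<close>

lemma acvf_hat_zero_pad:
  assumes "i \<le> p" "j \<le> p" "n \<ge> 1"
  shows "acvf_hat p n x (int i - int j)
     = (\<Sum>s = 1 - int p..int n + int p. zero_pad p n x (s - int i) * zero_pad p n x (s - int j)) / real n"
proof -
  have *: "(\<Sum>u = 1 - int p..int n - (int j - int i). x u * x (u + (int j - int i)))
     = (\<Sum>s = 1 - int p..int n + int p. zero_pad p n x (s - int i) * zero_pad p n x (s - int j))"
    if "i \<le> j" "j \<le> p" for i j
  proof -
    have "(\<Sum>u = 1 - int p..int n - (int j - int i). x u * x (u + (int j - int i)))
      = (\<Sum>s = 1 - int p + int j..int n + int i. zero_pad p n x (s - int i) * zero_pad p n x (s - int j))"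
      using that
      by (intro sum.reindex_bij_witness[of _ "\<lambda>s. s - int j" "\<lambda>u. u + int j"])
         (auto simp: zero_pad_def algebra_simps)
    also have "\<dots> = (\<Sum>s = 1 - int p..int n + int p. zero_pad p n x (s - int i) * zero_pad p n x (s - int j))"
      using that by (intro sum.mono_neutral_left) (auto simp: zero_pad_def)
    finally show ?thesis .
  qed
  show ?thesis
  proof (cases "i \<le> j")
    case True
    then have "\<bar>int i - int j\<bar> = int j - int i" by simp
    then show ?thesis using *[of i j] True assms by (simp add: acvf_hat_def)
  next
    case False
    then have "\<bar>int i - int j\<bar> = int i - int j" by simp
    then show ?thesis using *[of j i] False assms by (simp add: acvf_hat_def mult.commute)
  qed
qed

text \<open>A Gram form is a sum of squares over the whole window. Dropping the times outside 1..n
  can only decrease it, and at the remaining times all lags 1..p lie in the sample, where the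
  padding is invisible.\<close>

lemma acvf_hat_quadratic_form:
  assumes "n \<ge> 1"
  shows "mean n (\<lambda>t. (\<Sum>i=1..p. v i * x (t - int i))\<^sup>2)
     \<le> (\<Sum>i=1..p. v i * (\<Sum>j=1..p. acvf_hat p n x (int i - int j) * v j))"
proof -
  let ?W = "{1 - int p..int n + int p}" and ?y = "zero_pad p n x"
  have "(\<Sum>i=1..p. v i * (\<Sum>j=1..p. acvf_hat p n x (int i - int j) * v j))
     = (\<Sum>i=1..p. \<Sum>j=1..p. \<Sum>s\<in>?W. v i * (?y (s - int i) * ?y (s - int j)) * v j / real n)"
    unfolding sum_distrib_left using assms
    by (intro sum.cong refl)
       (simp add: acvf_hat_zero_pad sum_distrib_left sum_distrib_right sum_divide_distrib mult.assoc)
  also have "\<dots> = (\<Sum>s\<in>?W. \<Sum>i=1..p. \<Sum>j=1..p. v i * (?y (s - int i) * ?y (s - int j)) * v j / real n)"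
    by (subst sum.swap[of _ ?W], subst sum.swap[of _ _ ?W]) simp
  also have "\<dots> = (\<Sum>s\<in>?W. (\<Sum>i=1..p. v i * ?y (s - int i))\<^sup>2 / real n)"
    by (intro sum.cong refl)
       (simp add: power2_eq_square sum_product sum_divide_distrib algebra_simps)
  also have "\<dots> \<ge> (\<Sum>s\<in>{1..int n}. (\<Sum>i=1..p. v i * ?y (s - int i))\<^sup>2 / real n)"
    by (intro sum_mono2) auto
  also have "(\<Sum>s\<in>{1..int n}. (\<Sum>i=1..p. v i * ?y (s - int i))\<^sup>2 / real n)
      = mean n (\<lambda>t. (\<Sum>i=1..p. v i * x (t - int i))\<^sup>2)"
    unfolding mean_def sum_divide_distrib
    by (intro sum.cong arg_cong2[where f = "(/)"] arg_cong[where f = "\<lambda>x. x ^ 2"] refl) (auto simp: zero_pad_def)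
  finally show ?thesis .
qed

abbreviation boundary_energy :: "nat \<Rightarrow> nat \<Rightarrow> (int \<Rightarrow> real) \<Rightarrow> real" where
  "boundary_energy p n x \<equiv> \<Sum>s\<in>{1 - int p..0} \<union> {int n + 1..int n + int p}. \<Sum>k\<le>p. (x (s - int k))\<^sup>2"

text \<open>At times 1..n the padded sequence obeys the autoregressive equation and leaves
  \<open>x (t - i) * z t\<close>. The equation can fail only at the 2p remaining window times, where
  the products are controlled by the squares in \<open>boundary_energy\<close>.\<close>

lemma acvf_hat_normal_equation:
  assumes n: "n \<ge> 1" and i: "i \<in> {1..p}"
    and ar: "\<And>t. x t = (\<Sum>j=1..p. \<phi> j * x (t - int j)) + z t"
  shows "\<bar>acvf_hat p n x (int i) - (\<Sum>j=1..p. acvf_hat p n x (int i - int j) * \<phi> j)\<bar>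
     \<le> \<bar>mean n (\<lambda>t. x (t - int i) * z t)\<bar>
       + (1 + (\<Sum>j=1..p. \<bar>\<phi> j\<bar>)) * boundary_energy p n x / real n"
proof -
  let ?W = "{1 - int p..int n + int p}" and ?y = "zero_pad p n x"
  let ?b = "{1 - int p..0} \<union> {int n + 1..int n + int p}"
  define d where "d s = ?y (s - int i) * (?y s - (\<Sum>j=1..p. \<phi> j * ?y (s - int j)))" for s
  have "acvf_hat p n x (int i) - (\<Sum>j=1..p. acvf_hat p n x (int i - int j) * \<phi> j)
      = (\<Sum>s\<in>?W. ?y (s - int i) * ?y s) / real n
        - (\<Sum>j=1..p. (\<Sum>s\<in>?W. ?y (s - int i) * ?y (s - int j)) / real n * \<phi> j)"
    using acvf_hat_zero_pad[of i p 0 n x] n i by (simp add: acvf_hat_zero_pad)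
  also have "(\<Sum>j=1..p. (\<Sum>s\<in>?W. ?y (s - int i) * ?y (s - int j)) / real n * \<phi> j)
      = (\<Sum>s\<in>?W. \<Sum>j=1..p. ?y (s - int i) * (\<phi> j * ?y (s - int j))) / real n"
    by (subst sum.swap) (simp add: sum_divide_distrib sum_distrib_right sum_distrib_left algebra_simps)
  also have "(\<Sum>s\<in>?W. ?y (s - int i) * ?y s) / real n - \<dots> = (\<Sum>s\<in>?W. d s) / real n"
    unfolding diff_divide_distrib[symmetric] sum_subtractf[symmetric]
    by (simp add: d_def right_diff_distrib sum_distrib_left)
  also have "?W = {1..int n} \<union> ?b" by auto
  also have "(\<Sum>s\<in>{1..int n} \<union> ?b. d s) = (\<Sum>s\<in>{1..int n}. d s) + (\<Sum>s\<in>?b. d s)"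
    by (intro sum.union_disjoint) auto
  also have "(\<Sum>s\<in>{1..int n}. d s) = (\<Sum>t\<in>{1..int n}. x (t - int i) * z t)"
  proof (intro sum.cong refl)
    fix t assume t: "t \<in> {1..int n}"
    have "(\<Sum>j=1..p. \<phi> j * ?y (t - int j)) = (\<Sum>j=1..p. \<phi> j * x (t - int j))"
      using t by (intro sum.cong) (auto simp: zero_pad_def)
    then show "d t = x (t - int i) * z t"
      using t i ar[of t] by (auto simp: d_def zero_pad_def)
  qed
  finally have "\<bar>acvf_hat p n x (int i) - (\<Sum>j=1..p. acvf_hat p n x (int i - int j) * \<phi> j)\<bar>
      \<le> \<bar>mean n (\<lambda>t. x (t - int i) * z t)\<bar> + \<bar>\<Sum>s\<in>?b. d s\<bar> / real n"
    by (simp add: mean_def add_divide_distrib abs_triangle_ineq[THEN order_trans])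
  also have "\<bar>\<Sum>s\<in>?b. d s\<bar> \<le> (\<Sum>s\<in>?b. \<bar>d s\<bar>)" by (rule sum_abs)
  also have "\<dots> \<le> (\<Sum>s\<in>?b. (1 + (\<Sum>j=1..p. \<bar>\<phi> j\<bar>)) * (\<Sum>k\<le>p. (x (s - int k))\<^sup>2))"
  proof (rule sum_mono)
    fix s
    define S where "S = (\<Sum>k\<le>p. (x (s - int k))\<^sup>2)"
    have le: "(?y (s - int k))\<^sup>2 \<le> S" if "k \<le> p" for k
    proof -
      have "(?y (s - int k))\<^sup>2 \<le> (x (s - int k))\<^sup>2" by (simp add: zero_pad_def)
      also have "\<dots> \<le> S" unfolding S_def using that by (intro member_le_sum) auto
      finally show ?thesis .
    qed
    have prod: "\<bar>?y (s - int k) * ?y (s - int l)\<bar> \<le> S" if "k \<le> p" "l \<le> p" for k l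
    proof -
      have "2 * \<bar>?y (s - int k) * ?y (s - int l)\<bar> \<le> (?y (s - int k))\<^sup>2 + (?y (s - int l))\<^sup>2"
        using sum_squares_bound[of "\<bar>?y (s - int k)\<bar>" "\<bar>?y (s - int l)\<bar>"] by (simp add: abs_mult mult.assoc)
      with le[OF that(1)] le[OF that(2)] show ?thesis by linarith
    qed
    have "d s = ?y (s - int i) * ?y (s - int 0) - (\<Sum>j=1..p. \<phi> j * (?y (s - int i) * ?y (s - int j)))"
      by (simp add: d_def right_diff_distrib sum_distrib_left algebra_simps)
    also have "\<bar>\<dots>\<bar> \<le> \<bar>?y (s - int i) * ?y (s - int 0)\<bar> + \<bar>\<Sum>j=1..p. \<phi> j * (?y (s - int i) * ?y (s - int j))\<bar>"
      by (rule abs_triangle_ineq4)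
    also have "\<dots> \<le> S + (\<Sum>j=1..p. \<bar>\<phi> j\<bar> * S)"
    proof (intro add_mono order_trans[OF sum_abs] sum_mono)
      show "\<bar>?y (s - int i) * ?y (s - int 0)\<bar> \<le> S" using i by (intro prod) auto
      show "\<bar>\<phi> j * (?y (s - int i) * ?y (s - int j))\<bar> \<le> \<bar>\<phi> j\<bar> * S" if "j \<in> {1..p}" for j
        unfolding abs_mult[of "\<phi> j"] using i that by (intro mult_left_mono prod) auto
    qed
    finally show "\<bar>d s\<bar> \<le> (1 + (\<Sum>j=1..p. \<bar>\<phi> j\<bar>)) * (\<Sum>k\<le>p. (x (s - int k))\<^sup>2)"
      by (simp add: S_def sum_distrib_right distrib_right)
  qed
  finally show ?thesis by (simp add: sum_distrib_left divide_right_mono)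
qed

text \<open>A positive definite matrix has trivial kernel, hence nonzero determinant; the default
  branch of \<open>yule_walker\<close> is excluded and the estimator truly solves its linear
  system.\<close>

lemma yule_walker_solution:
  assumes c: "c > 0"
    and pos: "\<And>v. c * (\<Sum>k=1..p. (v k)\<^sup>2)
       \<le> (\<Sum>i=1..p. v i * (\<Sum>j=1..p. acvf_hat p n x (int i - int j) * v j))"
    and i: "i \<in> {1..p}"
  shows "(\<Sum>j=1..p. acvf_hat p n x (int i - int j) * vec_index (yule_walker p n x) (j - 1)) = acvf_hat p n x (int i)"
proof -
  let ?G = "Gamma_hat p n x"
  have G: "?G \<in> carrier_mat p p" by (simp add: Gamma_hat_def)
  have G_mult: "vec_index (?G *\<^sub>v w) i = (\<Sum>j=1..p. acvf_hat p n x (int (Suc i) - int j) * vec_index w (j - 1))"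
    if "w \<in> carrier_vec p" "i < p" for w i
    using that
    by (simp add: Gamma_hat_def scalar_prod_def sum.atLeast1_atMost_eq atLeast0LessThan)
  have "Determinant.det ?G \<noteq> 0"
  proof
    assume "Determinant.det ?G = 0"
    then obtain w where w: "w \<in> carrier_vec p" "w \<noteq> 0\<^sub>v p" "?G *\<^sub>v w = 0\<^sub>v p"
      using det_0_iff_vec_prod_zero_field[OF G] by blast
    have z: "(\<Sum>j=1..p. acvf_hat p n x (int i - int j) * vec_index w (j - 1)) = 0" if "i \<in> {1..p}" for i
    proof -
      have "i - 1 < p" "Suc (i - 1) = i" using that by auto
      then show ?thesis using G_mult[OF w(1), of "i - 1"] w(3) by simp
    qed
    have "c * (\<Sum>k=1..p. (vec_index w (k - 1))\<^sup>2) \<le> 0"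
      using pos[of "\<lambda>k. vec_index w (k - 1)"] z by simp
    then have "(\<Sum>k=1..p. (vec_index w (k - 1))\<^sup>2) \<le> 0"
      using c by (simp add: mult_le_0_iff)
    moreover have "(\<Sum>k=1..p. (vec_index w (k - 1))\<^sup>2) \<ge> 0" by (intro sum_nonneg) auto
    ultimately have "(\<Sum>k=1..p. (vec_index w (k - 1))\<^sup>2) = 0" by linarith
    then have w0: "vec_index w (k - 1) = 0" if "k \<in> {1..p}" for k
      using that by (subst (asm) sum_nonneg_eq_0_iff) auto
    have "vec_index w k = 0" if "k < p" for k
      using w0[of "Suc k"] that by simp
    then have "w = 0\<^sub>v p" using w(1) by (intro eq_vecI) auto
    with w(2) show False by simp
  qed
  then have "?G \<in> Units (ring_mat TYPE(real) p ())" by (rule det_non_zero_imp_unit[OF G])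
  then obtain Bm where Bm: "mat_inverse ?G = Some Bm"
    using mat_inverse(1)[OF G, of "()"] by (cases "mat_inverse ?G") auto
  from mat_inverse(2)[OF G Bm] have Bm': "?G * Bm = 1\<^sub>m p" "Bm \<in> carrier_mat p p" by auto
  have g: "gamma_vec_hat p n x \<in> carrier_vec p" by (simp add: gamma_vec_hat_def)
  have yw: "yule_walker p n x = Bm *\<^sub>v gamma_vec_hat p n x" by (simp add: yule_walker_def Bm)
  then have "?G *\<^sub>v yule_walker p n x = gamma_vec_hat p n x"
    using assoc_mult_mat_vec[OF G Bm'(2) g] Bm'(1) g by simp
  moreover have "yule_walker p n x \<in> carrier_vec p" using Bm'(2) yw g by simp
  moreover have "i - 1 < p" "Suc (i - 1) = i" using i by auto
  ultimately show ?thesis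
    using G_mult[of "yule_walker p n x" "i - 1"] by (simp add: gamma_vec_hat_def)
qed

text \<open>Let \<delta> be the estimation error and r the residual of the true coefficients in the
  normal equations. Testing the equations for \<delta> against \<delta> itself gives c |\<delta>|^2
  <= |\<delta>| times the sum of the |r_i|, and one factor |\<delta>| cancels.\<close>

lemma yule_walker_error_le:
  assumes n: "n \<ge> 1" and c: "c > 0"
    and ar: "\<And>t. x t = (\<Sum>j=1..p. \<phi> j * x (t - int j)) + z t"
    and pos: "\<And>v. c * (\<Sum>k=1..p. (v k)\<^sup>2) \<le> mean n (\<lambda>t. (\<Sum>i=1..p. v i * x (t - int i))\<^sup>2)"
    and j: "j \<in> {1..p}"
  shows "\<bar>vec_index (yule_walker p n x) (j - 1) - \<phi> j\<bar>
     \<le> (\<Sum>i=1..p. \<bar>mean n (\<lambda>t. x (t - int i) * z t)\<bar>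
       + (1 + (\<Sum>j=1..p. \<bar>\<phi> j\<bar>)) * boundary_energy p n x / real n) / c"
proof -
  define \<delta> where "\<delta> j = vec_index (yule_walker p n x) (j - 1) - \<phi> j" for j
  define r where "r i = acvf_hat p n x (int i) - (\<Sum>j=1..p. acvf_hat p n x (int i - int j) * \<phi> j)" for i
  have pos': "c * (\<Sum>k=1..p. (v k)\<^sup>2)
       \<le> (\<Sum>i=1..p. v i * (\<Sum>j=1..p. acvf_hat p n x (int i - int j) * v j))" for v
    using pos acvf_hat_quadratic_form[OF n] by (rule order_trans)
  have eq: "(\<Sum>j=1..p. acvf_hat p n x (int i - int j) * \<delta> j) = r i" if "i \<in> {1..p}" for i
    using yule_walker_solution[OF c pos' that] by (simp add: \<delta>_def r_def right_diff_distrib sum_subtractf)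
  define D where "D = sqrt (\<Sum>k=1..p. (\<delta> k)\<^sup>2)"
  have \<delta>D: "\<bar>\<delta> k\<bar> \<le> D" if "k \<in> {1..p}" for k
  proof -
    have "(\<delta> k)\<^sup>2 \<le> (\<Sum>k=1..p. (\<delta> k)\<^sup>2)" using that by (intro member_le_sum) auto
    then show ?thesis unfolding D_def using real_sqrt_le_mono by fastforce
  qed
  have D0: "D \<ge> 0" unfolding D_def by (intro real_sqrt_ge_zero sum_nonneg) auto
  have "c * D\<^sup>2 = c * (\<Sum>k=1..p. (\<delta> k)\<^sup>2)" by (simp add: D_def sum_nonneg)
  also have "\<dots> \<le> (\<Sum>i=1..p. \<delta> i * r i)"
    using pos'[of \<delta>] eq by simp
  also have "\<dots> \<le> (\<Sum>i=1..p. D * \<bar>r i\<bar>)"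
  proof (rule sum_mono)
    fix i assume "i \<in> {1..p}"
    have "\<delta> i * r i \<le> \<bar>\<delta> i\<bar> * \<bar>r i\<bar>" using abs_ge_self[of "\<delta> i * r i"] by (simp add: abs_mult)
    also have "\<dots> \<le> D * \<bar>r i\<bar>" using \<delta>D[OF \<open>i \<in> {1..p}\<close>] by (intro mult_right_mono) auto
    finally show "\<delta> i * r i \<le> D * \<bar>r i\<bar>" .
  qed
  also have "\<dots> = D * (\<Sum>i=1..p. \<bar>r i\<bar>)" by (simp add: sum_distrib_left)
  finally have cD: "c * D\<^sup>2 \<le> D * (\<Sum>i=1..p. \<bar>r i\<bar>)" .
  have "D \<le> (\<Sum>i=1..p. \<bar>r i\<bar>) / c"
  proof (cases "D = 0")
    case True
    then show ?thesis using c by (simp add: sum_nonneg)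
  next
    case False
    with D0 have "D > 0" by simp
    moreover have "D * (c * D) \<le> D * (\<Sum>i=1..p. \<bar>r i\<bar>)" using cD by (simp add: power2_eq_square algebra_simps)
    ultimately have "c * D \<le> (\<Sum>i=1..p. \<bar>r i\<bar>)" by simp
    then show ?thesis using c by (simp add: field_simps)
  qed
  moreover
  have "\<bar>r i\<bar> \<le> \<bar>mean n (\<lambda>t. x (t - int i) * z t)\<bar>
       + (1 + (\<Sum>j=1..p. \<bar>\<phi> j\<bar>)) * boundary_energy p n x / real n"
    if "i \<in> {1..p}" for i
    unfolding r_def using n that ar by (rule acvf_hat_normal_equation)
  then have "(\<Sum>i=1..p. \<bar>r i\<bar>) / c
     \<le> (\<Sum>i=1..p. \<bar>mean n (\<lambda>t. x (t - int i) * z t)\<bar>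
       + (1 + (\<Sum>j=1..p. \<bar>\<phi> j\<bar>)) * boundary_energy p n x / real n) / c"
    using c by (intro divide_right_mono sum_mono) auto
  ultimately show ?thesis
    using \<delta>D[OF j] unfolding \<delta>_def by linarith
qed

section \<open>Measurability of the estimator\<close>

lemma borel_measurable_det:
  fixes A :: "'a \<Rightarrow> real mat"
  assumes A: "\<And>\<omega>. A \<omega> \<in> carrier_mat m m"
    and meas: "\<And>i j. i < m \<Longrightarrow> j < m \<Longrightarrow> (\<lambda>\<omega>. A \<omega> $$ (i, j)) \<in> borel_measurable M"
  shows "(\<lambda>\<omega>. Determinant.det (A \<omega>)) \<in> borel_measurable M"
proof -
  have "Determinant.det (A \<omega>) = (\<Sum>q\<in>{q. q permutes {0..<m}}. signof q * (\<Prod>i=0..<m. A \<omega> $$ (i, q i)))" for \<omega>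
    by (rule det_def'[OF A])
  moreover have "(\<lambda>\<omega>. \<Sum>q\<in>{q. q permutes {0..<m}}. signof q * (\<Prod>i=0..<m. A \<omega> $$ (i, q i))) \<in> borel_measurable M"
    using permutes_in_image
    by (intro borel_measurable_sum borel_measurable_times borel_measurable_const borel_measurable_prod meas) fastforce+
  ultimately show ?thesis by simp
qed

text \<open>The inverse is computed by elimination, whose case distinctions hide measurability.
  Uniqueness of inverses replaces it by the adjugate over the determinant, an explicit rational
  expression in the entries.\<close>

lemma mat_inverse_eq_adj_mat:
  fixes A :: "real mat"
  assumes A: "A \<in> carrier_mat m m"
  shows "mat_inverse A = (if Determinant.det A = 0 then None else Some ((1 / Determinant.det A) \<cdot>\<^sub>m adj_mat A))"
proof (cases "mat_inverse A")
  case None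
  then have "A \<notin> Units (ring_mat TYPE(real) m ())" using mat_inverse(1)[OF A None, of "()"] by blast
  then have "Determinant.det A = 0" using det_non_zero_imp_unit[OF A, of "()"] by blast
  then show ?thesis using None by simp
next
  case (Some B)
  from mat_inverse(2)[OF A Some] have B: "A * B = 1\<^sub>m m" "B * A = 1\<^sub>m m" "B \<in> carrier_mat m m" by auto
  have "Determinant.det A * Determinant.det B = 1" using det_mult[OF A B(3)] B(1) by simp
  then have d: "Determinant.det A \<noteq> 0" by auto
  have adj: "adj_mat A \<in> carrier_mat m m" "A * adj_mat A = Determinant.det A \<cdot>\<^sub>m 1\<^sub>m m" using adj_mat[OF A] by auto
  have "adj_mat A = B * A * adj_mat A" using B adj by simp
  also have "\<dots> = B * (Determinant.det A \<cdot>\<^sub>m 1\<^sub>m m)" using assoc_mult_mat[OF B(3) A adj(1)] adj(2) by simp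
  also have "\<dots> = Determinant.det A \<cdot>\<^sub>m B" using mult_smult_distrib[OF B(3) one_carrier_mat, of "Determinant.det A"] B(3) by simp
  finally have "(1 / Determinant.det A) \<cdot>\<^sub>m adj_mat A = B" using d B(3) by (intro eq_matI) auto
  then show ?thesis using Some d by simp
qed

lemma borel_measurable_yule_walker:
  assumes X: "\<And>t. X t \<in> borel_measurable M" and j: "j < p"
  shows "(\<lambda>\<omega>. vec_index (yule_walker p n (\<lambda>t. X t \<omega>)) j) \<in> borel_measurable M"
proof -
  let ?G = "\<lambda>\<omega>. Gamma_hat p n (\<lambda>t. X t \<omega>)"
  have G: "?G \<omega> \<in> carrier_mat p p" for \<omega> by (simp add: Gamma_hat_def)
  have acvf: "(\<lambda>\<omega>. acvf_hat p n (\<lambda>t. X t \<omega>) l) \<in> borel_measurable M" for l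
    unfolding acvf_hat_def using X by measurable
  have G_meas: "(\<lambda>\<omega>. ?G \<omega> $$ (i, k)) \<in> borel_measurable M" if "i < p" "k < p" for i k
    using that acvf by (simp add: Gamma_hat_def)
  have det: "(\<lambda>\<omega>. Determinant.det (?G \<omega>)) \<in> borel_measurable M" by (rule borel_measurable_det[OF G G_meas])
  have cof: "(\<lambda>\<omega>. cofactor (?G \<omega>) k j) \<in> borel_measurable M" if "k < p" for k
  proof -
    have "(\<lambda>\<omega>. Determinant.det (mat_delete (?G \<omega>) k j)) \<in> borel_measurable M"
    proof (rule borel_measurable_det[where m = "p - 1"])
      show "mat_delete (?G \<omega>) k j \<in> carrier_mat (p - 1) (p - 1)" for \<omega>
        using G[of \<omega>] by (simp add: mat_delete_def)
      show "(\<lambda>\<omega>. mat_delete (?G \<omega>) k j $$ (a, b)) \<in> borel_measurable M" if "a < p - 1" "b < p - 1" for a b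
        using that G by (auto simp: mat_delete_def carrier_matD[OF G] intro!: G_meas)
    qed
    then show ?thesis by (simp add: cofactor_def)
  qed
  \<comment> \<open>Cramer's rule; a singular matrix yields the default entry 0.\<close>
  have "vec_index (yule_walker p n (\<lambda>t. X t \<omega>)) j
      = (if Determinant.det (?G \<omega>) = 0 then 0 else
          (\<Sum>k<p. cofactor (?G \<omega>) k j * acvf_hat p n (\<lambda>t. X t \<omega>) (int k + 1)) / Determinant.det (?G \<omega>))" for \<omega>
    using G[of \<omega>] j
    by (auto simp: yule_walker_def mat_inverse_eq_adj_mat[OF G] adj_mat_def gamma_vec_hat_def
        scalar_prod_def sum_divide_distrib atLeast0LessThan intro!: sum.cong)
  then show ?thesis using det cof acvf by simp
qed

section \<open>Martingale inequalities for independent noise\<close>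

lemma sum_int_eq_sum_nat: "(\<Sum>t = 1..int n. g t) = (\<Sum>i<n. g (1 + int i))"
  by (intro sum.reindex_bij_witness[of _ "\<lambda>i. 1 + int i" "\<lambda>t. nat (t - 1)"]) auto

text \<open>For x = -y < 0 the product (1 - y + y^2) (1 + y + y^2/2) is at least 1 and the second
  factor is at most exp y, so 1 - y + y^2 dominates exp (-y).\<close>

lemma exp_le_quadratic:
  fixes x :: real
  assumes "\<bar>x\<bar> \<le> 1"
  shows "exp x \<le> 1 + x + x\<^sup>2"
proof (cases "x \<ge> 0")
  case True
  then show ?thesis using exp_bound[of x] assms by simp
next
  case False
  define y where "y = - x"
  have y: "y \<ge> 0" using False by (simp add: y_def)
  have "1 \<le> (1 - y + y\<^sup>2) * (1 + y + y\<^sup>2 / 2)"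
  proof -
    have "(1 - y + y\<^sup>2) * (1 + y + y\<^sup>2 / 2) = 1 + (y\<^sup>2 + y ^ 3 + y ^ 4) / 2"
      by (simp add: field_simps power2_eq_square power3_eq_cube power4_eq_xxxx)
    then show ?thesis using y by simp
  qed
  also have "\<dots> \<le> (1 - y + y\<^sup>2) * exp y"
  proof (rule mult_left_mono)
    show "1 + y + y\<^sup>2 / 2 \<le> exp y" using exp_lower_Taylor_quadratic[OF y] by simp
    have "1 - y + y\<^sup>2 = (y - 1 / 2)\<^sup>2 + 3 / 4" by (simp add: power2_eq_square algebra_simps)
    then show "0 \<le> 1 - y + y\<^sup>2" by simp
  qed
  finally have "exp (- y) \<le> 1 - y + y\<^sup>2" by (simp add: exp_minus field_simps)
  then show ?thesis by (simp add: y_def)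
qed

lemma abs_le_1_power4: "\<bar>x :: real\<bar> \<le> 1 + x ^ 4"
proof (cases "\<bar>x\<bar> \<le> 1")
  case False
  then have "\<bar>x\<bar> ^ 1 \<le> \<bar>x\<bar> ^ 4" by (intro power_increasing) auto
  then show ?thesis by simp
next
  case True
  moreover have "0 \<le> x ^ 4" by (simp add: zero_le_power_eq)
  ultimately show ?thesis by linarith
qed

lemma power2_le_1_power4: "(x :: real)\<^sup>2 \<le> 1 + x ^ 4"
proof -
  have "2 * x\<^sup>2 \<le> 1 + x ^ 4" using sum_squares_bound[of 1 "x\<^sup>2"] by simp
  then show ?thesis using zero_le_power2[of x] by linarith
qed

text \<open>The power mean inequality with weights a, from Cauchy-Schwarz applied first to x and
  then to its squares. It controls fourth moments of linear combinations without using
  independence.\<close>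

lemma weighted_sum_power4_le:
  fixes a x :: "'i \<Rightarrow> real"
  assumes "\<And>i. i \<in> I \<Longrightarrow> 0 \<le> a i"
  shows "(\<Sum>i\<in>I. a i * x i) ^ 4 \<le> (\<Sum>i\<in>I. a i) ^ 3 * (\<Sum>i\<in>I. a i * x i ^ 4)"
proof -
  have cs: "(\<Sum>i\<in>I. a i * y i)\<^sup>2 \<le> (\<Sum>i\<in>I. a i) * (\<Sum>i\<in>I. a i * (y i)\<^sup>2)" for y
  proof -
    have "(\<Sum>i\<in>I. sqrt (a i) * (sqrt (a i) * y i))\<^sup>2 \<le> (\<Sum>i\<in>I. (sqrt (a i))\<^sup>2) * (\<Sum>i\<in>I. (sqrt (a i) * y i)\<^sup>2)"
      by (rule Cauchy_Schwarz_ineq_sum)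
    moreover have "(\<Sum>i\<in>I. sqrt (a i) * (sqrt (a i) * y i)) = (\<Sum>i\<in>I. a i * y i)"
      using assms by (intro sum.cong) (simp_all add: mult.assoc[symmetric])
    moreover have "(\<Sum>i\<in>I. (sqrt (a i))\<^sup>2) = (\<Sum>i\<in>I. a i)" "(\<Sum>i\<in>I. (sqrt (a i) * y i)\<^sup>2) = (\<Sum>i\<in>I. a i * (y i)\<^sup>2)"
      using assms by (auto intro!: sum.cong simp: power_mult_distrib)
    ultimately show ?thesis by simp
  qed
  have A: "(\<Sum>i\<in>I. a i) \<ge> 0" using assms by (intro sum_nonneg)
  have "(\<Sum>i\<in>I. a i * x i) ^ 4 = ((\<Sum>i\<in>I. a i * x i)\<^sup>2)\<^sup>2" by simp
  also have "\<dots> \<le> ((\<Sum>i\<in>I. a i) * (\<Sum>i\<in>I. a i * (x i)\<^sup>2))\<^sup>2"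
    by (intro power_mono cs) simp
  also have "\<dots> = (\<Sum>i\<in>I. a i)\<^sup>2 * (\<Sum>i\<in>I. a i * (x i)\<^sup>2)\<^sup>2" by (simp add: power_mult_distrib)
  also have "\<dots> \<le> (\<Sum>i\<in>I. a i)\<^sup>2 * ((\<Sum>i\<in>I. a i) * (\<Sum>i\<in>I. a i * ((x i)\<^sup>2)\<^sup>2))"
    by (intro mult_left_mono cs) simp
  also have "\<dots> = (\<Sum>i\<in>I. a i) ^ 3 * (\<Sum>i\<in>I. a i * x i ^ 4)"
    by (simp add: power2_eq_square power3_eq_cube power4_eq_xxxx mult.assoc)
  finally show ?thesis .
qed

section \<open>Independent noise and conditioning on its past\<close>

locale iid_noise = prob_space M for M :: "'a measure" +
  fixes Z :: "int \<Rightarrow> 'a \<Rightarrow> real" and F :: "real \<Rightarrow> real" and L m4 v :: real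
  assumes indep: "indep_vars (\<lambda>_. borel) Z UNIV"
    and F_eq: "\<And>t y. prob {\<omega> \<in> space M. Z t \<omega> \<le> y} = F y"
    and F_lipschitz: "\<And>x y. \<bar>F x - F y\<bar> \<le> L * \<bar>x - y\<bar>"
    and mean_zero: "\<And>t. expectation (Z t) = 0"
    and variance_eq: "\<And>t. expectation (\<lambda>\<omega>. (Z t \<omega>)\<^sup>2) = v"
    and fourth_integrable: "\<And>t. integrable M (\<lambda>\<omega>. (Z t \<omega>) ^ 4)"
    and fourth_moment: "\<And>t. expectation (\<lambda>\<omega>. (Z t \<omega>) ^ 4) = m4"
begin

lemma Z_measurable [measurable]: "Z t \<in> borel_measurable M"
  using indep by (auto simp: indep_vars_def)

text \<open>Time t itself is excluded, so quantities measurable here are predictable at t. The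
  pullback from a product space matches the block form in which independence of restricted families
  is available.\<close>

definition past :: "int \<Rightarrow> 'a measure" where
  "past t = vimage_algebra (space M) (\<lambda>\<omega>. \<lambda>s\<in>{..<t}. Z s \<omega>) (Pi\<^sub>M {..<t} (\<lambda>_. borel))"

lemma space_past [simp]: "space (past t) = space M"
  by (simp add: past_def)

lemma sets_past_le: "sets (past t) \<subseteq> sets M"
  unfolding past_def by (intro sets_image_in_sets refl measurable_restrict) auto

lemma measurable_past_imp: "W \<in> measurable (past t) N \<Longrightarrow> W \<in> measurable M N"
  using sets_past_le by (auto simp: measurable_def)

lemma Z_past: "s < t \<Longrightarrow> Z s \<in> borel_measurable (past t)"
proof -
  assume "s < t"
  have "(\<lambda>\<omega>. \<lambda>s\<in>{..<t}. Z s \<omega>) \<in> measurable (past t) (Pi\<^sub>M {..<t} (\<lambda>_. borel))"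
    unfolding past_def by (intro measurable_vimage_algebra1) (auto simp: space_PiM)
  from measurable_compose[OF this measurable_component_singleton[of s]] \<open>s < t\<close>
  show ?thesis by simp
qed

lemma past_mono: "s \<le> t \<Longrightarrow> W \<in> measurable (past s) N \<Longrightarrow> W \<in> measurable (past t) N"
proof -
  assume "s \<le> t" and W: "W \<in> measurable (past s) N"
  then have "sets (past s) \<subseteq> sets (past t)"
    unfolding past_def[of s] by (intro sets_image_in_sets measurable_restrict Z_past) auto
  then show ?thesis using W by (auto simp: measurable_def)
qed

lemma prob_past_inter:
  assumes "A \<in> sets (past t)" "B \<in> sets borel"
  shows "prob (A \<inter> (Z t -` B \<inter> space M)) = prob A * prob (Z t -` B \<inter> space M)"
proof -
  let ?R = "\<lambda>T \<omega>. \<lambda>s\<in>T. Z s \<omega>" and ?P = "\<lambda>T. Pi\<^sub>M T (\<lambda>_. borel :: real measure)"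
  have "indep_var (?P {..<t}) (?R {..<t}) (?P {t}) (?R {t})"
    by (rule indep_var_restrict[OF indep]) auto
  then have ind: "indep_set (sigma_sets (space M) {?R {..<t} -` A \<inter> space M |A. A \<in> sets (?P {..<t})})
      (sigma_sets (space M) {?R {t} -` A \<inter> space M |A. A \<in> sets (?P {t})})"
    unfolding indep_var_eq by blast
  have "(\<lambda>f. f t) -` B \<inter> space (?P {t}) \<in> sets (?P {t})"
    using assms(2) by (intro measurable_sets[OF measurable_component_singleton[of t]]) auto
  moreover have "Z t -` B \<inter> space M = ?R {t} -` ((\<lambda>f. f t) -` B \<inter> space (?P {t})) \<inter> space M"
    by (auto simp: space_PiM)
  ultimately have "Z t -` B \<inter> space M \<in> sigma_sets (space M) {?R {t} -` A \<inter> space M |A. A \<in> sets (?P {t})}"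
    by (intro sigma_sets.Basic) blast
  moreover have "A \<in> sigma_sets (space M) {?R {..<t} -` A \<inter> space M |A. A \<in> sets (?P {..<t})}"
    using assms(1) by (simp add: past_def sets_vimage_algebra)
  ultimately show ?thesis using indep_setD[OF ind] by blast
qed

lemma past_pair_distr:
  assumes W: "W \<in> measurable (past t) N"
  shows "distr M N W \<Otimes>\<^sub>M distr M borel (Z t) = distr M (N \<Otimes>\<^sub>M borel) (\<lambda>\<omega>. (W \<omega>, Z t \<omega>))"
proof (rule pair_measure_eqI)
  have [measurable]: "W \<in> measurable M N" using W by (rule measurable_past_imp)
  interpret A: prob_space "distr M N W" by (rule prob_space_distr) simp
  interpret B: prob_space "distr M borel (Z t)" by (rule prob_space_distr) simp
  show "sigma_finite_measure (distr M N W)" "sigma_finite_measure (distr M borel (Z t))" by unfold_locales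
  show "sets (distr M N W \<Otimes>\<^sub>M distr M borel (Z t)) = sets (distr M (N \<Otimes>\<^sub>M borel) (\<lambda>\<omega>. (W \<omega>, Z t \<omega>)))"
    by (simp cong: sets_pair_measure_cong)
  fix A B assume "A \<in> sets (distr M N W)" "B \<in> sets (distr M borel (Z t))"
  then have [measurable]: "A \<in> sets N" "B \<in> sets borel" by auto
  have "W -` A \<inter> space (past t) \<in> sets (past t)" using W by (rule measurable_sets) simp
  then have "W -` A \<inter> space M \<in> sets (past t)" by simp
  from prob_past_inter[OF this \<open>B \<in> sets borel\<close>]
  have "prob ((\<lambda>\<omega>. (W \<omega>, Z t \<omega>)) -` (A \<times> B) \<inter> space M) = prob (W -` A \<inter> space M) * prob (Z t -` B \<inter> space M)"
    by (simp add: vimage_def Int_def conj_ac Times_eq_image_sum cong: conj_cong)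
  then show "emeasure (distr M N W) A * emeasure (distr M borel (Z t)) B
      = emeasure (distr M (N \<Otimes>\<^sub>M borel) (\<lambda>\<omega>. (W \<omega>, Z t \<omega>))) (A \<times> B)"
    by (simp add: emeasure_distr emeasure_eq_measure ennreal_mult')
qed

text \<open>Takes the place of conditional expectation: as the past and \<open>Z t\<close> have a
  product law, the past quantity is frozen and only a fresh copy of the noise is integrated.\<close>

lemma nn_integral_past:
  assumes W: "W \<in> measurable (past t) N" and g[measurable]: "g \<in> borel_measurable (N \<Otimes>\<^sub>M borel)"
  shows "(\<integral>\<^sup>+\<omega>. g (W \<omega>, Z t \<omega>) \<partial>M) = (\<integral>\<^sup>+\<omega>. (\<integral>\<^sup>+\<omega>'. g (W \<omega>, Z t \<omega>') \<partial>M) \<partial>M)"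
proof -
  have [measurable]: "W \<in> measurable M N" using W by (rule measurable_past_imp)
  interpret B: prob_space "distr M borel (Z t)" by (rule prob_space_distr) simp
  have "(\<integral>\<^sup>+\<omega>. g (W \<omega>, Z t \<omega>) \<partial>M) = (\<integral>\<^sup>+x. g x \<partial>distr M (N \<Otimes>\<^sub>M borel) (\<lambda>\<omega>. (W \<omega>, Z t \<omega>)))"
    by (subst nn_integral_distr) auto
  also have "\<dots> = (\<integral>\<^sup>+x. g x \<partial>(distr M N W \<Otimes>\<^sub>M distr M borel (Z t)))"
    by (simp add: past_pair_distr[OF W])
  also have "\<dots> = (\<integral>\<^sup>+a. (\<integral>\<^sup>+b. g (a, b) \<partial>distr M borel (Z t)) \<partial>distr M N W)"
    by (subst B.nn_integral_fst[symmetric]) auto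
  also have "\<dots> = (\<integral>\<^sup>+\<omega>. (\<integral>\<^sup>+b. g (W \<omega>, b) \<partial>distr M borel (Z t)) \<partial>M)"
    by (subst nn_integral_distr) auto
  also have "\<dots> = (\<integral>\<^sup>+\<omega>. (\<integral>\<^sup>+\<omega>'. g (W \<omega>, Z t \<omega>') \<partial>M) \<partial>M)"
    by (intro nn_integral_cong, subst nn_integral_distr) (auto dest: measurable_space[OF \<open>W \<in> measurable M N\<close>])
  finally show ?thesis .
qed

lemma indep_var_past:
  assumes W: "W \<in> borel_measurable (past t)" and q[measurable]: "q \<in> borel_measurable borel"
  shows "indep_var borel W borel (\<lambda>\<omega>. q (Z t \<omega>) :: real)"
proof -
  have "indep_var borel W borel (Z t)"
    unfolding indep_var_distribution_eq
    using past_pair_distr[OF W] measurable_past_imp[OF W] by simp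
  from indep_var_compose[OF this measurable_ident q] show ?thesis by (simp add: comp_def)
qed

text \<open>Martingale differences are orthogonal: the cross term of the sum so far with the next
  summand factors through the mean of \<open>q (Z t)\<close>, which is 0. The freedom in
  \<open>q\<close>, \<open>w\<close> and the starting time lets the same bound serve the noise, its
  centred squares, its products with lagged values, and all shifts of these.\<close>

lemma martingale_L2:
  assumes w: "\<And>t. w t \<in> borel_measurable (past t)"
    and w2: "\<And>t. integrable M (\<lambda>\<omega>. (w t \<omega>)\<^sup>2)"
    and wB: "\<And>t. expectation (\<lambda>\<omega>. (w t \<omega>)\<^sup>2) \<le> B"
    and q[measurable]: "q \<in> borel_measurable borel"
    and q2: "\<And>t. integrable M (\<lambda>\<omega>. (q (Z t \<omega>))\<^sup>2)"
    and q0: "\<And>t. expectation (\<lambda>\<omega>. q (Z t \<omega>)) = 0"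
    and qV: "\<And>t. expectation (\<lambda>\<omega>. (q (Z t \<omega>))\<^sup>2) \<le> V"
  shows "integrable M (\<lambda>\<omega>. (\<Sum>i<n. w (s + int i) \<omega> * q (Z (s + int i) \<omega>))\<^sup>2)
    \<and> expectation (\<lambda>\<omega>. (\<Sum>i<n. w (s + int i) \<omega> * q (Z (s + int i) \<omega>))\<^sup>2) \<le> real n * (B * V)"
proof (induction n)
  case (Suc n)
  let ?t = "s + int n"
  define S where "S \<omega> = (\<Sum>i<n. w (s + int i) \<omega> * q (Z (s + int i) \<omega>))" for \<omega>
  have Sm: "S \<in> borel_measurable (past ?t)"
    unfolding S_def
    by (intro borel_measurable_sum borel_measurable_times past_mono[OF _ w] measurable_compose[OF Z_past q]) auto
  have [measurable]: "S \<in> borel_measurable M" "w ?t \<in> borel_measurable M"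
    using Sm w by (auto dest: measurable_past_imp)
  have S2: "integrable M (\<lambda>\<omega>. (S \<omega>)\<^sup>2)" "expectation (\<lambda>\<omega>. (S \<omega>)\<^sup>2) \<le> real n * (B * V)"
    using Suc.IH by (simp_all add: S_def)
  have Sw: "integrable M (\<lambda>\<omega>. S \<omega> * w ?t \<omega>)"
  proof (rule Bochner_Integration.integrable_bound)
    show "integrable M (\<lambda>\<omega>. (S \<omega>)\<^sup>2 + (w ?t \<omega>)\<^sup>2)" using S2 w2 by simp
    have "\<bar>a * b\<bar> \<le> a\<^sup>2 + b\<^sup>2" for a b :: real
    proof -
      have "2 * (\<bar>a\<bar> * \<bar>b\<bar>) \<le> a\<^sup>2 + b\<^sup>2" "0 \<le> \<bar>a\<bar> * \<bar>b\<bar>"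
        using sum_squares_bound[of "\<bar>a\<bar>" "\<bar>b\<bar>"] by (simp_all add: mult.assoc)
      then show ?thesis unfolding abs_mult by linarith
    qed
    then show "AE \<omega> in M. norm (S \<omega> * w ?t \<omega>) \<le> norm ((S \<omega>)\<^sup>2 + (w ?t \<omega>)\<^sup>2)" by simp
  qed simp
  have q1: "integrable M (\<lambda>\<omega>. q (Z ?t \<omega>))"
    by (rule square_integrable_imp_integrable[OF _ q2]) simp
  have cross: "integrable M (\<lambda>\<omega>. (S \<omega> * w ?t \<omega>) * q (Z ?t \<omega>))"
      "expectation (\<lambda>\<omega>. (S \<omega> * w ?t \<omega>) * q (Z ?t \<omega>)) = 0"
    using indep_var_integrable[OF indep_var_past Sw q1] indep_var_lebesgue_integral[OF indep_var_past Sw q1] Sm w q0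
    by auto
  have diag: "integrable M (\<lambda>\<omega>. (w ?t \<omega>)\<^sup>2 * (q (Z ?t \<omega>))\<^sup>2)"
      "expectation (\<lambda>\<omega>. (w ?t \<omega>)\<^sup>2 * (q (Z ?t \<omega>))\<^sup>2)
         = expectation (\<lambda>\<omega>. (w ?t \<omega>)\<^sup>2) * expectation (\<lambda>\<omega>. (q (Z ?t \<omega>))\<^sup>2)"
    using indep_var_integrable[OF indep_var_past[where q = "\<lambda>z. (q z)\<^sup>2"] w2 q2]
      indep_var_lebesgue_integral[OF indep_var_past[where q = "\<lambda>z. (q z)\<^sup>2"] w2 q2] w
    by auto
  have eq: "(\<Sum>i<Suc n. w (s + int i) \<omega> * q (Z (s + int i) \<omega>))\<^sup>2
     = (S \<omega>)\<^sup>2 + (2 * ((S \<omega> * w ?t \<omega>) * q (Z ?t \<omega>)) + (w ?t \<omega>)\<^sup>2 * (q (Z ?t \<omega>))\<^sup>2)" for \<omega>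
    by (simp add: S_def power2_sum power_mult_distrib algebra_simps)
  have "expectation (\<lambda>\<omega>. (w ?t \<omega>)\<^sup>2) * expectation (\<lambda>\<omega>. (q (Z ?t \<omega>))\<^sup>2) \<le> B * V"
  proof (intro mult_mono wB qV)
    show "0 \<le> B" using wB[of ?t] by (rule order_trans[rotated]) simp
  qed simp
  then show ?case unfolding eq using S2 cross diag by (simp add: distrib_right)
qed simp

lemma martingale_mean_tail:
  assumes w: "\<And>t. w t \<in> borel_measurable (past t)"
    and w2: "\<And>t. integrable M (\<lambda>\<omega>. (w t \<omega>)\<^sup>2)"
    and wB: "\<And>t. expectation (\<lambda>\<omega>. (w t \<omega>)\<^sup>2) \<le> B"
    and q: "q \<in> borel_measurable borel"
    and q2: "\<And>t. integrable M (\<lambda>\<omega>. (q (Z t \<omega>))\<^sup>2)"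
    and q0: "\<And>t. expectation (\<lambda>\<omega>. q (Z t \<omega>)) = 0"
    and qV: "\<And>t. expectation (\<lambda>\<omega>. (q (Z t \<omega>))\<^sup>2) \<le> V"
    and "u > 0" "n \<ge> 1"
  shows "prob {\<omega> \<in> space M. \<bar>mean n (\<lambda>t. w (t - k) \<omega> * q (Z (t - k) \<omega>))\<bar> > u} \<le> B * V / (real n * u\<^sup>2)"
proof -
  define S where "S \<omega> = (\<Sum>i<n. w (1 - k + int i) \<omega> * q (Z (1 - k + int i) \<omega>))" for \<omega>
  have S: "integrable M (\<lambda>\<omega>. (S \<omega>)\<^sup>2)" "expectation (\<lambda>\<omega>. (S \<omega>)\<^sup>2) \<le> real n * (B * V)"
    using martingale_L2[OF w w2 wB q q2 q0 qV, where n = n and s = "1 - k"] by (simp_all add: S_def)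
  have [measurable]: "w t \<in> borel_measurable M" for t using w by (rule measurable_past_imp)
  have Sm [measurable]: "S \<in> borel_measurable M" unfolding S_def using q by measurable
  have mean_eq: "mean n (\<lambda>t. w (t - k) \<omega> * q (Z (t - k) \<omega>)) = S \<omega> / real n" for \<omega>
    unfolding mean_def sum_int_eq_sum_nat S_def by (simp add: algebra_simps)
  have "prob {\<omega> \<in> space M. \<bar>mean n (\<lambda>t. w (t - k) \<omega> * q (Z (t - k) \<omega>))\<bar> > u}
      \<le> prob {\<omega> \<in> space M. (S \<omega>)\<^sup>2 \<ge> (real n * u)\<^sup>2}"
  proof (intro finite_measure_mono subsetI)
    fix \<omega> assume "\<omega> \<in> {\<omega> \<in> space M. \<bar>mean n (\<lambda>t. w (t - k) \<omega> * q (Z (t - k) \<omega>))\<bar> > u}"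
    then have "\<omega> \<in> space M" "\<bar>real n * u\<bar> \<le> \<bar>S \<omega>\<bar>"
      using assms(8,9) by (auto simp: mean_eq field_simps)
    then show "\<omega> \<in> {\<omega> \<in> space M. (S \<omega>)\<^sup>2 \<ge> (real n * u)\<^sup>2}"
      by (simp add: abs_le_square_iff)
  qed simp
  also have "\<dots> \<le> expectation (\<lambda>\<omega>. (S \<omega>)\<^sup>2) / (real n * u)\<^sup>2"
    using assms(8,9) S(1) by (intro integral_Markov_inequality_measure[where A = "space M"]) auto
  also have "\<dots> \<le> real n * (B * V) / (real n * u)\<^sup>2"
    using S(2) by (intro divide_right_mono) auto
  also have "\<dots> = B * V / (real n * u\<^sup>2)" using assms(8,9) by (simp add: power2_eq_square field_simps)
  finally show ?thesis .
qed

section \<open>Exponential inequality for centred indicator increments\<close>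

lemma F_measurable [measurable]: "F \<in> borel_measurable borel"
proof (rule borel_measurable_mono)
  show "mono F"
    unfolding mono_def F_eq[of 0, symmetric] by (intro allI impI finite_measure_mono) auto
qed

lemma L_nonneg: "L \<ge> 0"
  using F_lipschitz[of 1 0] by simp

text \<open>When \<open>d\<close> is determined by the past of \<open>t\<close>, this is a
  martingale difference; the difference of the values of \<open>F\<close> is its
  compensator.\<close>

definition increment :: "int \<Rightarrow> real \<Rightarrow> real \<Rightarrow> 'a \<Rightarrow> real" where
  "increment t y d \<omega> = indicator {..y + d} (Z t \<omega>) - indicator {..y} (Z t \<omega>) - (F (y + d) - F y)"

text \<open>For |l| <= 1/2 the exponent lies in [-1, 1], where exp is at most its quadratic bound.
  The linear term has mean 0 and the variance is at most the probability that \<open>Z t\<close>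
  falls between y and y + d, hence at most \<open>L * c\<close>.\<close>

lemma increment_exp_moment:
  assumes c: "\<bar>d\<bar> \<le> c" and l: "\<bar>l\<bar> \<le> 1 / 2"
  shows "(\<integral>\<^sup>+\<omega>. ennreal (exp (l * increment t y d \<omega>)) \<partial>M) \<le> ennreal (exp (l\<^sup>2 * (L * c)))"
proof -
  define I where "I \<omega> = (indicator {..y + d} (Z t \<omega>) - indicator {..y} (Z t \<omega>) :: real)" for \<omega>
  define m where "m = F (y + d) - F y"
  have [measurable]: "I \<in> borel_measurable M" unfolding I_def by measurable
  have I_cases: "I \<omega> \<in> {-1, 0, 1}" for \<omega> by (auto simp: I_def indicator_def)
  have I_le: "\<bar>I \<omega>\<bar> \<le> 1" for \<omega> using I_cases[of \<omega>] by auto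
  have int[simp]: "integrable M I"
    by (rule integrable_const_bound[where B = 1]) (simp_all add: I_le)
  have EI: "expectation I = m"
  proof -
    have ind: "expectation (\<lambda>\<omega>. indicator {..z} (Z t \<omega>)) = F z" "integrable M (\<lambda>\<omega>. indicator {..z} (Z t \<omega>) :: real)" for z
    proof -
      have eq: "(\<lambda>\<omega>. indicator {..z} (Z t \<omega>) :: real) = indicator {\<omega>. Z t \<omega> \<le> z}" by (auto simp: indicator_def)
      show "expectation (\<lambda>\<omega>. indicator {..z} (Z t \<omega>)) = F z"
        unfolding eq by (simp add: F_eq[of t, symmetric] Int_def conj_commute)
      show "integrable M (\<lambda>\<omega>. indicator {..z} (Z t \<omega>) :: real)"
        by (rule integrable_const_bound[where B = 1]) (auto intro!: AE_I2)
    qed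
    then show ?thesis unfolding I_def m_def by simp
  qed
  have m: "\<bar>m\<bar> \<le> 1"
  proof -
    have F01: "0 \<le> F z \<and> F z \<le> 1" for z by (simp add: F_eq[of 0, symmetric])
    show ?thesis using F01[of "y + d"] F01[of y] unfolding m_def by linarith
  qed
  have I2: "expectation (\<lambda>\<omega>. (I \<omega>)\<^sup>2) \<le> L * c" "integrable M (\<lambda>\<omega>. (I \<omega>)\<^sup>2)"
  proof -
    \<comment> \<open>A nonzero value of \<open>I\<close> is 1 or -1 and has the sign of
      \<open>d\<close>, so the second moment reduces to the mean.\<close>
    have "(I \<omega>)\<^sup>2 = sgn d * I \<omega>" for \<omega>
      by (cases "d = 0"; cases "d > 0") (auto simp: I_def indicator_def)
    then have "(\<lambda>\<omega>. (I \<omega>)\<^sup>2) = (\<lambda>\<omega>. sgn d * I \<omega>)" by auto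
    moreover have "sgn d * m \<le> \<bar>m\<bar>" by (auto simp: sgn_if)
    moreover have "\<bar>m\<bar> \<le> L * \<bar>d\<bar>" unfolding m_def using F_lipschitz[of "y + d" y] by simp
    moreover have "L * \<bar>d\<bar> \<le> L * c" using c L_nonneg by (rule mult_left_mono)
    ultimately show "expectation (\<lambda>\<omega>. (I \<omega>)\<^sup>2) \<le> L * c" "integrable M (\<lambda>\<omega>. (I \<omega>)\<^sup>2)"
      using EI by auto
  qed
  define r where "r \<omega> = l * (I \<omega> - m)" for \<omega>
  have r1: "\<bar>r \<omega>\<bar> \<le> 1" for \<omega>
  proof -
    have "\<bar>I \<omega> - m\<bar> \<le> 2" using I_cases[of \<omega>] m by auto
    then have "\<bar>r \<omega>\<bar> \<le> 1 / 2 * 2" unfolding r_def abs_mult using l by (intro mult_mono) auto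
    then show ?thesis by simp
  qed
  have r_eq: "1 + r \<omega> + (r \<omega>)\<^sup>2 = (1 - l * m + l\<^sup>2 * m\<^sup>2) + (l - 2 * l\<^sup>2 * m) * I \<omega> + l\<^sup>2 * (I \<omega>)\<^sup>2" for \<omega>
    by (simp add: r_def power2_eq_square algebra_simps)
  have "(\<integral>\<^sup>+\<omega>. ennreal (exp (l * increment t y d \<omega>)) \<partial>M) \<le> (\<integral>\<^sup>+\<omega>. ennreal (1 + r \<omega> + (r \<omega>)\<^sup>2) \<partial>M)"
  proof (intro nn_integral_mono ennreal_leI)
    show "exp (l * increment t y d \<omega>) \<le> 1 + r \<omega> + (r \<omega>)\<^sup>2" for \<omega>
      using exp_le_quadratic[OF r1[of \<omega>]] by (simp add: r_def I_def m_def increment_def)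
  qed
  also have "\<dots> = ennreal (expectation (\<lambda>\<omega>. 1 + r \<omega> + (r \<omega>)\<^sup>2))"
  proof (rule nn_integral_eq_integral)
    show "integrable M (\<lambda>\<omega>. 1 + r \<omega> + (r \<omega>)\<^sup>2)" unfolding r_eq using I2 by simp
    have "0 \<le> 1 + r \<omega> + (r \<omega>)\<^sup>2" for \<omega> using r1[of \<omega>] zero_le_power2[of "r \<omega>"] by linarith
    then show "AE \<omega> in M. 0 \<le> 1 + r \<omega> + (r \<omega>)\<^sup>2" by simp
  qed
  also have "expectation (\<lambda>\<omega>. 1 + r \<omega> + (r \<omega>)\<^sup>2) = 1 + l\<^sup>2 * (expectation (\<lambda>\<omega>. (I \<omega>)\<^sup>2) - m\<^sup>2)"
    unfolding r_eq using I2 EI by (simp add: prob_space power2_eq_square algebra_simps)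
  also have "\<dots> \<le> 1 + l\<^sup>2 * (L * c)"
    using I2(1) zero_le_power2[of m] by (intro add_left_mono mult_left_mono) (linarith, simp)
  also have "\<dots> \<le> exp (l\<^sup>2 * (L * c))" by (rule exp_ge_add_one_self)
  finally show ?thesis by (simp add: ennreal_leI)
qed

text \<open>Induction on the number of summands: freezing the past leaves a single increment with a
  fixed shift. The bound \<open>c\<close> is deterministic, so the factor gained at each step is a
  constant that comes out of the integral.\<close>

lemma exp_supermartingale:
  assumes D: "\<And>t. D t \<in> borel_measurable (past t)"
    and c: "\<And>t \<omega>. \<bar>D t \<omega>\<bar> \<le> c" and l: "\<bar>l\<bar> \<le> 1 / 2"
  shows "(\<integral>\<^sup>+\<omega>. ennreal (exp (l * (\<Sum>i<n. increment (s + int i) y (D (s + int i) \<omega>) \<omega>))) \<partial>M)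
     \<le> ennreal (exp (real n * (l\<^sup>2 * (L * c))))"
proof (induction n)
  case 0
  then show ?case by (simp add: emeasure_space_1)
next
  case (Suc n)
  let ?t = "s + int n"
  define S where "S \<omega> = (\<Sum>i<n. increment (s + int i) y (D (s + int i) \<omega>) \<omega>)" for \<omega>
  have Sm: "S \<in> borel_measurable (past ?t)"
    unfolding S_def
  proof (rule borel_measurable_sum)
    fix i assume "i \<in> {..<n}"
    then have [measurable]: "D (s + int i) \<in> borel_measurable (past ?t)" "Z (s + int i) \<in> borel_measurable (past ?t)"
      by (auto intro: past_mono[OF _ D] Z_past)
    show "(\<lambda>\<omega>. increment (s + int i) y (D (s + int i) \<omega>) \<omega>) \<in> borel_measurable (past ?t)"
      unfolding increment_def indicator_def atMost_iff by measurable
  qed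
  have W: "(\<lambda>\<omega>. (S \<omega>, D ?t \<omega>)) \<in> measurable (past ?t) (borel \<Otimes>\<^sub>M borel)"
    using Sm D by simp
  \<comment> \<open>The pair of the sum so far and the next shift is known from the past; the second
    component of \<open>x\<close> is the new noise.\<close>
  define g where "g x = ennreal (exp (l * fst (fst x))) *
      ennreal (exp (l * (indicator {..y + snd (fst x)} (snd x) - indicator {..y} (snd x) - (F (y + snd (fst x)) - F y))))"
    for x :: "(real \<times> real) \<times> real"
  have g: "g \<in> borel_measurable ((borel \<Otimes>\<^sub>M borel) \<Otimes>\<^sub>M borel)"
    unfolding g_def indicator_def atMost_iff by measurable
  have "(\<integral>\<^sup>+\<omega>. ennreal (exp (l * (\<Sum>i<Suc n. increment (s + int i) y (D (s + int i) \<omega>) \<omega>))) \<partial>M)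
      = (\<integral>\<^sup>+\<omega>. g ((S \<omega>, D ?t \<omega>), Z ?t \<omega>) \<partial>M)"
    by (intro nn_integral_cong)
       (simp add: g_def S_def increment_def distrib_left exp_add ennreal_mult')
  also have "\<dots> = (\<integral>\<^sup>+\<omega>. (\<integral>\<^sup>+\<omega>'. g ((S \<omega>, D ?t \<omega>), Z ?t \<omega>') \<partial>M) \<partial>M)"
    by (rule nn_integral_past[OF W g])
  also have "\<dots> \<le> (\<integral>\<^sup>+\<omega>. ennreal (exp (l * S \<omega>)) * ennreal (exp (l\<^sup>2 * (L * c))) \<partial>M)"
  proof (rule nn_integral_mono)
    fix \<omega>
    have "(\<integral>\<^sup>+\<omega>'. g ((S \<omega>, D ?t \<omega>), Z ?t \<omega>') \<partial>M)
        = ennreal (exp (l * S \<omega>)) * (\<integral>\<^sup>+\<omega>'. ennreal (exp (l * increment ?t y (D ?t \<omega>) \<omega>')) \<partial>M)"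
      unfolding g_def increment_def fst_conv snd_conv indicator_def atMost_iff by (rule nn_integral_cmult) measurable
    also have "\<dots> \<le> ennreal (exp (l * S \<omega>)) * ennreal (exp (l\<^sup>2 * (L * c)))"
      by (intro mult_left_mono increment_exp_moment c l) simp
    finally show "(\<integral>\<^sup>+\<omega>'. g ((S \<omega>, D ?t \<omega>), Z ?t \<omega>') \<partial>M) \<le> ennreal (exp (l * S \<omega>)) * ennreal (exp (l\<^sup>2 * (L * c)))" .
  qed
  also have "\<dots> = (\<integral>\<^sup>+\<omega>. ennreal (exp (l * S \<omega>)) \<partial>M) * ennreal (exp (l\<^sup>2 * (L * c)))"
    using measurable_past_imp[OF Sm] by (intro nn_integral_multc) measurable
  also have "\<dots> \<le> ennreal (exp (real n * (l\<^sup>2 * (L * c)))) * ennreal (exp (l\<^sup>2 * (L * c)))"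
    using Suc.IH by (intro mult_right_mono) (simp_all add: S_def)
  also have "\<dots> = ennreal (exp (real (Suc n) * (l\<^sup>2 * (L * c))))"
    by (simp add: ennreal_mult'[symmetric] exp_add[symmetric] algebra_simps)
  finally show ?case .
qed

text \<open>The exponential Markov inequality for both signs of the sum. The parameter
  \<open>l\<close> stays free, to be tuned to the size of the shifts.\<close>

lemma increment_sum_tail:
  assumes D: "\<And>t. D t \<in> borel_measurable (past t)"
    and c: "\<And>t \<omega>. \<bar>D t \<omega>\<bar> \<le> c" and l: "0 < l" "l \<le> 1 / 2"
  shows "prob {\<omega> \<in> space M. \<bar>\<Sum>t = 1..int n. increment t y (D t \<omega>) \<omega>\<bar> \<ge> u}
     \<le> 2 * exp (real n * (l\<^sup>2 * (L * c)) - l * u)"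
proof -
  define S where "S \<omega> = (\<Sum>t = 1..int n. increment t y (D t \<omega>) \<omega>)" for \<omega>
  have [measurable]: "D t \<in> borel_measurable M" for t using D by (rule measurable_past_imp)
  have [measurable]: "S \<in> borel_measurable M"
    unfolding S_def increment_def indicator_def atMost_iff by measurable
  have tail: "prob {\<omega> \<in> space M. sg * S \<omega> \<ge> u} \<le> exp (real n * (l\<^sup>2 * (L * c)) - l * u)" if sg: "sg \<in> {-1, 1}" for sg
  proof -
    have "emeasure M ({\<omega> \<in> space M. 1 \<le> ennreal (exp (- (l * u))) * ennreal (exp (l * (sg * S \<omega>)))})
       \<le> ennreal (exp (- (l * u))) * (\<integral>\<^sup>+\<omega>. ennreal (exp (l * (sg * S \<omega>))) * indicator (space M) \<omega> \<partial>M)"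
      by (rule nn_integral_Markov_inequality) auto
    also have "(\<integral>\<^sup>+\<omega>. ennreal (exp (l * (sg * S \<omega>))) * indicator (space M) \<omega> \<partial>M)
        = (\<integral>\<^sup>+\<omega>. ennreal (exp ((l * sg) * S \<omega>)) \<partial>M)"
      by (intro nn_integral_cong) (simp add: mult.assoc)
    also have "\<dots> \<le> ennreal (exp (real n * ((l * sg)\<^sup>2 * (L * c))))"
      unfolding S_def sum_int_eq_sum_nat
      by (rule exp_supermartingale[OF D c]) (use l sg in \<open>auto simp: abs_mult\<close>)
    also have "ennreal (exp (- (l * u))) * ennreal (exp (real n * ((l * sg)\<^sup>2 * (L * c))))
        = ennreal (exp (real n * (l\<^sup>2 * (L * c)) - l * u))"
      using sg by (auto simp: ennreal_mult'[symmetric] exp_add[symmetric] power_mult_distrib)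
    also have "{\<omega> \<in> space M. 1 \<le> ennreal (exp (- (l * u))) * ennreal (exp (l * (sg * S \<omega>)))}
        = {\<omega> \<in> space M. sg * S \<omega> \<ge> u}"
    proof -
      have "1 \<le> ennreal (exp (- (l * u))) * ennreal (exp (l * x)) \<longleftrightarrow> u \<le> x" for x
        using l by (simp add: ennreal_mult'[symmetric] exp_add[symmetric] ennreal_1[symmetric] del: ennreal_1)
      then show ?thesis by simp
    qed
    finally show ?thesis by (simp add: emeasure_eq_measure mult_left_mono)
  qed
  have "{\<omega> \<in> space M. \<bar>S \<omega>\<bar> \<ge> u} = {\<omega> \<in> space M. 1 * S \<omega> \<ge> u} \<union> {\<omega> \<in> space M. -1 * S \<omega> \<ge> u}" by auto
  then have "prob {\<omega> \<in> space M. \<bar>S \<omega>\<bar> \<ge> u} \<le> prob {\<omega> \<in> space M. 1 * S \<omega> \<ge> u} + prob {\<omega> \<in> space M. -1 * S \<omega> \<ge> u}"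
    by (simp only:) (rule measure_Un_le; measurable)
  also have "\<dots> \<le> exp (real n * (l\<^sup>2 * (L * c)) - l * u) + exp (real n * (l\<^sup>2 * (L * c)) - l * u)"
    by (intro add_mono tail) auto
  finally show ?thesis by (simp add: S_def)
qed

subsection \<open>Causal moving averages\<close>

text \<open>Where the series diverges the value is arbitrary; for absolutely summable \<psi> this
  concerns only a null set. As a pointwise function of earlier noise it is measurable in the past
  without exceptional sets.\<close>

definition ma :: "(nat \<Rightarrow> real) \<Rightarrow> int \<Rightarrow> 'a \<Rightarrow> real" where
  "ma \<psi> t \<omega> = (\<Sum>j. \<psi> j * Z (t - int j) \<omega>)"

lemma ma_past: "s < t \<Longrightarrow> ma \<psi> s \<in> borel_measurable (past t)"
  unfolding ma_def by (intro borel_measurable_suminf borel_measurable_times borel_measurable_const Z_past) auto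

lemma ma_measurable [measurable]: "ma \<psi> s \<in> borel_measurable M"
  using ma_past[of s "s + 1"] by (auto intro: measurable_past_imp)

lemma m4_nonneg: "m4 \<ge> 0"
  unfolding fourth_moment[of 0, symmetric] by (intro integral_nonneg_AE) auto

lemma Z_square_integrable: "integrable M (\<lambda>\<omega>. (Z t \<omega>)\<^sup>2)"
  using fourth_integrable[of t] by (intro square_integrable_imp_integrable[of "\<lambda>\<omega>. (Z t \<omega>)\<^sup>2"]) auto

text \<open>Tonelli for series. It is applied with the absolute value, for almost sure convergence
  of moving averages, and with the fourth power, for their moments.\<close>

lemma AE_summable_noise:
  assumes \<psi>: "summable (\<lambda>j. \<bar>\<psi> j\<bar>)" and q[measurable]: "q \<in> borel_measurable borel"
    and q0: "\<And>z. 0 \<le> q z" and C: "\<And>t. (\<integral>\<^sup>+\<omega>. ennreal (q (Z t \<omega>)) \<partial>M) \<le> ennreal C"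
  shows "AE \<omega> in M. summable (\<lambda>j. \<bar>\<psi> j\<bar> * q (Z (t - int j) \<omega>))"
    and "(\<integral>\<^sup>+\<omega>. (\<Sum>j. ennreal (\<bar>\<psi> j\<bar> * q (Z (t - int j) \<omega>))) \<partial>M) \<le> ennreal (\<Sum>j. \<bar>\<psi> j\<bar>) * ennreal C"
proof -
  have "(\<integral>\<^sup>+\<omega>. (\<Sum>j. ennreal (\<bar>\<psi> j\<bar> * q (Z (t - int j) \<omega>))) \<partial>M)
      = (\<Sum>j. \<integral>\<^sup>+\<omega>. ennreal (\<bar>\<psi> j\<bar>) * ennreal (q (Z (t - int j) \<omega>)) \<partial>M)"
    by (subst nn_integral_suminf) (auto simp: ennreal_mult' q0)
  also have "\<dots> = (\<Sum>j. ennreal (\<bar>\<psi> j\<bar>) * (\<integral>\<^sup>+\<omega>. ennreal (q (Z (t - int j) \<omega>)) \<partial>M))"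
    by (subst nn_integral_cmult) auto
  also have "\<dots> \<le> (\<Sum>j. ennreal (\<bar>\<psi> j\<bar>) * ennreal C)"
    by (intro suminf_le mult_left_mono C) auto
  also have "\<dots> = ennreal (\<Sum>j. \<bar>\<psi> j\<bar>) * ennreal C"
    using \<psi> by (subst ennreal_suminf_multc) (simp add: suminf_ennreal2)
  finally show *: "(\<integral>\<^sup>+\<omega>. (\<Sum>j. ennreal (\<bar>\<psi> j\<bar> * q (Z (t - int j) \<omega>))) \<partial>M) \<le> ennreal (\<Sum>j. \<bar>\<psi> j\<bar>) * ennreal C" .
  then have "(\<integral>\<^sup>+\<omega>. (\<Sum>j. ennreal (\<bar>\<psi> j\<bar> * q (Z (t - int j) \<omega>))) \<partial>M) \<noteq> \<infinity>"
    by (auto simp: ennreal_mult_eq_top_iff top_unique)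
  from nn_integral_noteq_infinite[OF _ this]
  have "AE \<omega> in M. (\<Sum>j. ennreal (\<bar>\<psi> j\<bar> * q (Z (t - int j) \<omega>))) \<noteq> \<infinity>" by simp
  then show "AE \<omega> in M. summable (\<lambda>j. \<bar>\<psi> j\<bar> * q (Z (t - int j) \<omega>))"
  proof eventually_elim
    case (elim \<omega>)
    have "0 \<le> \<bar>\<psi> j\<bar> * q (Z (t - int j) \<omega>)" for j by (simp add: q0)
    from summable_suminf_not_top[OF this] elim show ?case by simp
  qed
qed

lemma nn_integral_abs_noise: "(\<integral>\<^sup>+\<omega>. ennreal \<bar>Z t \<omega>\<bar> \<partial>M) \<le> ennreal (1 + m4)"
proof -
  have "(\<integral>\<^sup>+\<omega>. ennreal \<bar>Z t \<omega>\<bar> \<partial>M) \<le> (\<integral>\<^sup>+\<omega>. ennreal (1 + Z t \<omega> ^ 4) \<partial>M)"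
    by (intro nn_integral_mono ennreal_leI abs_le_1_power4)
  also have "\<dots> = ennreal (expectation (\<lambda>\<omega>. 1 + Z t \<omega> ^ 4))"
    using fourth_integrable[of t] by (intro nn_integral_eq_integral) auto
  also have "expectation (\<lambda>\<omega>. 1 + Z t \<omega> ^ 4) = 1 + m4"
    using fourth_integrable[of t] by (simp add: fourth_moment prob_space)
  finally show ?thesis .
qed

lemma AE_summable_ma:
  assumes "summable (\<lambda>j. \<bar>\<psi> j\<bar>)"
  shows "AE \<omega> in M. summable (\<lambda>j. \<bar>\<psi> j * Z (t - int j) \<omega>\<bar>)"
  using AE_summable_noise(1)[OF assms, of "\<lambda>z. \<bar>z\<bar>", OF _ _ nn_integral_abs_noise] by (simp add: abs_mult)

lemma AE_ma_sums:
  assumes "summable (\<lambda>j. \<bar>\<psi> j\<bar>)"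
  shows "AE \<omega> in M. \<forall>t. (\<lambda>j. \<psi> j * Z (t - int j) \<omega>) sums ma \<psi> t \<omega>"
  unfolding AE_all_countable ma_def
proof
  fix t
  show "AE \<omega> in M. (\<lambda>j. \<psi> j * Z (t - int j) \<omega>) sums (\<Sum>j. \<psi> j * Z (t - int j) \<omega>)"
    using AE_summable_ma[OF assms, of t]
    by eventually_elim (rule summable_sums[OF summable_rabs_cancel])
qed

text \<open>The power mean inequality with weights |\<psi> j| bounds the fourth power of every
  partial sum by one series with expectation at most \<open>A ^ 4 * m4\<close>; the bound passes to
  the limit.\<close>

lemma ma_fourth_moment:
  assumes \<psi>: "summable (\<lambda>j. \<bar>\<psi> j\<bar>)"
  shows "integrable M (\<lambda>\<omega>. ma \<psi> t \<omega> ^ 4)"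
    and "expectation (\<lambda>\<omega>. ma \<psi> t \<omega> ^ 4) \<le> (\<Sum>j. \<bar>\<psi> j\<bar>) ^ 4 * m4"
proof -
  define A where "A = (\<Sum>j. \<bar>\<psi> j\<bar>)"
  have A: "A \<ge> 0" unfolding A_def using \<psi> by (intro suminf_nonneg) auto
  have Z4: "(\<integral>\<^sup>+\<omega>. ennreal (Z t \<omega> ^ 4) \<partial>M) \<le> ennreal m4" for t
    using fourth_integrable[of t] by (subst nn_integral_eq_integral) (auto simp: fourth_moment)
  have "AE \<omega> in M. ennreal (ma \<psi> t \<omega> ^ 4) \<le> ennreal (A ^ 3) * (\<Sum>j. ennreal (\<bar>\<psi> j\<bar> * Z (t - int j) \<omega> ^ 4))"
    using AE_ma_sums[OF \<psi>]
  proof eventually_elim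
    case (elim \<omega>)
    let ?s = "\<lambda>N. \<Sum>j<N. \<psi> j * Z (t - int j) \<omega>"
    have lim: "(\<lambda>N. ennreal (?s N ^ 4)) \<longlonglongrightarrow> ennreal (ma \<psi> t \<omega> ^ 4)"
      using elim by (intro tendsto_ennrealI tendsto_power) (simp add: sums_def)
    have "ennreal (?s N ^ 4) \<le> ennreal (A ^ 3) * (\<Sum>j. ennreal (\<bar>\<psi> j\<bar> * Z (t - int j) \<omega> ^ 4))" for N
    proof -
      \<comment> \<open>The signs of \<psi> are moved onto the noise, where the fourth power removes
        them.\<close>
      have eq: "?s N = (\<Sum>j<N. \<bar>\<psi> j\<bar> * (sgn (\<psi> j) * Z (t - int j) \<omega>))"
        by (intro sum.cong refl) (simp add: mult.assoc[symmetric] abs_mult_sgn)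
      have "?s N ^ 4 \<le> (\<Sum>j<N. \<bar>\<psi> j\<bar>) ^ 3 * (\<Sum>j<N. \<bar>\<psi> j\<bar> * (sgn (\<psi> j) * Z (t - int j) \<omega>) ^ 4)"
        unfolding eq by (intro weighted_sum_power4_le) simp
      also have "\<dots> \<le> A ^ 3 * (\<Sum>j<N. \<bar>\<psi> j\<bar> * Z (t - int j) \<omega> ^ 4)"
      proof (rule mult_mono)
        show "(\<Sum>j<N. \<bar>\<psi> j\<bar>) ^ 3 \<le> A ^ 3"
          unfolding A_def using \<psi> by (intro power_mono sum_le_suminf sum_nonneg) auto
        show "(\<Sum>j<N. \<bar>\<psi> j\<bar> * (sgn (\<psi> j) * Z (t - int j) \<omega>) ^ 4) \<le> (\<Sum>j<N. \<bar>\<psi> j\<bar> * Z (t - int j) \<omega> ^ 4)"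
          by (intro sum_mono mult_left_mono) (simp_all add: sgn_if power_mult_distrib zero_le_power_eq)
      qed (use A in \<open>auto intro!: sum_nonneg mult_nonneg_nonneg\<close>)
      finally have "ennreal (?s N ^ 4) \<le> ennreal (A ^ 3) * (\<Sum>j<N. ennreal (\<bar>\<psi> j\<bar> * Z (t - int j) \<omega> ^ 4))"
        using A by (simp add: ennreal_mult'[symmetric] sum_ennreal ennreal_leI)
      also have "\<dots> \<le> ennreal (A ^ 3) * (\<Sum>j. ennreal (\<bar>\<psi> j\<bar> * Z (t - int j) \<omega> ^ 4))"
        by (intro mult_left_mono sum_le_suminf) auto
      finally show ?thesis .
    qed
    then show ?case by (intro LIMSEQ_le_const2[OF lim]) blast
  qed
  then have "(\<integral>\<^sup>+\<omega>. ennreal (ma \<psi> t \<omega> ^ 4) \<partial>M)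
      \<le> (\<integral>\<^sup>+\<omega>. ennreal (A ^ 3) * (\<Sum>j. ennreal (\<bar>\<psi> j\<bar> * Z (t - int j) \<omega> ^ 4)) \<partial>M)"
    by (rule nn_integral_mono_AE)
  also have "\<dots> = ennreal (A ^ 3) * (\<integral>\<^sup>+\<omega>. (\<Sum>j. ennreal (\<bar>\<psi> j\<bar> * Z (t - int j) \<omega> ^ 4)) \<partial>M)"
    by (rule nn_integral_cmult) measurable
  also have "\<dots> \<le> ennreal (A ^ 3) * (ennreal A * ennreal m4)"
    unfolding A_def
    by (intro mult_left_mono AE_summable_noise(2)[where q = "\<lambda>z. z ^ 4", OF \<psi> _ _ Z4])
       (simp_all add: zero_le_power_eq)
  also have "\<dots> = ennreal (A ^ 4 * m4)"
    using A m4_nonneg by (simp add: ennreal_mult'[symmetric] power4_eq_xxxx power3_eq_cube mult.assoc)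
  finally have le: "(\<integral>\<^sup>+\<omega>. ennreal (ma \<psi> t \<omega> ^ 4) \<partial>M) \<le> ennreal (A ^ 4 * m4)" .
  show int: "integrable M (\<lambda>\<omega>. ma \<psi> t \<omega> ^ 4)"
  proof (rule integrableI_nonneg)
    show "AE \<omega> in M. 0 \<le> ma \<psi> t \<omega> ^ 4" by (simp add: zero_le_power_eq)
    show "(\<integral>\<^sup>+\<omega>. ennreal (ma \<psi> t \<omega> ^ 4) \<partial>M) < \<infinity>" using le by (rule le_less_trans) simp
  qed simp
  have "ennreal (expectation (\<lambda>\<omega>. ma \<psi> t \<omega> ^ 4)) \<le> ennreal (A ^ 4 * m4)"
    using le by (subst nn_integral_eq_integral[symmetric]) (simp_all add: int zero_le_power_eq)
  then show "expectation (\<lambda>\<omega>. ma \<psi> t \<omega> ^ 4) \<le> (\<Sum>j. \<bar>\<psi> j\<bar>) ^ 4 * m4"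
    using A m4_nonneg by (simp add: A_def)
qed

text \<open>The mean of a moving average is the \<psi>-weighted combination of means of shifted
  noise, each of order n^(-1/2) in expected absolute value uniformly in the shift.\<close>

lemma ma_mean_expectation:
  assumes \<psi>: "summable (\<lambda>j. \<bar>\<psi> j\<bar>)" and n: "n \<ge> 1"
  shows "(\<integral>\<^sup>+\<omega>. ennreal \<bar>mean n (\<lambda>t. ma \<psi> (t - k) \<omega>)\<bar> \<partial>M) \<le> ennreal ((\<Sum>j. \<bar>\<psi> j\<bar>) * (1 + v) / sqrt (real n))"
proof -
  define A where "A = (\<Sum>j. \<bar>\<psi> j\<bar>)"
  have A: "A \<ge> 0" unfolding A_def using \<psi> by (intro suminf_nonneg) auto
  have v0: "v \<ge> 0" unfolding variance_eq[of 0, symmetric] by (intro integral_nonneg_AE) auto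
  define T where "T j \<omega> = mean n (\<lambda>t. Z (t - k - int j) \<omega>)" for j \<omega>
  have [measurable]: "T j \<in> borel_measurable M" for j unfolding T_def mean_def by measurable
  have ET: "(\<integral>\<^sup>+\<omega>. ennreal \<bar>T j \<omega>\<bar> \<partial>M) \<le> ennreal ((1 + v) / sqrt (real n))" for j
  proof -
    define S where "S \<omega> = (\<Sum>i<n. Z (1 - k - int j + int i) \<omega>)" for \<omega>
    have T_eq: "T j \<omega> = S \<omega> / real n" for \<omega>
      unfolding T_def S_def mean_def sum_int_eq_sum_nat by (simp add: algebra_simps)
    have S: "integrable M (\<lambda>\<omega>. (S \<omega>)\<^sup>2)" "expectation (\<lambda>\<omega>. (S \<omega>)\<^sup>2) \<le> real n * v"
    proof -
      have "integrable M (\<lambda>\<omega>. (\<Sum>i<n. 1 * Z (1 - k - int j + int i) \<omega>)\<^sup>2)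
        \<and> expectation (\<lambda>\<omega>. (\<Sum>i<n. 1 * Z (1 - k - int j + int i) \<omega>)\<^sup>2) \<le> real n * (1 * v)"
        by (rule martingale_L2[where w = "\<lambda>_ _. 1" and q = "\<lambda>z. z"])
           (simp_all add: Z_square_integrable mean_zero variance_eq prob_space)
      then show "integrable M (\<lambda>\<omega>. (S \<omega>)\<^sup>2)" "expectation (\<lambda>\<omega>. (S \<omega>)\<^sup>2) \<le> real n * v"
        by (simp_all add: S_def)
    qed
    \<comment> \<open>Young's inequality with scale sqrt n converts the second moment bound into a
      first moment bound of the right order.\<close>
    have le: "\<bar>T j \<omega>\<bar> \<le> 1 / sqrt (real n) + (S \<omega>)\<^sup>2 / (real n * sqrt (real n))" for \<omega>
    proof -
      define r where "r = sqrt (real n)"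
      have r: "r > 0" "real n = r\<^sup>2" using n by (auto simp: r_def)
      have "0 \<le> \<bar>S \<omega>\<bar> * r" using r(1) by simp
      moreover have "2 * (\<bar>S \<omega>\<bar> * r) \<le> (S \<omega>)\<^sup>2 + r\<^sup>2"
        using sum_squares_bound[of "\<bar>S \<omega>\<bar>" r] by (simp add: mult.assoc)
      ultimately have "\<bar>S \<omega>\<bar> * r \<le> r\<^sup>2 + (S \<omega>)\<^sup>2" by linarith
      then have "(\<bar>S \<omega>\<bar> * r) / (r\<^sup>2 * r) \<le> (r\<^sup>2 + (S \<omega>)\<^sup>2) / (r\<^sup>2 * r)"
        using r(1) by (intro divide_right_mono) auto
      then have "\<bar>S \<omega>\<bar> / r\<^sup>2 \<le> 1 / r + (S \<omega>)\<^sup>2 / (r\<^sup>2 * r)"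
        using r(1) by (simp add: add_divide_distrib)
      moreover have "\<bar>T j \<omega>\<bar> = \<bar>S \<omega>\<bar> / r\<^sup>2" by (simp add: T_eq r(2)[symmetric])
      ultimately show ?thesis unfolding r(2)[symmetric] unfolding r_def by simp
    qed
    have "(\<integral>\<^sup>+\<omega>. ennreal \<bar>T j \<omega>\<bar> \<partial>M) \<le> (\<integral>\<^sup>+\<omega>. ennreal (1 / sqrt (real n) + (S \<omega>)\<^sup>2 / (real n * sqrt (real n))) \<partial>M)"
      by (intro nn_integral_mono ennreal_leI le)
    also have "\<dots> = ennreal (1 / sqrt (real n) + expectation (\<lambda>\<omega>. (S \<omega>)\<^sup>2) / (real n * sqrt (real n)))"
      using S(1) by (subst nn_integral_eq_integral) (auto simp: prob_space)
    also have "\<dots> \<le> ennreal (1 / sqrt (real n) + (real n * v) / (real n * sqrt (real n)))"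
      using S(2) by (intro ennreal_leI add_left_mono divide_right_mono) auto
    also have "1 / sqrt (real n) + (real n * v) / (real n * sqrt (real n)) = (1 + v) / sqrt (real n)"
      using n by (simp add: add_divide_distrib)
    finally show ?thesis .
  qed
  have "AE \<omega> in M. ennreal \<bar>mean n (\<lambda>t. ma \<psi> (t - k) \<omega>)\<bar> \<le> (\<Sum>j. ennreal (\<bar>\<psi> j\<bar> * \<bar>T j \<omega>\<bar>))"
    using AE_ma_sums[OF \<psi>]
  proof eventually_elim
    case (elim \<omega>)
    have "(\<lambda>j. mean n (\<lambda>t. \<psi> j * Z (t - k - int j) \<omega>)) sums mean n (\<lambda>t. ma \<psi> (t - k) \<omega>)"
      unfolding mean_def using elim by (intro sums_divide sums_sum) auto
    then have lim: "(\<lambda>N. ennreal \<bar>\<Sum>j<N. \<psi> j * T j \<omega>\<bar>) \<longlonglongrightarrow> ennreal \<bar>mean n (\<lambda>t. ma \<psi> (t - k) \<omega>)\<bar>"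
      by (intro tendsto_ennrealI tendsto_rabs) (simp add: sums_def T_def mean_cmult)
    have "ennreal \<bar>\<Sum>j<N. \<psi> j * T j \<omega>\<bar> \<le> (\<Sum>j. ennreal (\<bar>\<psi> j\<bar> * \<bar>T j \<omega>\<bar>))" for N
    proof -
      have "ennreal \<bar>\<Sum>j<N. \<psi> j * T j \<omega>\<bar> \<le> ennreal (\<Sum>j<N. \<bar>\<psi> j\<bar> * \<bar>T j \<omega>\<bar>)"
        by (intro ennreal_leI order_trans[OF sum_abs]) (simp add: abs_mult)
      also have "\<dots> = (\<Sum>j<N. ennreal (\<bar>\<psi> j\<bar> * \<bar>T j \<omega>\<bar>))" by (simp add: sum_ennreal)
      also have "\<dots> \<le> (\<Sum>j. ennreal (\<bar>\<psi> j\<bar> * \<bar>T j \<omega>\<bar>))" by (intro sum_le_suminf) auto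
      finally show ?thesis .
    qed
    then show ?case by (intro LIMSEQ_le_const2[OF lim]) blast
  qed
  then have "(\<integral>\<^sup>+\<omega>. ennreal \<bar>mean n (\<lambda>t. ma \<psi> (t - k) \<omega>)\<bar> \<partial>M) \<le> (\<integral>\<^sup>+\<omega>. (\<Sum>j. ennreal (\<bar>\<psi> j\<bar> * \<bar>T j \<omega>\<bar>)) \<partial>M)"
    by (rule nn_integral_mono_AE)
  also have "\<dots> = (\<Sum>j. \<integral>\<^sup>+\<omega>. ennreal (\<bar>\<psi> j\<bar>) * ennreal \<bar>T j \<omega>\<bar> \<partial>M)"
    by (subst nn_integral_suminf) (auto simp: ennreal_mult')
  also have "\<dots> = (\<Sum>j. ennreal (\<bar>\<psi> j\<bar>) * (\<integral>\<^sup>+\<omega>. ennreal \<bar>T j \<omega>\<bar> \<partial>M))"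
    by (subst nn_integral_cmult) auto
  also have "\<dots> \<le> (\<Sum>j. ennreal (\<bar>\<psi> j\<bar>) * ennreal ((1 + v) / sqrt (real n)))"
    by (intro suminf_le mult_left_mono ET) auto
  also have "\<dots> = ennreal A * ennreal ((1 + v) / sqrt (real n))"
    unfolding A_def using \<psi> by (subst ennreal_suminf_multc) (simp add: suminf_ennreal2)
  also have "\<dots> = ennreal (A * (1 + v) / sqrt (real n))"
    using A v0 by (simp add: ennreal_mult'[symmetric])
  finally show ?thesis by (simp add: A_def)
qed

text \<open>After \<open>N\<close> back-substitutions, \<open>X t\<close> equals a partial sum of the moving average plus a
  combination of \<open>p\<close> earlier values with coefficients tending to 0; as all \<open>X t\<close> have the same law,
  this remainder vanishes in probability.\<close>
lemma stationary_ar_eq_ma: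
  assumes \<psi>: "summable (\<lambda>j. \<bar>\<psi> j\<bar>)"
    and conv: "\<And>m. (\<Sum>j\<le>m. \<psi> j * ar_coeff p \<phi> (m - j)) = (if m = 0 then 1 else 0)"
    and X[measurable]: "\<And>t. X t \<in> borel_measurable M"
    and X_distr: "\<And>t. distr M borel (X t) = distr M borel (X 0)"
    and ar: "AE \<omega> in M. \<forall>t. X t \<omega> = (\<Sum>j=1..p. \<phi> j * X (t - int j) \<omega>) + Z t \<omega>"
  shows "AE \<omega> in M. X t \<omega> = ma \<psi> t \<omega>"
proof -
  let ?c = "ar_coeff p \<phi>"
  define Cs where "Cs = (\<Sum>i\<le>p. \<bar>?c i\<bar>)"
  have Cs: "\<bar>?c i\<bar> \<le> Cs" for i
  proof (cases "i \<le> p")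
    case True
    then show ?thesis unfolding Cs_def by (intro member_le_sum) auto
  next
    case False
    then show ?thesis by (simp add: ar_coeff_def Cs_def sum_nonneg)
  qed
  have Cs0: "Cs \<ge> 0" unfolding Cs_def by (intro sum_nonneg) auto
  \<comment> \<open>The coefficient of \<open>X (t - m)\<close> when the first \<open>N\<close>
    terms of the moving average are rewritten by the autoregressive equation.\<close>
  define e where "e N m = (\<Sum>j<N. \<psi> j * (if j \<le> m then ?c (m - j) else 0))" for N m
  \<comment> \<open>For lags from \<open>N\<close> on, only the last \<open>p\<close> of the \<psi>
    can meet a nonzero autoregressive coefficient, so their absolute sum controls all leftover
    coefficients.\<close>
  define \<eta> where "\<eta> N = (\<Sum>i=1..p. \<bar>\<psi> (N - i)\<bar>)" for N
  have \<eta>0: "\<eta> N \<ge> 0" for N unfolding \<eta>_def by (intro sum_nonneg) auto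
  have \<eta>_lim: "\<eta> \<longlonglongrightarrow> 0"
  proof -
    have "\<psi> \<longlonglongrightarrow> 0" by (rule summable_LIMSEQ_zero[OF summable_rabs_cancel[OF \<psi>]])
    then have "(\<lambda>N. \<bar>\<psi> (N - i)\<bar>) \<longlonglongrightarrow> 0" for i
      by (intro tendsto_rabs_zero) (rule filterlim_compose[of \<psi>, OF _ filterlim_minus_const_nat_at_top])
    then have "(\<lambda>N. \<Sum>i=1..p. \<bar>\<psi> (N - i)\<bar>) \<longlonglongrightarrow> (\<Sum>i=1..p. 0)" by (intro tendsto_sum)
    then show ?thesis by (simp add: \<eta>_def[abs_def])
  qed
  have e_small: "e N m = (if m = 0 then 1 else 0)" if "m < N" for N m
  proof -
    have "e N m = (\<Sum>j\<le>m. \<psi> j * ?c (m - j))"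
      unfolding e_def using that by (intro sum.mono_neutral_cong_right) auto
    then show ?thesis by (simp add: conv)
  qed
  have e_large: "\<bar>e N m\<bar> \<le> Cs * \<eta> N" if "N \<le> m" "p \<le> N" for N m
  proof -
    have "e N m = (\<Sum>j\<in>{N - p..<N}. \<psi> j * (if j \<le> m then ?c (m - j) else 0))"
      unfolding e_def using that by (intro sum.mono_neutral_right) (auto simp: ar_coeff_def)
    also have "\<dots> = (\<Sum>i=1..p. \<psi> (N - i) * (if N - i \<le> m then ?c (m - (N - i)) else 0))"
      using that by (intro sum.reindex_bij_witness[of _ "\<lambda>i. N - i" "\<lambda>j. N - j"]) auto
    also have "\<bar>\<dots>\<bar> \<le> (\<Sum>i=1..p. \<bar>\<psi> (N - i)\<bar> * Cs)"
      by (intro order_trans[OF sum_abs] sum_mono) (auto simp: abs_mult Cs Cs0 intro!: mult_left_mono)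
    finally show ?thesis by (simp add: \<eta>_def sum_distrib_left mult.commute)
  qed
  define P where "P N \<omega> = (\<Sum>j<N. \<psi> j * Z (t - int j) \<omega>)" for N \<omega>
  have [measurable]: "P N \<in> borel_measurable M" for N unfolding P_def by measurable
  have rem: "AE \<omega> in M. \<forall>N\<in>{p + 1..}. \<bar>X t \<omega> - P N \<omega>\<bar> \<le> (\<Sum>m\<in>{N..<N + p}. Cs * \<eta> N * \<bar>X (t - int m) \<omega>\<bar>)"
    using ar
  proof eventually_elim
    case (elim \<omega>)
    show ?case
    proof
      fix N assume N: "N \<in> {p + 1..}"
      have Z_eq: "Z s \<omega> = (\<Sum>i\<le>p. ?c i * X (s - int i) \<omega>)" for s
      proof -
        have "{..p} = insert 0 {1..p}" by auto
        then have "(\<Sum>i\<le>p. ?c i * X (s - int i) \<omega>) = X s \<omega> + (\<Sum>i=1..p. ?c i * X (s - int i) \<omega>)"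
          by (simp add: ar_coeff_def)
        also have "(\<Sum>i=1..p. ?c i * X (s - int i) \<omega>) = - (\<Sum>j=1..p. \<phi> j * X (s - int j) \<omega>)"
          unfolding sum_negf[symmetric] by (intro sum.cong) (auto simp: ar_coeff_def)
        finally show ?thesis using elim[rule_format, of s] by simp
      qed
      have "P N \<omega> = (\<Sum>j<N. \<Sum>m<N + p. \<psi> j * (if j \<le> m then ?c (m - j) else 0) * X (t - int m) \<omega>)"
        unfolding P_def
      proof (rule sum.cong[OF refl])
        fix j assume j: "j \<in> {..<N}"
        have "Z (t - int j) \<omega> = (\<Sum>m\<in>{j..j + p}. ?c (m - j) * X (t - int m) \<omega>)"
          unfolding Z_eq by (rule sum.reindex_bij_witness[of _ "\<lambda>m. m - j" "\<lambda>i. i + j"]) (auto simp: algebra_simps)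
        also have "\<dots> = (\<Sum>m<N + p. (if j \<le> m then ?c (m - j) else 0) * X (t - int m) \<omega>)"
          using j by (intro sum.mono_neutral_cong_left) (auto simp: ar_coeff_def)
        finally show "\<psi> j * Z (t - int j) \<omega>
            = (\<Sum>m<N + p. \<psi> j * (if j \<le> m then ?c (m - j) else 0) * X (t - int m) \<omega>)"
          by (simp add: sum_distrib_left mult.assoc)
      qed
      also have "\<dots> = (\<Sum>m<N + p. e N m * X (t - int m) \<omega>)"
        by (subst sum.swap) (simp add: e_def sum_distrib_right)
      also have "{..<N + p} = insert 0 ({1..<N} \<union> {N..<N + p})" using N by auto
      also have "(\<Sum>m\<in>insert 0 ({1..<N} \<union> {N..<N + p}). e N m * X (t - int m) \<omega>)
          = X t \<omega> + ((\<Sum>m\<in>{1..<N}. e N m * X (t - int m) \<omega>) + (\<Sum>m\<in>{N..<N + p}. e N m * X (t - int m) \<omega>))"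
        using N by (subst sum.insert, simp, simp, subst sum.union_disjoint) (auto simp: e_small)
      also have "(\<Sum>m\<in>{1..<N}. e N m * X (t - int m) \<omega>) = 0"
        by (intro sum.neutral) (auto simp: e_small)
      finally have "X t \<omega> - P N \<omega> = - (\<Sum>m\<in>{N..<N + p}. e N m * X (t - int m) \<omega>)" by simp
      then have "\<bar>X t \<omega> - P N \<omega>\<bar> = \<bar>\<Sum>m\<in>{N..<N + p}. e N m * X (t - int m) \<omega>\<bar>" by simp
      also have "\<dots> \<le> (\<Sum>m\<in>{N..<N + p}. Cs * \<eta> N * \<bar>X (t - int m) \<omega>\<bar>)"
        using N by (intro order_trans[OF sum_abs] sum_mono) (auto simp: abs_mult intro!: mult_right_mono e_large)
      finally show "\<bar>X t \<omega> - P N \<omega>\<bar> \<le> (\<Sum>m\<in>{N..<N + p}. Cs * \<eta> N * \<bar>X (t - int m) \<omega>\<bar>)" .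
    qed
  qed
  \<comment> \<open>Truncation at 1 expresses convergence in probability through expectations; no
    moment of \<open>X\<close> has been established at this point.\<close>
  define b where "b x = min 1 \<bar>x\<bar>" for x :: real
  have b_bound: "0 \<le> b x" "b x \<le> 1" for x by (auto simp: b_def)
  have [measurable]: "b \<in> borel_measurable borel" unfolding b_def by measurable
  have b_int: "integrable M (\<lambda>\<omega>. b (Y \<omega>))" if [measurable]: "Y \<in> borel_measurable M" for Y
    by (rule integrable_const_bound[where B = 1]) (auto simp: b_bound)
  have b_sum: "b x \<le> (\<Sum>m\<in>I. b (y m))" if "finite I" "\<bar>x\<bar> \<le> (\<Sum>m\<in>I. \<bar>y m\<bar>)" for x and y :: "nat \<Rightarrow> real" and I
  proof (cases "\<exists>m\<in>I. \<bar>y m\<bar> \<ge> 1")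
    case True
    then obtain m where m: "m \<in> I" "\<bar>y m\<bar> \<ge> 1" by auto
    then have "b x \<le> b (y m)" by (simp add: b_def)
    also have "\<dots> \<le> (\<Sum>m\<in>I. b (y m))" using m that(1) by (intro member_le_sum) (auto simp: b_bound)
    finally show ?thesis .
  next
    case False
    then have "(\<Sum>m\<in>I. b (y m)) = (\<Sum>m\<in>I. \<bar>y m\<bar>)" by (intro sum.cong) (auto simp: b_def)
    then show ?thesis using that by (simp add: b_def)
  qed
  have upper: "expectation (\<lambda>\<omega>. b (X t \<omega> - P N \<omega>)) \<le> real p * expectation (\<lambda>\<omega>. b (Cs * \<eta> N * X 0 \<omega>))" if N: "N \<ge> p + 1" for N
  proof -
    have "expectation (\<lambda>\<omega>. b (X t \<omega> - P N \<omega>)) \<le> expectation (\<lambda>\<omega>. \<Sum>m\<in>{N..<N + p}. b (Cs * \<eta> N * X (t - int m) \<omega>))"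
    proof (rule integral_mono_AE)
      show "AE \<omega> in M. b (X t \<omega> - P N \<omega>) \<le> (\<Sum>m\<in>{N..<N + p}. b (Cs * \<eta> N * X (t - int m) \<omega>))"
        using rem
      proof eventually_elim
        case (elim \<omega>)
        then show ?case using N Cs0 \<eta>0 by (intro b_sum) (auto simp: abs_mult)
      qed
    qed (auto intro!: b_int)
    also have "\<dots> = (\<Sum>m\<in>{N..<N + p}. expectation (\<lambda>\<omega>. b (Cs * \<eta> N * X (t - int m) \<omega>)))"
      by (intro Bochner_Integration.integral_sum b_int) simp
    also have "\<dots> = (\<Sum>m\<in>{N..<N + p}. expectation (\<lambda>\<omega>. b (Cs * \<eta> N * X 0 \<omega>)))"
    proof (intro sum.cong refl)
      fix m
      have "expectation (\<lambda>\<omega>. b (Cs * \<eta> N * X (t - int m) \<omega>)) = (\<integral>x. b (Cs * \<eta> N * x) \<partial>distr M borel (X (t - int m)))"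
        by (subst integral_distr) auto
      also have "\<dots> = expectation (\<lambda>\<omega>. b (Cs * \<eta> N * X 0 \<omega>))"
        unfolding X_distr[of "t - int m"] by (subst integral_distr) auto
      finally show "expectation (\<lambda>\<omega>. b (Cs * \<eta> N * X (t - int m) \<omega>)) = expectation (\<lambda>\<omega>. b (Cs * \<eta> N * X 0 \<omega>))" .
    qed
    finally show ?thesis by simp
  qed
  have b_cont: "isCont b x" for x unfolding b_def by (intro continuous_intros)
  have "(\<lambda>N. expectation (\<lambda>\<omega>. b (Cs * \<eta> N * X 0 \<omega>))) \<longlonglongrightarrow> expectation (\<lambda>\<omega>. b 0)"
  proof (rule integral_dominated_convergence[where w = "\<lambda>_. 1"])
    have "(\<lambda>N. b (Cs * \<eta> N * x)) \<longlonglongrightarrow> b (Cs * 0 * x)" for x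
      by (intro isCont_tendsto_compose[OF b_cont] tendsto_intros \<eta>_lim)
    then show "AE \<omega> in M. (\<lambda>N. b (Cs * \<eta> N * X 0 \<omega>)) \<longlonglongrightarrow> b 0" by simp
  qed (auto simp: b_bound)
  then have lim0: "(\<lambda>N. real p * expectation (\<lambda>\<omega>. b (Cs * \<eta> N * X 0 \<omega>))) \<longlonglongrightarrow> 0"
    by (intro tendsto_mult_right_zero) (simp add: b_def)
  have "(\<lambda>N. expectation (\<lambda>\<omega>. b (X t \<omega> - P N \<omega>))) \<longlonglongrightarrow> expectation (\<lambda>\<omega>. b (X t \<omega> - ma \<psi> t \<omega>))"
  proof (rule integral_dominated_convergence[where w = "\<lambda>_. 1"])
    show "AE \<omega> in M. (\<lambda>N. b (X t \<omega> - P N \<omega>)) \<longlonglongrightarrow> b (X t \<omega> - ma \<psi> t \<omega>)"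
      using AE_ma_sums[OF \<psi>]
      by eventually_elim (auto simp: sums_def P_def intro!: isCont_tendsto_compose[OF b_cont] tendsto_diff)
  qed (auto simp: b_bound)
  moreover have "(\<lambda>N. expectation (\<lambda>\<omega>. b (X t \<omega> - P N \<omega>))) \<longlonglongrightarrow> 0"
  proof (rule tendsto_sandwich[OF _ _ tendsto_const lim0])
    show "\<forall>\<^sub>F N in sequentially. 0 \<le> expectation (\<lambda>\<omega>. b (X t \<omega> - P N \<omega>))"
      by (intro always_eventually allI integral_nonneg_AE) (simp add: b_bound)
    show "\<forall>\<^sub>F N in sequentially. expectation (\<lambda>\<omega>. b (X t \<omega> - P N \<omega>)) \<le> real p * expectation (\<lambda>\<omega>. b (Cs * \<eta> N * X 0 \<omega>))"
      using eventually_ge_at_top[of "p + 1"] by eventually_elim (rule upper)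
  qed
  ultimately have "expectation (\<lambda>\<omega>. b (X t \<omega> - ma \<psi> t \<omega>)) = 0" by (rule LIMSEQ_unique)
  then have "AE \<omega> in M. b (X t \<omega> - ma \<psi> t \<omega>) = 0"
    by (subst (asm) integral_nonneg_eq_0_iff_AE) (auto simp: b_bound intro!: b_int)
  then show ?thesis by eventually_elim (simp add: b_def min_def split: if_splits)
qed

end

section \<open>Events of asymptotically small probability\<close>

context prob_space
begin

text \<open>Stated through a measurable superset, so that the events of interest need not be shown measurable.\<close>
definition small_event :: "real \<Rightarrow> (nat \<Rightarrow> 'a \<Rightarrow> bool) \<Rightarrow> bool" where
  "small_event \<theta> Q \<longleftrightarrow> (\<forall>\<^sub>F n in sequentially. \<exists>N\<in>events. {\<omega> \<in> space M. Q n \<omega>} \<subseteq> N \<and> prob N \<le> \<theta>)"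

lemma small_eventI:
  assumes "\<forall>\<^sub>F n in sequentially. {\<omega> \<in> space M. Q n \<omega>} \<in> events \<and> prob {\<omega> \<in> space M. Q n \<omega>} \<le> \<theta>"
  shows "small_event \<theta> Q"
  unfolding small_event_def using assms by eventually_elim blast

lemma small_event_tendsto:
  assumes "\<And>n. {\<omega> \<in> space M. Q n \<omega>} \<in> events"
    and "\<forall>\<^sub>F n in sequentially. prob {\<omega> \<in> space M. Q n \<omega>} \<le> u n"
    and "u \<longlonglongrightarrow> 0" and "\<theta> > 0"
  shows "small_event \<theta> Q"
proof (rule small_eventI)
  show "\<forall>\<^sub>F n in sequentially. {\<omega> \<in> space M. Q n \<omega>} \<in> events \<and> prob {\<omega> \<in> space M. Q n \<omega>} \<le> \<theta>"
    using assms(2) order_tendstoD(2)[OF assms(3,4)] by eventually_elim (simp add: assms(1))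
qed

lemma small_event_disj:
  assumes "small_event \<theta>\<^sub>1 Q\<^sub>1" "small_event \<theta>\<^sub>2 Q\<^sub>2"
  shows "small_event (\<theta>\<^sub>1 + \<theta>\<^sub>2) (\<lambda>n \<omega>. Q\<^sub>1 n \<omega> \<or> Q\<^sub>2 n \<omega>)"
  using assms unfolding small_event_def
proof eventually_elim
  case (elim n)
  then obtain N\<^sub>1 N\<^sub>2 where N: "N\<^sub>1 \<in> events" "{\<omega> \<in> space M. Q\<^sub>1 n \<omega>} \<subseteq> N\<^sub>1" "prob N\<^sub>1 \<le> \<theta>\<^sub>1"
    "N\<^sub>2 \<in> events" "{\<omega> \<in> space M. Q\<^sub>2 n \<omega>} \<subseteq> N\<^sub>2" "prob N\<^sub>2 \<le> \<theta>\<^sub>2" by blast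
  have "prob (N\<^sub>1 \<union> N\<^sub>2) \<le> \<theta>\<^sub>1 + \<theta>\<^sub>2" using measure_Un_le[of N\<^sub>1 M N\<^sub>2] N by simp
  then show ?case using N by (intro bexI[of _ "N\<^sub>1 \<union> N\<^sub>2"]) auto
qed

text \<open>Almost sure implication is enough, which absorbs the null sets where the autoregressive
  equation or the moving average representation fails.\<close>

lemma small_event_mono:
  assumes "small_event \<theta> Q'" "\<forall>\<^sub>F n in sequentially. AE \<omega> in M. Q n \<omega> \<longrightarrow> Q' n \<omega>"
  shows "small_event \<theta> Q"
  using assms unfolding small_event_def
proof eventually_elim
  case (elim n)
  then obtain N where N: "N \<in> events" "{\<omega> \<in> space M. Q' n \<omega>} \<subseteq> N" "prob N \<le> \<theta>" by blast
  from AE_E[OF elim(2)] obtain N0 where N0: "{\<omega> \<in> space M. \<not> (Q n \<omega> \<longrightarrow> Q' n \<omega>)} \<subseteq> N0"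
    "emeasure M N0 = 0" "N0 \<in> events" by blast
  have "prob (N \<union> N0) \<le> \<theta>" using measure_Un_le[of N M N0] N N0 by (simp add: measure_def)
  then show ?case using N N0 by (intro bexI[of _ "N \<union> N0"]) auto
qed

lemma small_event_Bex:
  assumes "finite I" "\<And>i. i \<in> I \<Longrightarrow> small_event \<theta> (Q i)"
  shows "small_event (real (card I) * \<theta>) (\<lambda>n \<omega>. \<exists>i\<in>I. Q i n \<omega>)"
  using assms
proof (induction I rule: finite_induct)
  case empty
  then show ?case by (auto intro!: small_eventI)
next
  case (insert i I)
  then have "small_event (\<theta> + real (card I) * \<theta>) (\<lambda>n \<omega>. Q i n \<omega> \<or> (\<exists>i\<in>I. Q i n \<omega>))"
    by (intro small_event_disj) auto
  then show ?case using insert by (simp add: algebra_simps)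
qed

lemma small_event_Bex_finite:
  assumes "finite I" "I \<noteq> {}" "\<And>i. i \<in> I \<Longrightarrow> small_event (\<theta> / real (card I)) (Q i)"
  shows "small_event \<theta> (\<lambda>n \<omega>. \<exists>i\<in>I. Q i n \<omega>)"
  using small_event_Bex[OF assms(1,3)] assms(1,2) by simp

text \<open>Markov's inequality for a nonnegative integral, so that integrability of g need not be
  shown separately.\<close>

lemma prob_gt_le:
  assumes [measurable]: "g \<in> borel_measurable M" and "(\<integral>\<^sup>+\<omega>. ennreal \<bar>g \<omega>\<bar> \<partial>M) \<le> ennreal c" "u > 0" "c \<ge> 0"
  shows "prob {\<omega> \<in> space M. \<bar>g \<omega>\<bar> > u} \<le> c / u"
proof -
  have "emeasure M {\<omega> \<in> space M. \<bar>g \<omega>\<bar> > u} \<le> emeasure M {\<omega> \<in> space M. 1 \<le> ennreal (1 / u) * ennreal \<bar>g \<omega>\<bar>}"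
    using assms(3)
    by (intro emeasure_mono) (auto simp: ennreal_mult'[symmetric] ennreal_1[symmetric] simp del: ennreal_1)
  also have "\<dots> \<le> ennreal (1 / u) * (\<integral>\<^sup>+\<omega>. ennreal \<bar>g \<omega>\<bar> * indicator (space M) \<omega> \<partial>M)"
    by (rule nn_integral_Markov_inequality) auto
  also have "(\<integral>\<^sup>+\<omega>. ennreal \<bar>g \<omega>\<bar> * indicator (space M) \<omega> \<partial>M) = (\<integral>\<^sup>+\<omega>. ennreal \<bar>g \<omega>\<bar> \<partial>M)"
    by (intro nn_integral_cong) simp
  also have "ennreal (1 / u) * \<dots> \<le> ennreal (1 / u) * ennreal c" by (intro mult_left_mono assms) simp
  also have "\<dots> = ennreal (c / u)" using assms(3,4) by (simp add: ennreal_mult'[symmetric])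
  finally show ?thesis using assms(3,4) by (simp add: emeasure_eq_measure)
qed

lemma small_event_Markov:
  assumes g[measurable]: "\<And>n. g n \<in> borel_measurable M" and nonneg: "\<And>n \<omega>. 0 \<le> g n \<omega>"
    and c: "\<And>n. n \<ge> 1 \<Longrightarrow> (\<integral>\<^sup>+\<omega>. ennreal \<bar>g n \<omega>\<bar> \<partial>M) \<le> ennreal c" "c > 0" and "\<theta> > 0"
  shows "small_event \<theta> (\<lambda>n \<omega>. g n \<omega> > c / \<theta>)"
proof (intro small_eventI eventually_sequentiallyI[of 1] conjI)
  fix n :: nat assume "1 \<le> n"
  then show "prob {\<omega> \<in> space M. g n \<omega> > c / \<theta>} \<le> \<theta>"
    using prob_gt_le[OF g c(1), of n "c / \<theta>"] c(2) nonneg \<open>\<theta> > 0\<close> by simp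
qed measurable

lemma nn_integral_mean_le:
  assumes [measurable]: "\<And>t. g t \<in> borel_measurable M" and "\<And>t. (\<integral>\<^sup>+\<omega>. ennreal \<bar>g t \<omega>\<bar> \<partial>M) \<le> ennreal c" "c \<ge> 0" "n \<ge> 1"
  shows "(\<integral>\<^sup>+\<omega>. ennreal \<bar>mean n (\<lambda>t. g t \<omega>)\<bar> \<partial>M) \<le> ennreal c"
proof -
  have "(\<integral>\<^sup>+\<omega>. ennreal \<bar>mean n (\<lambda>t. g t \<omega>)\<bar> \<partial>M) \<le> (\<integral>\<^sup>+\<omega>. (\<Sum>t=1..int n. ennreal (1 / real n) * ennreal \<bar>g t \<omega>\<bar>) \<partial>M)"
  proof (rule nn_integral_mono)
    fix \<omega>
    have "\<bar>mean n (\<lambda>t. g t \<omega>)\<bar> \<le> (\<Sum>t=1..int n. \<bar>g t \<omega>\<bar>) / real n"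
      unfolding mean_def abs_divide by (simp add: divide_right_mono)
    also have "\<dots> = (\<Sum>t=1..int n. 1 / real n * \<bar>g t \<omega>\<bar>)" by (simp add: sum_divide_distrib)
    finally show "ennreal \<bar>mean n (\<lambda>t. g t \<omega>)\<bar> \<le> (\<Sum>t=1..int n. ennreal (1 / real n) * ennreal \<bar>g t \<omega>\<bar>)"
      by (subst ennreal_mult'[symmetric], simp, subst sum_ennreal) (auto intro!: ennreal_leI)
  qed
  also have "\<dots> = (\<Sum>t=1..int n. ennreal (1 / real n) * (\<integral>\<^sup>+\<omega>. ennreal \<bar>g t \<omega>\<bar> \<partial>M))"
    by (subst nn_integral_sum) (auto simp: nn_integral_cmult)
  also have "\<dots> \<le> (\<Sum>t=1..int n. ennreal (1 / real n) * ennreal c)"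
    by (intro sum_mono mult_left_mono assms) simp
  also have "\<dots> = ennreal c"
    using assms(3,4) by (simp add: ennreal_mult'[symmetric] ennreal_of_nat_eq_real_of_nat)
  finally show ?thesis .
qed

end

text \<open>The moving average stands in for the observed process: it agrees with it only almost
  everywhere, but it is exactly measurable in the past, as the martingale arguments require.\<close>

locale ar_noise = iid_noise M Z F L m4 v
  for M :: "'a measure" and Z F L m4 v +
  fixes p :: nat and \<phi> \<psi> :: "nat \<Rightarrow> real"
  assumes p: "p \<ge> 1" and \<psi>: "summable (\<lambda>j. \<bar>\<psi> j\<bar>)" and v: "v > 0"
    and ar: "AE \<omega> in M. \<forall>t. ma \<psi> t \<omega> = (\<Sum>j=1..p. \<phi> j * ma \<psi> (t - int j) \<omega>) + Z t \<omega>"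
begin

abbreviation "Y \<equiv> ma \<psi>"

abbreviation "abs_lags t \<omega> \<equiv> \<Sum>j=1..p. \<bar>Y (t - int j) \<omega>\<bar>"

abbreviation "yw_error n j \<omega> \<equiv> vec_index (yule_walker p n (\<lambda>t. Y t \<omega>)) (j - 1) - \<phi> j"

text \<open>One constant for the first, second and fourth absolute moments, since |x| and x^2 are at
  most 1 + x^4.\<close>

definition "mY = 1 + (\<Sum>j. \<bar>\<psi> j\<bar>) ^ 4 * m4"

lemma mY: "mY \<ge> 1"
  using \<psi> m4_nonneg by (simp add: mY_def suminf_nonneg)

lemma Y_moment:
  assumes "\<And>x. g x \<le> 1 + x ^ 4"
  shows "(\<integral>\<^sup>+\<omega>. ennreal (g (Y t \<omega>)) \<partial>M) \<le> ennreal mY"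
proof -
  have "(\<integral>\<^sup>+\<omega>. ennreal (g (Y t \<omega>)) \<partial>M) \<le> (\<integral>\<^sup>+\<omega>. ennreal (1 + Y t \<omega> ^ 4) \<partial>M)"
    by (intro nn_integral_mono ennreal_leI assms)
  also have "\<dots> = ennreal (expectation (\<lambda>\<omega>. 1 + Y t \<omega> ^ 4))"
    using ma_fourth_moment(1)[OF \<psi>] by (intro nn_integral_eq_integral) (auto intro!: add_nonneg_nonneg zero_le_even_power)
  also have "expectation (\<lambda>\<omega>. 1 + Y t \<omega> ^ 4) \<le> mY"
    using ma_fourth_moment[OF \<psi>] by (simp add: prob_space mY_def)
  finally show ?thesis by (simp add: ennreal_leI)
qed

lemma Y_square:
  "integrable M (\<lambda>\<omega>. (Y t \<omega>)\<^sup>2)" "expectation (\<lambda>\<omega>. (Y t \<omega>)\<^sup>2) \<le> mY"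
proof -
  have le: "(\<integral>\<^sup>+\<omega>. ennreal ((Y t \<omega>)\<^sup>2) \<partial>M) \<le> ennreal mY"
    by (intro Y_moment power2_le_1_power4)
  show int: "integrable M (\<lambda>\<omega>. (Y t \<omega>)\<^sup>2)"
  proof (rule integrableI_nonneg)
    show "(\<integral>\<^sup>+\<omega>. ennreal ((Y t \<omega>)\<^sup>2) \<partial>M) < \<infinity>" using le by (rule le_less_trans) simp
  qed simp_all
  show "expectation (\<lambda>\<omega>. (Y t \<omega>)\<^sup>2) \<le> mY"
    using le mY by (subst (asm) nn_integral_eq_integral) (auto simp: int)
qed

lemma prob_cross_mean:
  assumes "i \<ge> 1" "u > 0" "n \<ge> 1"
  shows "prob {\<omega> \<in> space M. \<bar>mean n (\<lambda>t. Z (t - k) \<omega> * Y (t - k - int i) \<omega>)\<bar> > u} \<le> mY * v / (real n * u\<^sup>2)"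
proof -
  have "prob {\<omega> \<in> space M. \<bar>mean n (\<lambda>t. (\<lambda>t \<omega>. Y (t - int i) \<omega>) (t - k) \<omega> * (\<lambda>z. z) (Z (t - k) \<omega>))\<bar> > u} \<le> mY * v / (real n * u\<^sup>2)"
    using assms Y_square Z_square_integrable mean_zero variance_eq
    by (intro martingale_mean_tail ma_past) auto
  then show ?thesis by (simp add: mult.commute)
qed

text \<open>Chebyshev for the centred squares, whose variance m4 - v^2 is at most m4.\<close>

lemma prob_noise_mean_square:
  assumes "n \<ge> 1"
  shows "prob {\<omega> \<in> space M. mean n (\<lambda>t. (Z (t - k) \<omega>)\<^sup>2) < v / 2} \<le> 4 * m4 / (real n * v\<^sup>2)"
proof -
  have Z4: "integrable M (\<lambda>\<omega>. ((Z t \<omega>)\<^sup>2 - v)\<^sup>2)" "expectation (\<lambda>\<omega>. ((Z t \<omega>)\<^sup>2 - v)\<^sup>2) \<le> m4" for t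
  proof -
    have eq: "((Z t \<omega>)\<^sup>2 - v)\<^sup>2 = (Z t \<omega> ^ 4 + v\<^sup>2) - 2 * v * (Z t \<omega>)\<^sup>2" for \<omega>
      by (simp add: power2_diff)
    show "integrable M (\<lambda>\<omega>. ((Z t \<omega>)\<^sup>2 - v)\<^sup>2)"
      unfolding eq using fourth_integrable[of t] Z_square_integrable[of t] by simp
    have "expectation (\<lambda>\<omega>. ((Z t \<omega>)\<^sup>2 - v)\<^sup>2) = m4 + v\<^sup>2 - 2 * v * v"
      unfolding eq using fourth_integrable[of t] Z_square_integrable[of t]
      by (simp add: prob_space fourth_moment variance_eq)
    then show "expectation (\<lambda>\<omega>. ((Z t \<omega>)\<^sup>2 - v)\<^sup>2) \<le> m4" by (simp add: power2_eq_square)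
  qed
  have "prob {\<omega> \<in> space M. mean n (\<lambda>t. (Z (t - k) \<omega>)\<^sup>2) < v / 2}
     \<le> prob {\<omega> \<in> space M. \<bar>mean n (\<lambda>t. 1 * ((Z (t - k) \<omega>)\<^sup>2 - v))\<bar> > v / 2}"
  proof (intro finite_measure_mono subsetI)
    fix \<omega> assume "\<omega> \<in> {\<omega> \<in> space M. mean n (\<lambda>t. (Z (t - k) \<omega>)\<^sup>2) < v / 2}"
    moreover have "mean n (\<lambda>t. 1 * ((Z (t - k) \<omega>)\<^sup>2 - v)) = mean n (\<lambda>t. (Z (t - k) \<omega>)\<^sup>2) - v"
      using assms by (simp add: mean_def sum_subtractf diff_divide_distrib)
    ultimately show "\<omega> \<in> {\<omega> \<in> space M. \<bar>mean n (\<lambda>t. 1 * ((Z (t - k) \<omega>)\<^sup>2 - v))\<bar> > v / 2}"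
      using v by simp
  next
    show "{\<omega> \<in> space M. \<bar>mean n (\<lambda>t. 1 * ((Z (t - k) \<omega>)\<^sup>2 - v))\<bar> > v / 2} \<in> events"
      unfolding mean_def by measurable
  qed
  also have "\<dots> \<le> 1 * m4 / (real n * (v / 2)\<^sup>2)"
    using assms Z4 v Z_square_integrable variance_eq
    by (intro martingale_mean_tail[where w = "\<lambda>_ _. 1" and q = "\<lambda>z. z\<^sup>2 - v"]) (auto simp: prob_space)
  finally show ?thesis using v by (simp add: power_divide mult.commute)
qed

lemma small_event_regressor_square:
  assumes "\<theta> > 0"
  obtains B where "B > 0" "small_event \<theta> (\<lambda>n \<omega>. \<exists>k\<in>{1..p}. mean n (\<lambda>t. (Y (t - int k) \<omega>)\<^sup>2) > B)"
proof (rule that)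
  show "mY / (\<theta> / real (card {1..p})) > 0" using mY p assms by simp
  show "small_event \<theta> (\<lambda>n \<omega>. \<exists>k\<in>{1..p}. mean n (\<lambda>t. (Y (t - int k) \<omega>)\<^sup>2) > mY / (\<theta> / real (card {1..p})))"
  proof (intro small_event_Bex_finite small_event_Markov)
    fix k
    show "(\<lambda>\<omega>. mean n (\<lambda>t. (Y (t - int k) \<omega>)\<^sup>2)) \<in> borel_measurable M" for n
      unfolding mean_def by measurable
    show "(\<integral>\<^sup>+\<omega>. ennreal \<bar>mean n (\<lambda>t. (Y (t - int k) \<omega>)\<^sup>2)\<bar> \<partial>M) \<le> ennreal mY" if "n \<ge> 1" for n
      using that mY Y_moment[OF power2_le_1_power4] by (intro nn_integral_mean_le) auto
  qed (use mY p assms in \<open>auto intro: mean_nonneg\<close>)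
qed

lemma small_event_noise_square:
  assumes "\<theta> > 0"
  shows "small_event \<theta> (\<lambda>n \<omega>. \<exists>k\<in>{1..p}. mean n (\<lambda>t. (Z (t - int k) \<omega>)\<^sup>2) < v / 2)"
proof (intro small_event_Bex_finite small_event_tendsto eventually_sequentiallyI[of 1])
  fix k
  show "{\<omega> \<in> space M. mean n (\<lambda>t. (Z (t - int k) \<omega>)\<^sup>2) < v / 2} \<in> events" for n
    unfolding mean_def by measurable
  show "prob {\<omega> \<in> space M. mean n (\<lambda>t. (Z (t - int k) \<omega>)\<^sup>2) < v / 2} \<le> (4 * m4 / v\<^sup>2) / real n" if "n \<ge> 1" for n
    using prob_noise_mean_square[OF that, of "int k"] by (simp add: mult.commute)
  show "(\<lambda>n. (4 * m4 / v\<^sup>2) / real n) \<longlonglongrightarrow> 0" by (rule lim_const_over_n)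
qed (use assms p in auto)

lemma small_event_cross:
  assumes "\<theta> > 0" "\<tau> > 0"
  shows "small_event \<theta> (\<lambda>n \<omega>. \<exists>k\<in>{1..p}. \<exists>i\<in>{1..p}. \<bar>mean n (\<lambda>t. Z (t - int k) \<omega> * Y (t - int k - int i) \<omega>)\<bar> > \<tau>)"
proof (intro small_event_Bex_finite small_event_tendsto eventually_sequentiallyI[of 1])
  fix k i assume i: "i \<in> {1..p}"
  let ?Q = "\<lambda>n \<omega>. \<bar>mean n (\<lambda>t. Z (t - int k) \<omega> * Y (t - int k - int i) \<omega>)\<bar> > \<tau>"
  show "{\<omega> \<in> space M. ?Q n \<omega>} \<in> events" for n unfolding mean_def by measurable
  show "prob {\<omega> \<in> space M. ?Q n \<omega>} \<le> (mY * v / \<tau>\<^sup>2) / real n" if "n \<ge> 1" for n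
    using prob_cross_mean[OF _ assms(2) that, of i "int k"] i by (simp add: mult.commute)
  show "(\<lambda>n. (mY * v / \<tau>\<^sup>2) / real n) \<longlonglongrightarrow> 0" by (rule lim_const_over_n)
qed (use assms p in auto)

lemma small_event_score:
  assumes "\<theta> > 0"
  obtains b where "b > 0" "small_event \<theta> (\<lambda>n \<omega>. \<exists>i\<in>{1..p}. \<bar>mean n (\<lambda>t. Y (t - int i) \<omega> * Z t \<omega>)\<bar> > b / sqrt (real n))"
proof -
  \<comment> \<open>Makes the Chebyshev bound equal to \<theta> / p for each of the p lags; the
    factor 1/n in the variance cancels the squared threshold scale.\<close>
  define b where "b = sqrt (mY * v * real p / \<theta>)"
  have pos: "mY * v * real p / \<theta> > 0" using mY v p assms by simp
  then have b: "b > 0" "b\<^sup>2 = mY * v * real p / \<theta>" by (auto simp: b_def)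
  have "small_event \<theta> (\<lambda>n \<omega>. \<exists>i\<in>{1..p}. \<bar>mean n (\<lambda>t. Y (t - int i) \<omega> * Z t \<omega>)\<bar> > b / sqrt (real n))"
  proof (intro small_event_Bex_finite small_eventI eventually_sequentiallyI[of 1] conjI)
    fix i n assume i: "i \<in> {1..p}" and n: "1 \<le> (n :: nat)"
    show "{\<omega> \<in> space M. \<bar>mean n (\<lambda>t. Y (t - int i) \<omega> * Z t \<omega>)\<bar> > b / sqrt (real n)} \<in> events" unfolding mean_def by measurable
    have "prob {\<omega> \<in> space M. \<bar>mean n (\<lambda>t. Z (t - 0) \<omega> * Y (t - 0 - int i) \<omega>)\<bar> > b / sqrt (real n)}
        \<le> mY * v / (real n * (b / sqrt (real n))\<^sup>2)"
      using i n b by (intro prob_cross_mean) auto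
    also have "\<dots> = \<theta> / real (card {1..p})"
      using n b mY v p assms by (simp add: power_divide b(2) field_simps)
    finally show "prob {\<omega> \<in> space M. \<bar>mean n (\<lambda>t. Y (t - int i) \<omega> * Z t \<omega>)\<bar> > b / sqrt (real n)} \<le> \<theta> / real (card {1..p})"
      by (simp add: mult.commute)
  qed (use p in auto)
  with b show thesis by (intro that)
qed

abbreviation "boundary n \<equiv> {1 - int p..0} \<union> {int n + 1..int n + int p}"

lemma small_event_boundary:
  assumes "\<theta> > 0"
  obtains b where "b > 0" "small_event \<theta> (\<lambda>n \<omega>. (\<Sum>s\<in>boundary n. \<Sum>k\<le>p. (Y (s - int k) \<omega>)\<^sup>2) > b)"
proof (rule that)
  let ?g = "\<lambda>n \<omega>. \<Sum>s\<in>boundary n. \<Sum>k\<le>p. (Y (s - int k) \<omega>)\<^sup>2"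
  \<comment> \<open>There are 2p boundary times with p + 1 lags each, and every square has mean at
    most \<open>mY\<close>.\<close>
  define m where "m = 2 * real p * (real p + 1) * mY"
  have m: "m > 0" using mY p by (simp add: m_def)
  then show "m / \<theta> > 0" using assms by simp
  show "small_event \<theta> (\<lambda>n \<omega>. ?g n \<omega> > m / \<theta>)"
  proof (rule small_event_Markov)
    fix n
    have card: "card (boundary n) = 2 * p" by (subst card_Un_disjoint) auto
    have "(\<integral>\<^sup>+\<omega>. ennreal \<bar>?g n \<omega>\<bar> \<partial>M) = (\<integral>\<^sup>+\<omega>. (\<Sum>s\<in>boundary n. \<Sum>k\<le>p. ennreal ((Y (s - int k) \<omega>)\<^sup>2)) \<partial>M)"
      by (intro nn_integral_cong) (simp add: sum_ennreal sum_nonneg)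
    also have "\<dots> = (\<Sum>s\<in>boundary n. \<Sum>k\<le>p. \<integral>\<^sup>+\<omega>. ennreal ((Y (s - int k) \<omega>)\<^sup>2) \<partial>M)"
      by (simp add: nn_integral_sum del: sum_ennreal)
    also have "\<dots> \<le> (\<Sum>s\<in>boundary n. \<Sum>k\<le>p. ennreal mY)"
      by (intro sum_mono Y_moment power2_le_1_power4)
    also have "\<dots> = ennreal m"
      unfolding sum_constant card
      using mY by (simp add: m_def ennreal_of_nat_eq_real_of_nat ennreal_mult'[symmetric] algebra_simps ennreal_plus[symmetric] del: ennreal_plus)
    finally show "(\<integral>\<^sup>+\<omega>. ennreal \<bar>?g n \<omega>\<bar> \<partial>M) \<le> ennreal m" .
  qed (use m assms in \<open>auto intro!: sum_nonneg\<close>)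
qed

lemma small_event_mean_abs:
  assumes "\<theta> > 0"
  obtains B where "B > 0" "small_event \<theta> (\<lambda>n \<omega>. mean n (\<lambda>t. abs_lags t \<omega>) > B)"
proof (rule that)
  define m where "m = real p * mY"
  have m: "m > 0" using mY p by (simp add: m_def)
  then show "m / \<theta> > 0" using assms by simp
  show "small_event \<theta> (\<lambda>n \<omega>. mean n (\<lambda>t. abs_lags t \<omega>) > m / \<theta>)"
  proof (intro small_event_Markov nn_integral_mean_le)
    fix t
    have "(\<integral>\<^sup>+\<omega>. ennreal \<bar>abs_lags t \<omega>\<bar> \<partial>M) = (\<integral>\<^sup>+\<omega>. (\<Sum>j=1..p. ennreal \<bar>Y (t - int j) \<omega>\<bar>) \<partial>M)"
      by (intro nn_integral_cong) (simp add: sum_ennreal sum_nonneg)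
    also have "\<dots> = (\<Sum>j=1..p. \<integral>\<^sup>+\<omega>. ennreal \<bar>Y (t - int j) \<omega>\<bar> \<partial>M)"
      by (rule nn_integral_sum) measurable
    also have "\<dots> \<le> (\<Sum>j=1..p. ennreal mY)"
      by (intro sum_mono Y_moment abs_le_1_power4)
    also have "\<dots> = ennreal m"
      using mY by (simp add: m_def ennreal_of_nat_eq_real_of_nat ennreal_mult'[symmetric])
    finally show "(\<integral>\<^sup>+\<omega>. ennreal \<bar>abs_lags t \<omega>\<bar> \<partial>M) \<le> ennreal m" .
  next
    show "(\<lambda>\<omega>. mean n (\<lambda>t. abs_lags t \<omega>)) \<in> borel_measurable M" for n
      unfolding mean_def by measurable
  qed (use m assms in \<open>auto intro!: mean_nonneg sum_nonneg\<close>)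
qed

lemma small_event_mean:
  assumes "\<theta> > 0" "\<kappa> > 0"
  shows "small_event \<theta> (\<lambda>n \<omega>. \<exists>j\<in>{1..p}. \<bar>mean n (\<lambda>t. Y (t - int j) \<omega>)\<bar> > \<kappa>)"
proof (intro small_event_Bex_finite small_event_tendsto eventually_sequentiallyI[of 1])
  fix k
  define c where "c = (\<Sum>j. \<bar>\<psi> j\<bar>) * (1 + v)"
  have c: "c \<ge> 0" using \<psi> v by (simp add: c_def suminf_nonneg)
  have [measurable]: "(\<lambda>\<omega>. mean n (\<lambda>t. Y (t - int k) \<omega>)) \<in> borel_measurable M" for n
    unfolding mean_def by measurable
  show "{\<omega> \<in> space M. \<bar>mean n (\<lambda>t. Y (t - int k) \<omega>)\<bar> > \<kappa>} \<in> events" for n by measurable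
  show "prob {\<omega> \<in> space M. \<bar>mean n (\<lambda>t. Y (t - int k) \<omega>)\<bar> > \<kappa>} \<le> c / sqrt (real n) / \<kappa>" if "n \<ge> 1" for n
    using ma_mean_expectation[OF \<psi> that, of "int k"] c assms by (intro prob_gt_le) (auto simp: c_def)
  have "filterlim (\<lambda>n. sqrt (real n)) at_top sequentially"
    by (intro filterlim_compose[OF sqrt_at_top] filterlim_real_sequentially)
  then show "(\<lambda>n. c / sqrt (real n) / \<kappa>) \<longlonglongrightarrow> 0"
    by (intro tendsto_divide_zero tendsto_divide_0[OF tendsto_const] filterlim_at_top_imp_at_infinity)
qed (use assms p in auto)

text \<open>A union bound over n p variables with bounded fourth moment leaves n n^(-3/2) =
  n^(-1/2). The exponent 3/8 is what makes shifts scaled by n^(-1/2) at most n^(-1/8).\<close>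

lemma small_event_max:
  assumes "\<theta> > 0" "b > 0"
  shows "small_event \<theta> (\<lambda>n \<omega>. \<exists>t\<in>{1..int n}. b * (abs_lags t \<omega> + 1) > real n powr (3 / 8))"
proof -
  \<comment> \<open>The factor 2 reserves half of n^(3/8) for the summand 1, which is dominated for
    large n.\<close>
  define d where "d = 2 * b * real p"
  have d: "d > 0" using assms p by (simp add: d_def)
  have tail: "prob {\<omega> \<in> space M. \<bar>Y t \<omega>\<bar> > u} \<le> mY / u ^ 4" if "u > 0" for t u
  proof -
    have "prob {\<omega> \<in> space M. \<bar>Y t \<omega>\<bar> > u} \<le> prob {\<omega> \<in> space M. \<bar>Y t \<omega> ^ 4\<bar> > u ^ 4}"
    proof (intro finite_measure_mono subsetI)
      fix \<omega> assume "\<omega> \<in> {\<omega> \<in> space M. \<bar>Y t \<omega>\<bar> > u}"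
      then show "\<omega> \<in> {\<omega> \<in> space M. \<bar>Y t \<omega> ^ 4\<bar> > u ^ 4}"
        using that power_strict_mono[of u "\<bar>Y t \<omega>\<bar>" 4] by (simp add: power_abs)
    qed simp
    also have "\<dots> \<le> mY / u ^ 4"
      using that mY Y_moment[of "\<lambda>x. \<bar>x ^ 4\<bar>" t] by (intro prob_gt_le) (auto simp: power_even_abs)
    finally show ?thesis .
  qed
  let ?Q = "\<lambda>n \<omega>. \<exists>t\<in>{1..int n}. \<exists>j\<in>{1..p}. \<bar>Y (t - int j) \<omega>\<bar> > real n powr (3 / 8) / d"
  have "small_event \<theta> ?Q"
  proof (intro small_event_tendsto eventually_sequentiallyI[of 1])
    show "{\<omega> \<in> space M. ?Q n \<omega>} \<in> events" for n by measurable
    show "prob {\<omega> \<in> space M. ?Q n \<omega>} \<le> real p * mY * d ^ 4 * (1 / sqrt (real n))" if n: "n \<ge> 1" for n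
    proof -
      let ?E = "\<lambda>(t, j). {\<omega> \<in> space M. \<bar>Y (t - int j) \<omega>\<bar> > real n powr (3 / 8) / d}"
      have "prob {\<omega> \<in> space M. ?Q n \<omega>} = prob (\<Union>x\<in>{1..int n} \<times> {1..p}. ?E x)"
        by (intro arg_cong[where f = prob]) auto
      also have "\<dots> \<le> (\<Sum>x\<in>{1..int n} \<times> {1..p}. prob (?E x))"
        by (intro finite_measure_subadditive_finite) (auto split: prod.splits)
      also have "\<dots> \<le> (\<Sum>x\<in>{1..int n} \<times> {1..p}. mY / (real n powr (3 / 8) / d) ^ 4)"
        using n d by (intro sum_mono) (auto intro!: tail)
      also have "\<dots> = real p * mY * d ^ 4 * (real n / real n powr (3 / 2))"
        using n d by (simp add: power_divide powr_power card_cartesian_product)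
      also have "real n / real n powr (3 / 2) = 1 / sqrt (real n)"
      proof -
        have "real n powr (3 / 2) = real n powr (1 + 1 / 2)" by simp
        also have "\<dots> = real n * sqrt (real n)" unfolding powr_add using n by (simp add: powr_half_sqrt)
        finally show ?thesis using n by simp
      qed
      finally show ?thesis .
    qed
    have "filterlim (\<lambda>n. sqrt (real n)) at_top sequentially"
      by (intro filterlim_compose[OF sqrt_at_top] filterlim_real_sequentially)
    then show "(\<lambda>n. real p * mY * d ^ 4 * (1 / sqrt (real n))) \<longlonglongrightarrow> 0"
      by (intro tendsto_mult_right_zero tendsto_divide_0[OF tendsto_const] filterlim_at_top_imp_at_infinity)
  qed fact
  then show ?thesis
  proof (rule small_event_mono)
    have "filterlim (\<lambda>n. real n powr (3 / 8)) at_top sequentially"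
      by (intro filterlim_compose[OF real_powr_at_top] filterlim_real_sequentially) simp
    then have "\<forall>\<^sub>F n in sequentially. real n powr (3 / 8) \<ge> 2 * b"
      by (simp add: filterlim_at_top)
    then show "\<forall>\<^sub>F n in sequentially. AE \<omega> in M.
        (\<exists>t\<in>{1..int n}. b * (abs_lags t \<omega> + 1) > real n powr (3 / 8)) \<longrightarrow>
        ?Q n \<omega>"
    proof (eventually_elim, intro AE_I2 impI)
      fix n \<omega> assume n: "2 * b \<le> real n powr (3 / 8)"
        and "\<exists>t\<in>{1..int n}. b * (abs_lags t \<omega> + 1) > real n powr (3 / 8)"
      then obtain t where t: "t \<in> {1..int n}" "b * (abs_lags t \<omega> + 1) > real n powr (3 / 8)" by blast
      have "\<exists>j\<in>{1..p}. \<bar>Y (t - int j) \<omega>\<bar> > real n powr (3 / 8) / d"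
      proof (rule ccontr)
        assume "\<not> ?thesis"
        then have "abs_lags t \<omega> \<le> (\<Sum>j=1..p. real n powr (3 / 8) / d)"
          by (intro sum_mono) (auto simp: not_less)
        also have "\<dots> = real n powr (3 / 8) / (2 * b)" using p assms by (simp add: d_def)
        finally have "b * abs_lags t \<omega> \<le> real n powr (3 / 8) / 2"
          using assms by (simp add: field_simps)
        then show False using t(2) n by (simp add: distrib_left)
      qed
      with t(1) show "?Q n \<omega>" by blast
    qed
  qed
qed

text \<open>Outside five small events the Gram bound holds with a fixed constant c, the scores are
  of order n^(-1/2), and the boundary energy is bounded, so after division by n it is of even
  smaller order.\<close>

lemma small_event_yule_walker:
  assumes "\<theta> > 0"
  obtains b where "b > 0"
    "small_event \<theta> (\<lambda>n \<omega>. \<exists>j\<in>{1..p}. \<bar>yw_error n j \<omega>\<bar> > b / sqrt (real n))"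
proof -
  define \<theta>' where "\<theta>' = \<theta> / 5"
  have \<theta>': "\<theta>' > 0" using assms by (simp add: \<theta>'_def)
  obtain B where B: "B > 0" "small_event \<theta>' (\<lambda>n \<omega>. \<exists>k\<in>{1..p}. mean n (\<lambda>t. (Y (t - int k) \<omega>)\<^sup>2) > B)"
    using small_event_regressor_square[OF \<theta>'] .
  obtain b1 where b1: "b1 > 0" "small_event \<theta>' (\<lambda>n \<omega>. \<exists>i\<in>{1..p}. \<bar>mean n (\<lambda>t. Y (t - int i) \<omega> * Z t \<omega>)\<bar> > b1 / sqrt (real n))"
    using small_event_score[OF \<theta>'] .
  obtain b2 where b2: "b2 > 0" "small_event \<theta>' (\<lambda>n \<omega>. (\<Sum>s\<in>boundary n. \<Sum>k\<le>p. (Y (s - int k) \<omega>)\<^sup>2) > b2)"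
    using small_event_boundary[OF \<theta>'] .
  obtain c \<tau> where c: "c > 0" "\<tau> > 0" and gram:
    "\<And>n x z w. n \<ge> 1 \<Longrightarrow> (\<And>t. x t = (\<Sum>j=1..p. \<phi> j * x (t - int j)) + z t) \<Longrightarrow>
      (\<And>k. k \<in> {1..p} \<Longrightarrow> mean n (\<lambda>t. (x (t - int k))\<^sup>2) \<le> B) \<Longrightarrow>
      (\<And>k. k \<in> {1..p} \<Longrightarrow> mean n (\<lambda>t. (z (t - int k))\<^sup>2) \<ge> v / 2) \<Longrightarrow>
      (\<And>k i. k \<in> {1..p} \<Longrightarrow> i \<in> {1..p} \<Longrightarrow>
         \<bar>mean n (\<lambda>t. z (t - int k) * x (t - int k - int i))\<bar> \<le> \<tau>) \<Longrightarrow>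
      c * (\<Sum>k=1..p. (w k)\<^sup>2) \<le> mean n (\<lambda>t. (\<Sum>i=1..p. w i * x (t - int i))\<^sup>2)"
  proof (rule ar_gram_form_lower_bound[OF p half_gt_zero[OF v] less_imp_le[OF B(1)], of \<phi>], goal_cases)
    case (1 c \<tau>)
    show thesis by (rule 1(1)[OF 1(2,3) 1(4)])
  qed
  define \<Phi> where "\<Phi> = 1 + (\<Sum>j=1..p. \<bar>\<phi> j\<bar>)"
  have \<Phi>: "\<Phi> > 0" unfolding \<Phi>_def by (intro add_pos_nonneg sum_nonneg) auto
  \<comment> \<open>Collects p normal equations, each with a score term and a boundary term, and the
    division by the Gram constant \<open>c\<close>.\<close>
  define b where "b = real p * (b1 + \<Phi> * b2) / c"
  have b: "b > 0" using p b1 b2 c \<Phi> by (simp add: b_def add_pos_pos)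
  let ?bad = "\<lambda>n \<omega>. (\<exists>k\<in>{1..p}. mean n (\<lambda>t. (Y (t - int k) \<omega>)\<^sup>2) > B)
     \<or> (\<exists>k\<in>{1..p}. mean n (\<lambda>t. (Z (t - int k) \<omega>)\<^sup>2) < v / 2)
     \<or> (\<exists>k\<in>{1..p}. \<exists>i\<in>{1..p}. \<bar>mean n (\<lambda>t. Z (t - int k) \<omega> * Y (t - int k - int i) \<omega>)\<bar> > \<tau>)
     \<or> (\<exists>i\<in>{1..p}. \<bar>mean n (\<lambda>t. Y (t - int i) \<omega> * Z t \<omega>)\<bar> > b1 / sqrt (real n))
     \<or> (\<Sum>s\<in>boundary n. \<Sum>k\<le>p. (Y (s - int k) \<omega>)\<^sup>2) > b2"
  have "small_event (\<theta>' + (\<theta>' + (\<theta>' + (\<theta>' + \<theta>')))) ?bad"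
    using B(2) small_event_noise_square[OF \<theta>'] small_event_cross[OF \<theta>' c(2)] b1(2) b2(2)
    by (intro small_event_disj)
  moreover have "\<theta>' + (\<theta>' + (\<theta>' + (\<theta>' + \<theta>'))) = \<theta>" by (simp add: \<theta>'_def)
  ultimately have bad: "small_event \<theta> ?bad" by (simp only:)
  let ?Q = "\<lambda>n \<omega>. \<exists>j\<in>{1..p}. \<bar>yw_error n j \<omega>\<bar> > b / sqrt (real n)"
  have "small_event \<theta> ?Q"
    using bad
  proof (rule small_event_mono)
    show "\<forall>\<^sub>F n in sequentially. AE \<omega> in M. ?Q n \<omega> \<longrightarrow> ?bad n \<omega>"
      using eventually_ge_at_top[of 1]
    proof eventually_elim
      fix n :: nat assume n: "1 \<le> n"
      show "AE \<omega> in M. ?Q n \<omega> \<longrightarrow> ?bad n \<omega>"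
        using ar
      proof eventually_elim
        fix \<omega> assume ar: "\<forall>t. Y t \<omega> = (\<Sum>j=1..p. \<phi> j * Y (t - int j) \<omega>) + Z t \<omega>"
        show "?Q n \<omega> \<longrightarrow> ?bad n \<omega>"
        proof (rule impI, rule ccontr)
          assume ex: "?Q n \<omega>"
            and good: "\<not> ?bad n \<omega>"
          from ex obtain j where j: "j \<in> {1..p}" "\<bar>yw_error n j \<omega>\<bar> > b / sqrt (real n)" by blast
          let ?S = "\<Sum>s\<in>boundary n. \<Sum>k\<le>p. (Y (s - int k) \<omega>)\<^sup>2"
          from good have g1: "mean n (\<lambda>t. (Y (t - int k) \<omega>)\<^sup>2) \<le> B" if "k \<in> {1..p}" for k
            using that by (meson not_le)
          from good have g2: "mean n (\<lambda>t. (Z (t - int k) \<omega>)\<^sup>2) \<ge> v / 2" if "k \<in> {1..p}" for k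
            using that by (meson not_le)
          from good have g3: "\<bar>mean n (\<lambda>t. Z (t - int k) \<omega> * Y (t - int k - int i) \<omega>)\<bar> \<le> \<tau>"
            if "k \<in> {1..p}" "i \<in> {1..p}" for k i
            using that by (meson not_le)
          from good have g4: "\<bar>mean n (\<lambda>t. Y (t - int i) \<omega> * Z t \<omega>)\<bar> \<le> b1 / sqrt (real n)" if "i \<in> {1..p}" for i
            using that by (meson not_le)
          from good have g5: "?S \<le> b2" by (meson not_le)
          have "c * (\<Sum>k=1..p. (w k)\<^sup>2) \<le> mean n (\<lambda>t. (\<Sum>i=1..p. w i * Y (t - int i) \<omega>)\<^sup>2)" for w
            by (rule gram[OF n ar[rule_format] g1 g2 g3])
          then have "\<bar>yw_error n j \<omega>\<bar>
              \<le> (\<Sum>i=1..p. \<bar>mean n (\<lambda>t. Y (t - int i) \<omega> * Z t \<omega>)\<bar> + \<Phi> * ?S / real n) / c"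
            unfolding \<Phi>_def by (rule yule_walker_error_le[OF n c(1) ar[rule_format] _ j(1)])
          also have "\<dots> \<le> (\<Sum>i=1..p. b1 / sqrt (real n) + \<Phi> * b2 / sqrt (real n)) / c"
          proof (intro divide_right_mono sum_mono add_mono)
            fix i assume "i \<in> {1..p}"
            then show "\<bar>mean n (\<lambda>t. Y (t - int i) \<omega> * Z t \<omega>)\<bar> \<le> b1 / sqrt (real n)" by (rule g4)
            have "sqrt (real n) \<le> sqrt (real n) * sqrt (real n)"
              using n mult_left_mono[of 1 "sqrt (real n)" "sqrt (real n)"] by simp
            then have "sqrt (real n) \<le> real n" by simp
            with g5 show "\<Phi> * ?S / real n \<le> \<Phi> * b2 / sqrt (real n)"
              using \<Phi> n b2(1) by (intro frac_le mult_left_mono) auto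
          qed (use c in auto)
          also have "\<dots> = b / sqrt (real n)" by (simp add: b_def add_divide_distrib distrib_left mult.commute)
          finally show False using j(2) by simp
        qed
      qed
    qed
  qed
  with b show thesis by (rule that)
qed

end

section \<open>Residual empirical distribution functions\<close>

context iid_noise
begin

lemma small_event_increment_grid:
  assumes D: "\<And>n t. D n t \<in> borel_measurable (past t)"
    and bound: "\<And>n t \<omega>. \<bar>D n t \<omega>\<bar> \<le> real n powr (- 1 / 8)"
    and fin: "\<And>n. finite (G n)"
    and card: "\<forall>\<^sub>F n in sequentially. real (card (G n)) \<le> C * real n powr k"
    and "\<epsilon> > 0" "\<theta> > 0"
  shows "small_event \<theta> (\<lambda>n \<omega>. \<exists>y\<in>G n. \<bar>\<Sum>t = 1..int n. increment t y (D n t \<omega>) \<omega>\<bar> \<ge> \<epsilon> * sqrt (real n))"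
proof (rule small_event_tendsto)
  \<comment> \<open>The exponential tail with parameter n^(-7/16): its variance term is the constant
    \<open>L\<close>, and its linear term is \<epsilon> n^(1/16), which outgrows the logarithm of
    any polynomial number of grid points.\<close>
  define u where "u n = 2 * exp (L - \<epsilon> * real n powr (1 / 16))" for n
  have [measurable]: "D n t \<in> borel_measurable M" for n t using D by (rule measurable_past_imp)
  have l_small: "\<forall>\<^sub>F n in sequentially. real n powr (- 7 / 16) \<le> 1 / 2"
    by real_asymp
  let ?E = "\<lambda>n y. {\<omega> \<in> space M. \<bar>\<Sum>t = 1..int n. increment t y (D n t \<omega>) \<omega>\<bar> \<ge> \<epsilon> * sqrt (real n)}"
  have E: "?E n y \<in> events" for n y
    unfolding increment_def indicator_def atMost_iff by measurable
  have eq: "{\<omega> \<in> space M. \<exists>y\<in>G n. \<bar>\<Sum>t = 1..int n. increment t y (D n t \<omega>) \<omega>\<bar> \<ge> \<epsilon> * sqrt (real n)} = (\<Union>y\<in>G n. ?E n y)" for n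
    by auto
  show "{\<omega> \<in> space M. \<exists>y\<in>G n. \<bar>\<Sum>t = 1..int n. increment t y (D n t \<omega>) \<omega>\<bar> \<ge> \<epsilon> * sqrt (real n)} \<in> events" for n
    unfolding eq using fin E by auto
  show "\<forall>\<^sub>F n in sequentially.
      prob {\<omega> \<in> space M. \<exists>y\<in>G n. \<bar>\<Sum>t = 1..int n. increment t y (D n t \<omega>) \<omega>\<bar> \<ge> \<epsilon> * sqrt (real n)} \<le> C * real n powr k * u n"
    unfolding eq using card l_small eventually_ge_at_top[of 1]
  proof eventually_elim
    case (elim n)
    have tail: "prob (?E n y) \<le> u n" for y
    proof -
      have "prob (?E n y) \<le> 2 * exp (real n * ((real n powr (- 7 / 16))\<^sup>2 * (L * real n powr (- 1 / 8)))
          - real n powr (- 7 / 16) * (\<epsilon> * sqrt (real n)))"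
        using elim by (intro increment_sum_tail D bound) auto
      also have "real n * ((real n powr (- 7 / 16))\<^sup>2 * (L * real n powr (- 1 / 8))) = L"
      proof -
        have "real n * ((real n powr (- 7 / 16))\<^sup>2 * real n powr (- 1 / 8))
            = real n powr 1 * (real n powr (- 7 / 8) * real n powr (- 1 / 8))"
          using elim(3) by (simp add: powr_power)
        also have "\<dots> = 1" using elim(3) unfolding powr_add[symmetric] by simp
        finally show ?thesis by (simp add: mult_ac)
      qed
      also have "real n powr (- 7 / 16) * (\<epsilon> * sqrt (real n)) = \<epsilon> * real n powr (1 / 16)"
      proof -
        have "real n powr (- 7 / 16) * real n powr (1 / 2) = real n powr (1 / 16)"
          unfolding powr_add[symmetric] by simp
        then show ?thesis using elim(3) by (simp add: powr_half_sqrt)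
      qed
      finally show ?thesis by (simp add: u_def)
    qed
    have "prob (\<Union>y\<in>G n. ?E n y) \<le> (\<Sum>y\<in>G n. prob (?E n y))"
      using fin E by (intro finite_measure_subadditive_finite) auto
    also have "\<dots> \<le> (\<Sum>y\<in>G n. u n)" by (intro sum_mono tail)
    also have "\<dots> \<le> C * real n powr k * u n"
      using elim(1) by (simp add: u_def mult_right_mono)
    finally show ?case .
  qed
  show "(\<lambda>n. C * real n powr k * u n) \<longlonglongrightarrow> 0"
    unfolding u_def using \<open>\<epsilon> > 0\<close> by real_asymp
qed fact

text \<open>The derivative at y is common to all t, so the shifts are summed with their signs before
  absolute values are taken and cancellation among them survives. Only the Hoelder remainder of the
  mean value theorem pays the sum of absolute shifts, with the small factor c^\<beta>.\<close>

lemma compensator_sum_le: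
  assumes der: "\<And>x. (F has_real_derivative g x) (at x)"
    and holder: "\<And>x y. \<bar>g x - g y\<bar> \<le> H * \<bar>x - y\<bar> powr \<beta>" and \<beta>: "\<beta> > 0"
    and D: "\<And>t. t \<in> T \<Longrightarrow> \<bar>D t\<bar> \<le> c" and c: "c \<ge> 0"
  shows "\<bar>\<Sum>t\<in>T. F (y + D t) - F y\<bar> \<le> L * \<bar>\<Sum>t\<in>T. D t\<bar> + H * c powr \<beta> * (\<Sum>t\<in>T. \<bar>D t\<bar>)"
proof -
  have H: "H \<ge> 0" using holder[of 1 0] by simp
  \<comment> \<open>The Lipschitz constant of \<open>F\<close> bounds its difference quotients and
    hence its derivative.\<close>
  have g_le: "\<bar>g y\<bar> \<le> L"
  proof -
    have "((\<lambda>h. (F (y + h) - F y) / h) \<longlongrightarrow> g y) (at 0)" using der[of y] by (simp add: DERIV_def)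
    then have "((\<lambda>h. \<bar>(F (y + h) - F y) / h\<bar>) \<longlongrightarrow> \<bar>g y\<bar>) (at 0)" by (rule tendsto_rabs)
    moreover have "\<forall>\<^sub>F h in at 0. \<bar>(F (y + h) - F y) / h\<bar> \<le> L"
      unfolding eventually_at_filter
      using F_lipschitz[of "y + h" y for h] by (auto simp: abs_divide divide_le_eq intro!: always_eventually)
    ultimately show ?thesis by (intro tendsto_upperbound) auto
  qed
  have expand: "\<bar>F (y + d) - F y - g y * d\<bar> \<le> H * c powr \<beta> * \<bar>d\<bar>" if d: "\<bar>d\<bar> \<le> c" for d
  proof -
    obtain \<xi> where \<xi>: "\<bar>\<xi> - y\<bar> \<le> \<bar>d\<bar>" "F (y + d) - F y = d * g \<xi>"
    proof -
      consider "d = 0" | "d > 0" | "d < 0" by linarith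
      then show thesis
      proof cases
        case 1
        then show thesis by (intro that[of y]) auto
      next
        case 2
        then obtain z where "y < z" "z < y + d" "F (y + d) - F y = (y + d - y) * g z"
          using MVT2[of y "y + d" F g] der by auto
        then show thesis using 2 by (intro that[of z]) auto
      next
        case 3
        then obtain z where "y + d < z" "z < y" "F y - F (y + d) = (y - (y + d)) * g z"
          using MVT2[of "y + d" y F g] der by auto
        then show thesis using 3 by (intro that[of z]) (auto simp: algebra_simps)
      qed
    qed
    have "\<bar>F (y + d) - F y - g y * d\<bar> = \<bar>g \<xi> - g y\<bar> * \<bar>d\<bar>"
      unfolding \<xi>(2) abs_mult[symmetric] by (simp add: algebra_simps)
    also have "\<dots> \<le> (H * c powr \<beta>) * \<bar>d\<bar>"
    proof (rule mult_right_mono)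
      have "\<bar>\<xi> - y\<bar> powr \<beta> \<le> c powr \<beta>" using \<xi>(1) d \<beta> by (intro powr_mono2) auto
      then show "\<bar>g \<xi> - g y\<bar> \<le> H * c powr \<beta>"
        using holder[of \<xi> y] H by (meson mult_left_mono order_trans)
    qed simp
    finally show ?thesis .
  qed
  have "(\<Sum>t\<in>T. F (y + D t) - F y) = g y * (\<Sum>t\<in>T. D t) + (\<Sum>t\<in>T. F (y + D t) - F y - g y * D t)"
    by (simp add: sum_subtractf sum_distrib_left)
  also have "\<bar>\<dots>\<bar> \<le> \<bar>g y\<bar> * \<bar>\<Sum>t\<in>T. D t\<bar> + \<bar>\<Sum>t\<in>T. F (y + D t) - F y - g y * D t\<bar>"
    unfolding abs_mult[symmetric] by (rule abs_triangle_ineq)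
  also have "\<dots> \<le> L * \<bar>\<Sum>t\<in>T. D t\<bar> + (\<Sum>t\<in>T. H * c powr \<beta> * \<bar>D t\<bar>)"
    using g_le by (intro add_mono mult_right_mono order_trans[OF sum_abs] sum_mono expand D) auto
  finally show ?thesis by (simp add: sum_distrib_left)
qed

end

context ar_noise
begin

abbreviation "ecdf_gap n y \<omega> \<equiv>
  ecdf n (residual p n (\<lambda>t. Y t \<omega>)) y - ecdf n (\<lambda>t. Z t \<omega>) y"

text \<open>Here \<open>s\<close> is a fixed candidate for sqrt n times the estimation error, and
  \<tau> is a slack of either sign. The slack multiplies \<open>abs_lags\<close> to cover the
  rounding of that error and multiplies 1 to cover the rounding of the argument y.\<close>

definition residual_shift :: "nat \<Rightarrow> (nat \<Rightarrow> real) \<Rightarrow> real \<Rightarrow> int \<Rightarrow> 'a \<Rightarrow> real" where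
  "residual_shift n s \<tau> t \<omega> = ((\<Sum>j=1..p. s j * Y (t - int j) \<omega>) + \<tau> * (abs_lags t \<omega> + 1)) / sqrt (real n)"

lemma residual_shift_past: "residual_shift n s \<tau> t \<in> borel_measurable (past t)"
proof -
  have [measurable]: "Y (t - int j) \<in> borel_measurable (past t)" if "j \<in> {1..p}" for j
    using that by (intro ma_past) auto
  show ?thesis unfolding residual_shift_def by measurable
qed

lemma abs_residual_shift_le:
  assumes s: "\<And>j. j \<in> {1..p} \<Longrightarrow> \<bar>s j\<bar> \<le> b" and b: "b \<ge> 0"
  shows "\<bar>residual_shift n s \<tau> t \<omega>\<bar> \<le> (b + \<bar>\<tau>\<bar>) * (abs_lags t \<omega> + 1) / sqrt (real n)"
proof -
  let ?W = "abs_lags t \<omega>"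
  have W: "?W \<ge> 0" by (intro sum_nonneg) auto
  have "\<bar>\<Sum>j=1..p. s j * Y (t - int j) \<omega>\<bar> \<le> (\<Sum>j=1..p. b * \<bar>Y (t - int j) \<omega>\<bar>)"
    by (intro order_trans[OF sum_abs] sum_mono) (auto simp: abs_mult intro!: mult_right_mono s)
  also have "\<dots> = b * ?W" by (simp add: sum_distrib_left)
  also have "\<dots> \<le> b * (?W + 1)" using b by (intro mult_left_mono) auto
  finally have "\<bar>(\<Sum>j=1..p. s j * Y (t - int j) \<omega>) + \<tau> * (?W + 1)\<bar> \<le> b * (?W + 1) + \<bar>\<tau>\<bar> * (?W + 1)"
    using W abs_triangle_ineq[of "\<Sum>j=1..p. s j * Y (t - int j) \<omega>" "\<tau> * (?W + 1)"]
    by (simp add: abs_mult)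
  then show ?thesis unfolding residual_shift_def abs_divide
    by (simp add: divide_right_mono distrib_right)
qed

text \<open>The n shifts carry the factor n^(-1/2), whence sqrt n in both bounds. The signed sum
  profits from sample means at most \<kappa>; the absolute sum has only the bounded average
  \<open>B\<close>.\<close>

lemma sum_residual_shift_le:
  assumes s: "\<And>j. j \<in> {1..p} \<Longrightarrow> \<bar>s j\<bar> \<le> b" and b: "b \<ge> 0" and n: "n \<ge> 1"
    and \<kappa>: "\<And>j. j \<in> {1..p} \<Longrightarrow> \<bar>mean n (\<lambda>t. Y (t - int j) \<omega>)\<bar> \<le> \<kappa>"
    and B: "mean n (\<lambda>t. abs_lags t \<omega>) \<le> B"
  shows "\<bar>\<Sum>t = 1..int n. residual_shift n s \<tau> t \<omega>\<bar> \<le> sqrt (real n) * (real p * b * \<kappa> + \<bar>\<tau>\<bar> * (B + 1))"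
    and "(\<Sum>t = 1..int n. \<bar>residual_shift n s \<tau> t \<omega>\<bar>) \<le> sqrt (real n) * ((b + \<bar>\<tau>\<bar>) * (B + 1))"
proof -
  let ?W = "\<lambda>t. abs_lags t \<omega>"
  have mean1: "mean n (\<lambda>t. ?W t + 1) = mean n ?W + 1"
    unfolding mean_add using n by (simp add: mean_def)
  have m0: "mean n ?W + 1 \<ge> 0" using mean_nonneg[of ?W n] by (simp add: sum_nonneg)
  have sqrt_n: "sqrt (real n) * sqrt (real n) = real n" "sqrt (real n) > 0" using n by auto
  have sum_mean: "(\<Sum>t = 1..int n. g t / sqrt (real n)) = sqrt (real n) * mean n g" for g
    using sqrt_n by (simp add: mean_def sum_divide_distrib[symmetric] field_simps)
  have "(\<Sum>t = 1..int n. residual_shift n s \<tau> t \<omega>)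
      = sqrt (real n) * ((\<Sum>j=1..p. s j * mean n (\<lambda>t. Y (t - int j) \<omega>)) + \<tau> * (mean n ?W + 1))"
    unfolding residual_shift_def sum_mean mean_add mean_sum mean_cmult using mean1 by (simp add: mean_add mean_sum)
  also have "\<bar>\<dots>\<bar> \<le> sqrt (real n) * ((\<Sum>j=1..p. b * \<kappa>) + \<bar>\<tau>\<bar> * (B + 1))"
    unfolding abs_mult[of "sqrt (real n)"]
  proof (rule mult_mono)
    show "\<bar>(\<Sum>j=1..p. s j * mean n (\<lambda>t. Y (t - int j) \<omega>)) + \<tau> * (mean n ?W + 1)\<bar>
        \<le> (\<Sum>j=1..p. b * \<kappa>) + \<bar>\<tau>\<bar> * (B + 1)"
    proof (intro order_trans[OF abs_triangle_ineq] add_mono order_trans[OF sum_abs] sum_mono)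
      show "\<bar>s j * mean n (\<lambda>t. Y (t - int j) \<omega>)\<bar> \<le> b * \<kappa>" if "j \<in> {1..p}" for j
        unfolding abs_mult using s[OF that] \<kappa>[OF that] b by (intro mult_mono) auto
      show "\<bar>\<tau> * (mean n ?W + 1)\<bar> \<le> \<bar>\<tau>\<bar> * (B + 1)"
        unfolding abs_mult using m0 B by (intro mult_left_mono) auto
    qed
  qed (use n in auto)
  also have "(\<Sum>j=1..p. b * \<kappa>) = real p * b * \<kappa>" by simp
  finally show "\<bar>\<Sum>t = 1..int n. residual_shift n s \<tau> t \<omega>\<bar> \<le> sqrt (real n) * (real p * b * \<kappa> + \<bar>\<tau>\<bar> * (B + 1))" .
  have "(\<Sum>t = 1..int n. \<bar>residual_shift n s \<tau> t \<omega>\<bar>) \<le> (\<Sum>t = 1..int n. (b + \<bar>\<tau>\<bar>) * (?W t + 1) / sqrt (real n))"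
    by (intro sum_mono abs_residual_shift_le s b)
  also have "\<dots> = sqrt (real n) * ((b + \<bar>\<tau>\<bar>) * (mean n ?W + 1))"
    unfolding sum_mean mean_cmult mean1 ..
  also have "\<dots> \<le> sqrt (real n) * ((b + \<bar>\<tau>\<bar>) * (B + 1))"
    using B b by (intro mult_left_mono) auto
  finally show "(\<Sum>t = 1..int n. \<bar>residual_shift n s \<tau> t \<omega>\<bar>) \<le> sqrt (real n) * ((b + \<bar>\<tau>\<bar>) * (B + 1))" .
qed

text \<open>Monotonicity of indicators: the residual empirical distribution function is squeezed between
  versions with the estimation error and the argument replaced by grid values.\<close>
lemma ecdf_residual_sandwich:
  assumes n: "n \<ge> 1" and \<rho>: "\<rho> \<ge> 0"
    and ar: "\<And>t. Y t \<omega> = (\<Sum>j=1..p. \<phi> j * Y (t - int j) \<omega>) + Z t \<omega>"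
    and s: "\<And>j. j \<in> {1..p} \<Longrightarrow>
      \<bar>sqrt (real n) * yw_error n j \<omega> - s j\<bar> \<le> \<rho>"
    and y: "y\<^sub>0 \<le> y" "y \<le> y\<^sub>1" and y1: "y\<^sub>1 = y\<^sub>0 + \<rho> / sqrt (real n)"
  shows "real n * ecdf_gap n y \<omega>
      \<le> (\<Sum>t = 1..int n. increment t y\<^sub>0 (residual_shift n s \<rho> t \<omega>) \<omega>) + (\<Sum>t = 1..int n. F (y\<^sub>0 + residual_shift n s \<rho> t \<omega>) - F y\<^sub>0)"
    and "real n * ecdf_gap n y \<omega>
      \<ge> (\<Sum>t = 1..int n. increment t y\<^sub>1 (residual_shift n s (- \<rho>) t \<omega>) \<omega>) + (\<Sum>t = 1..int n. F (y\<^sub>1 + residual_shift n s (- \<rho>) t \<omega>) - F y\<^sub>1)"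
proof -
  let ?e = "residual p n (\<lambda>t. Y t \<omega>)" and ?W = "\<lambda>t. abs_lags t \<omega>"
  define \<delta> where "\<delta> j = yw_error n j \<omega>" for j
  have r: "sqrt (real n) > 0" using n by simp
  have e: "?e t = Z t \<omega> - (\<Sum>j=1..p. \<delta> j * Y (t - int j) \<omega>)" for t
    using ar[of t] by (simp add: residual_def \<delta>_def left_diff_distrib sum_subtractf)
  have close: "\<bar>sqrt (real n) * (\<Sum>j=1..p. \<delta> j * Y (t - int j) \<omega>) - (\<Sum>j=1..p. s j * Y (t - int j) \<omega>)\<bar> \<le> \<rho> * ?W t" for t
  proof -
    have "sqrt (real n) * (\<Sum>j=1..p. \<delta> j * Y (t - int j) \<omega>) - (\<Sum>j=1..p. s j * Y (t - int j) \<omega>)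
        = (\<Sum>j=1..p. (sqrt (real n) * \<delta> j - s j) * Y (t - int j) \<omega>)"
      by (simp add: left_diff_distrib sum_subtractf sum_distrib_left mult.assoc)
    also have "\<bar>\<dots>\<bar> \<le> (\<Sum>j=1..p. \<rho> * \<bar>Y (t - int j) \<omega>\<bar>)"
    proof (rule order_trans[OF sum_abs sum_mono])
      fix j assume "j \<in> {1..p}"
      then show "\<bar>(sqrt (real n) * \<delta> j - s j) * Y (t - int j) \<omega>\<bar> \<le> \<rho> * \<bar>Y (t - int j) \<omega>\<bar>"
        unfolding abs_mult \<delta>_def by (intro mult_right_mono s) auto
    qed
    finally show ?thesis by (simp add: sum_distrib_left)
  qed
  \<comment> \<open>The estimation grid uses up \<rho> times \<open>abs_lags\<close>; the remaining
    \<rho> / sqrt n of the shift covers the passage from y to the grid point below it.\<close>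
  have up: "y + (\<Sum>j=1..p. \<delta> j * Y (t - int j) \<omega>) \<le> y\<^sub>0 + residual_shift n s \<rho> t \<omega>" for t
  proof -
    have "(\<Sum>j=1..p. \<delta> j * Y (t - int j) \<omega>) \<le> ((\<Sum>j=1..p. s j * Y (t - int j) \<omega>) + \<rho> * ?W t) / sqrt (real n)"
      using close[of t] r by (simp add: pos_le_divide_eq mult.commute)
    moreover have "residual_shift n s \<rho> t \<omega> = ((\<Sum>j=1..p. s j * Y (t - int j) \<omega>) + \<rho> * ?W t) / sqrt (real n) + \<rho> / sqrt (real n)"
      by (simp add: residual_shift_def distrib_left add_divide_distrib)
    ultimately show ?thesis using y y1 by linarith
  qed
  have low: "y\<^sub>1 + residual_shift n s (- \<rho>) t \<omega> \<le> y + (\<Sum>j=1..p. \<delta> j * Y (t - int j) \<omega>)" for t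
  proof -
    have "((\<Sum>j=1..p. s j * Y (t - int j) \<omega>) - \<rho> * ?W t) / sqrt (real n) \<le> (\<Sum>j=1..p. \<delta> j * Y (t - int j) \<omega>)"
      using close[of t] r by (simp add: pos_divide_le_eq mult.commute)
    moreover have "residual_shift n s (- \<rho>) t \<omega> = ((\<Sum>j=1..p. s j * Y (t - int j) \<omega>) - \<rho> * ?W t) / sqrt (real n) - \<rho> / sqrt (real n)"
      by (simp add: residual_shift_def distrib_left add_divide_distrib diff_divide_distrib)
    ultimately show ?thesis using y y1 by linarith
  qed
  have ecdf_eq: "real n * (ecdf n ?e y - ecdf n (\<lambda>t. Z t \<omega>) y)
      = (\<Sum>t = 1..int n. indicator {?e t..} y - indicator {Z t \<omega>..} y)"
    using n by (simp add: ecdf_def diff_divide_distrib[symmetric] sum_subtractf)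
  show "real n * (ecdf n ?e y - ecdf n (\<lambda>t. Z t \<omega>) y)
      \<le> (\<Sum>t = 1..int n. increment t y\<^sub>0 (residual_shift n s \<rho> t \<omega>) \<omega>) + (\<Sum>t = 1..int n. F (y\<^sub>0 + residual_shift n s \<rho> t \<omega>) - F y\<^sub>0)"
    unfolding ecdf_eq sum.distrib[symmetric]
  proof (rule sum_mono)
    fix t
    have "(indicator {?e t..} y :: real) \<le> indicator {..y\<^sub>0 + residual_shift n s \<rho> t \<omega>} (Z t \<omega>)"
      using up[of t] e[of t] by (auto simp: indicator_def)
    moreover have "(indicator {..y\<^sub>0} (Z t \<omega>) :: real) \<le> indicator {Z t \<omega>..} y"
      using y by (auto simp: indicator_def)
    ultimately show "indicator {?e t..} y - indicator {Z t \<omega>..} y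
        \<le> increment t y\<^sub>0 (residual_shift n s \<rho> t \<omega>) \<omega> + (F (y\<^sub>0 + residual_shift n s \<rho> t \<omega>) - F y\<^sub>0)"
      unfolding increment_def by linarith
  qed
  show "real n * (ecdf n ?e y - ecdf n (\<lambda>t. Z t \<omega>) y)
      \<ge> (\<Sum>t = 1..int n. increment t y\<^sub>1 (residual_shift n s (- \<rho>) t \<omega>) \<omega>) + (\<Sum>t = 1..int n. F (y\<^sub>1 + residual_shift n s (- \<rho>) t \<omega>) - F y\<^sub>1)"
    unfolding ecdf_eq sum.distrib[symmetric]
  proof (rule sum_mono)
    fix t
    have "indicator {..y\<^sub>1 + residual_shift n s (- \<rho>) t \<omega>} (Z t \<omega>) \<le> (indicator {?e t..} y :: real)"
      using low[of t] e[of t] by (auto simp: indicator_def)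
    moreover have "indicator {Z t \<omega>..} y \<le> (indicator {..y\<^sub>1} (Z t \<omega>) :: real)"
      using y by (auto simp: indicator_def)
    ultimately show "increment t y\<^sub>1 (residual_shift n s (- \<rho>) t \<omega>) \<omega> + (F (y\<^sub>1 + residual_shift n s (- \<rho>) t \<omega>) - F y\<^sub>1)
        \<le> indicator {?e t..} y - indicator {Z t \<omega>..} y"
      unfolding increment_def by linarith
  qed
qed

text \<open>Clipping makes the conditional variances deterministically small, as the exponential inequality
  requires; by the fourth moment bound it has no effect with probability tending to 1.\<close>
definition clipped_shift :: "nat \<Rightarrow> (nat \<Rightarrow> real) \<Rightarrow> real \<Rightarrow> int \<Rightarrow> 'a \<Rightarrow> real" where
  "clipped_shift n s \<tau> t \<omega>
     = (if \<bar>residual_shift n s \<tau> t \<omega>\<bar> \<le> real n powr (- 1 / 8) then residual_shift n s \<tau> t \<omega> else 0)"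

lemma clipped_shift_past: "clipped_shift n s \<tau> t \<in> borel_measurable (past t)"
proof -
  note [measurable] = residual_shift_past
  show ?thesis unfolding clipped_shift_def by measurable
qed

text \<open>Everything is measured in units of sqrt n. Of the budget \<epsilon>, the martingale part
  takes at most \<epsilon>/4, and the compensator \<epsilon>/8 for the sample means, \<epsilon>/4
  for the slack and \<epsilon>/8 for the Hoelder remainder. The total 3\<epsilon>/4 contradicts a
  deviation above \<epsilon>.\<close>

lemma ecdf_residual_uniform:
  assumes der: "\<And>x. (F has_real_derivative g x) (at x)"
    and holder: "\<And>x y. \<bar>g x - g y\<bar> \<le> H * \<bar>x - y\<bar> powr \<beta>" and \<beta>: "\<beta> > 0"
    and a: "\<And>n. n \<ge> 1 \<Longrightarrow> a n > 0" "\<And>n. n \<ge> 1 \<Longrightarrow> a n \<le> C\<^sub>1 * real n powr C\<^sub>2"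
    and C: "C\<^sub>1 > 0" "C\<^sub>2 > 0"
    and \<epsilon>: "\<epsilon> > 0" and \<theta>: "\<theta> > 0"
  shows "small_event \<theta> (\<lambda>n \<omega>. \<exists>y. \<bar>y\<bar> \<le> a n + 1 \<and>
     \<bar>ecdf_gap n y \<omega>\<bar> > \<epsilon> / sqrt (real n))"
proof -
  define \<theta>' where "\<theta>' = \<theta> / 5"
  have \<theta>': "\<theta>' > 0" using \<theta> by (simp add: \<theta>'_def)
  obtain b where b: "b > 0" and ev_yw:
    "small_event \<theta>' (\<lambda>n \<omega>. \<exists>j\<in>{1..p}. \<bar>yw_error n j \<omega>\<bar> > b / sqrt (real n))"
    using small_event_yule_walker[OF \<theta>'] .
  obtain B where B: "B > 0" and ev_abs: "small_event \<theta>' (\<lambda>n \<omega>. mean n (\<lambda>t. abs_lags t \<omega>) > B)"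
    using small_event_mean_abs[OF \<theta>'] .
  \<comment> \<open>Leaves room for rounding an entry of size at most \<open>b\<close> by \<rho>,
    which is at most 1.\<close>
  define b' where "b' = b + 2"
  have b': "b' > 0" using b by (simp add: b'_def)
  \<comment> \<open>Chosen so that the slack costs the compensator at most \<epsilon>/4; it does not
    depend on n, which keeps the net for the estimation error a fixed finite set.\<close>
  define \<rho> where "\<rho> = min 1 (\<epsilon> / (4 * (L + 1) * (B + 1)))"
  have \<rho>: "\<rho> > 0" "\<rho> \<le> 1" using \<epsilon> L_nonneg B by (auto simp: \<rho>_def)
  have \<rho>_le: "L * (\<rho> * (B + 1)) \<le> \<epsilon> / 4"
  proof -
    have "L * (\<rho> * (B + 1)) \<le> (L + 1) * ((\<epsilon> / (4 * (L + 1) * (B + 1))) * (B + 1))"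
      using L_nonneg B \<rho> by (intro mult_mono) (auto simp: \<rho>_def)
    also have "\<dots> = \<epsilon> / 4"
    proof -
      have *: "x * ((e / (4 * x * y)) * y) = e / 4" if "x \<noteq> 0" "y \<noteq> 0" for x y e :: real
        using that by (simp add: field_simps)
      show ?thesis by (rule *) (use L_nonneg B in auto)
    qed
    finally show ?thesis .
  qed
  \<comment> \<open>The threshold for the sample means, chosen so that the linear term of the
    compensator stays below \<epsilon>/8.\<close>
  define \<kappa> where "\<kappa> = \<epsilon> / (8 * (L + 1) * real p * b')"
  have \<kappa>: "\<kappa> > 0" using \<epsilon> L_nonneg p b' by (simp add: \<kappa>_def)
  have \<kappa>_le: "L * (real p * b' * \<kappa>) \<le> \<epsilon> / 8"
  proof -
    have "L * (real p * b' * \<kappa>) \<le> (L + 1) * (real p * b' * \<kappa>)"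
      using b' \<kappa> by (intro mult_right_mono) auto
    also have "\<dots> = \<epsilon> / 8"
    proof -
      have *: "x * (y * w * (e / (8 * x * y * w))) = e / 8" if "x \<noteq> 0" "y \<noteq> 0" "w \<noteq> 0" for x y w e :: real
        using that by (simp add: field_simps)
      show ?thesis unfolding \<kappa>_def by (rule *) (use L_nonneg p b' in auto)
    qed
    finally show ?thesis .
  qed
  have ev_mean: "small_event \<theta>' (\<lambda>n \<omega>. \<exists>j\<in>{1..p}. \<bar>mean n (\<lambda>t. Y (t - int j) \<omega>)\<bar> > \<kappa>)"
    by (rule small_event_mean[OF \<theta>' \<kappa>])
  have ev_max: "small_event \<theta>' (\<lambda>n \<omega>. \<exists>t\<in>{1..int n}. (b' + 1) * (abs_lags t \<omega> + 1) > real n powr (3 / 8))"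
    using b' by (intro small_event_max[OF \<theta>']) simp
  \<comment> \<open>A finite net, independent of n, for the estimation error scaled by sqrt
    n.\<close>
  define S where "S = (\<Pi>\<^sub>E j\<in>{1..p}. (\<lambda>i. real_of_int i * \<rho>) ` {i. \<bar>real_of_int i * \<rho>\<bar> \<le> b'})"
  have fin_int: "finite {i. \<bar>real_of_int i * \<rho>\<bar> \<le> b'}"
  proof (rule finite_subset)
    show "{i. \<bar>real_of_int i * \<rho>\<bar> \<le> b'} \<subseteq> {- \<lceil>b' / \<rho>\<rceil>..\<lceil>b' / \<rho>\<rceil>}"
    proof
      fix i assume "i \<in> {i. \<bar>real_of_int i * \<rho>\<bar> \<le> b'}"
      then have "\<bar>real_of_int i\<bar> \<le> b' / \<rho>" using \<rho> by (simp add: abs_mult field_simps)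
      then have "\<bar>real_of_int i\<bar> \<le> real_of_int \<lceil>b' / \<rho>\<rceil>" by linarith
      then show "i \<in> {- \<lceil>b' / \<rho>\<rceil>..\<lceil>b' / \<rho>\<rceil>}" by auto
    qed
  qed simp
  then have fin_S: "finite S" unfolding S_def by (intro finite_PiE) auto
  have S_bound: "\<bar>s j\<bar> \<le> b'" if "s \<in> S" "j \<in> {1..p}" for s j
    using PiE_mem[OF that[unfolded S_def]] by auto
  have S_net: "\<exists>s\<in>S. \<forall>j\<in>{1..p}. \<bar>w j - s j\<bar> \<le> \<rho>" if w: "\<And>j. j \<in> {1..p} \<Longrightarrow> \<bar>w j\<bar> \<le> b" for w
  proof -
    define s where "s = (\<lambda>j\<in>{1..p}. real_of_int \<lfloor>w j / \<rho>\<rfloor> * \<rho>)"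
    have close: "\<bar>w j - real_of_int \<lfloor>w j / \<rho>\<rfloor> * \<rho>\<bar> \<le> \<rho>" for j
    proof -
      define k where "k = \<lfloor>w j / \<rho>\<rfloor>"
      have "real_of_int k \<le> w j / \<rho>" "w j / \<rho> \<le> real_of_int k + 1" unfolding k_def by linarith+
      then have "real_of_int k * \<rho> \<le> w j" "w j \<le> (real_of_int k + 1) * \<rho>"
        using \<rho> by (simp_all add: pos_le_divide_eq pos_divide_le_eq)
      then show ?thesis unfolding k_def[symmetric] by (simp add: distrib_right abs_le_iff)
    qed
    have "\<bar>real_of_int \<lfloor>w j / \<rho>\<rfloor> * \<rho>\<bar> \<le> b'" if "j \<in> {1..p}" for j
      using close[of j] w[OF that] \<rho> unfolding b'_def by linarith
    then have "s \<in> S" by (auto simp: S_def s_def)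
    moreover have "\<forall>j\<in>{1..p}. \<bar>w j - s j\<bar> \<le> \<rho>" using close by (simp add: s_def)
    ultimately show ?thesis by blast
  qed
  have S_ne: "S \<noteq> {}" using S_net[of "\<lambda>_. 0"] b by auto
  \<comment> \<open>The extra 1 ensures that for every admissible y the neighbouring grid point
    above it also belongs to the grid.\<close>
  define I where "I n = \<lceil>(a n + 2) * sqrt (real n) / \<rho>\<rceil> + 1" for n
  define G where "G n = (\<lambda>i. real_of_int i * (\<rho> / sqrt (real n))) ` {- I n..I n}" for n
  have fin_G: "finite (G n)" for n by (simp add: G_def)
  have card_G: "\<forall>\<^sub>F n in sequentially. real (card (G n)) \<le> (2 * (C\<^sub>1 + 2) / \<rho> + 5) * real n powr (C\<^sub>2 + 1 / 2)"
    using eventually_ge_at_top[of 1]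
  proof eventually_elim
    case (elim n)
    have q: "(a n + 2) * sqrt (real n) / \<rho> \<ge> 0" using a(1)[OF elim] \<rho> by simp
    then have I: "I n \<ge> 0" "real_of_int (I n) \<le> (a n + 2) * sqrt (real n) / \<rho> + 2"
      unfolding I_def by (linarith, linarith)
    have "real (card (G n)) \<le> real (card {- I n..I n})"
      unfolding G_def by (intro of_nat_mono card_image_le) simp
    also have "\<dots> = 2 * real_of_int (I n) + 1" using I by simp
    also have "\<dots> \<le> 2 * ((a n + 2) * sqrt (real n) / \<rho>) + 5" using I by simp
    also have "\<dots> \<le> 2 * ((C\<^sub>1 + 2) * real n powr (C\<^sub>2 + 1 / 2) / \<rho>) + 5 * real n powr (C\<^sub>2 + 1 / 2)"
    proof (intro add_mono mult_left_mono divide_right_mono)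
      have ge1: "real n powr e \<ge> 1" if "e \<ge> 0" for e using elim that by (intro ge_one_powr_ge_zero) auto
      have "a n + 2 \<le> C\<^sub>1 * real n powr C\<^sub>2 + 2 * real n powr C\<^sub>2"
        using a(2)[OF elim] ge1[of C\<^sub>2] C by simp
      then have "(a n + 2) * sqrt (real n) \<le> ((C\<^sub>1 + 2) * real n powr C\<^sub>2) * sqrt (real n)"
        by (intro mult_right_mono) (auto simp: distrib_right)
      also have "\<dots> = (C\<^sub>1 + 2) * real n powr (C\<^sub>2 + 1 / 2)"
        using elim by (simp add: powr_add powr_half_sqrt)
      finally show "(a n + 2) * sqrt (real n) \<le> (C\<^sub>1 + 2) * real n powr (C\<^sub>2 + 1 / 2)" .
      show "5 \<le> 5 * real n powr (C\<^sub>2 + 1 / 2)" using ge1[of "C\<^sub>2 + 1 / 2"] C by simp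
    qed (use \<rho> in auto)
    finally show ?case by (simp add: algebra_simps)
  qed
  have G_net: "\<exists>y\<^sub>0\<in>G n. y\<^sub>0 \<le> y \<and> y \<le> y\<^sub>0 + \<rho> / sqrt (real n) \<and> y\<^sub>0 + \<rho> / sqrt (real n) \<in> G n"
    if n: "n \<ge> 1" and y: "\<bar>y\<bar> \<le> a n + 1" for n y
  proof -
    define d where "d = \<rho> / sqrt (real n)"
    have d: "d > 0" "(a n + 2) * sqrt (real n) / \<rho> = (a n + 2) / d" using n \<rho> by (auto simp: d_def)
    define i where "i = \<lfloor>y / d\<rfloor>"
    have i: "real_of_int i \<le> y / d" "y / d \<le> real_of_int i + 1" unfolding i_def by linarith+
    have "\<bar>y / d\<bar> \<le> (a n + 2) / d" using y d by (simp add: abs_divide divide_right_mono)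
    then have i_range: "i \<in> {- I n..I n}" "i + 1 \<in> {- I n..I n}"
      using i unfolding I_def d(2) by (auto; linarith)+
    have "real_of_int i * d \<le> y" "y \<le> real_of_int i * d + d"
      using i d(1) by (simp_all add: pos_le_divide_eq pos_divide_le_eq distrib_right)
    moreover have "real_of_int i * d \<in> G n" using i_range(1) by (auto simp: G_def d_def)
    moreover have "real_of_int i * d + d \<in> G n"
    proof -
      have "real_of_int i * d + d = real_of_int (i + 1) * d" by (simp add: distrib_right)
      then show ?thesis using i_range(2) unfolding G_def d_def by blast
    qed
    ultimately show ?thesis unfolding d_def by blast
  qed
  \<comment> \<open>Both signs of the slack are needed: +\<rho> for the upper and -\<rho> for the
    lower side of the squeeze.\<close>
  define J where "J = S \<times> {\<rho>, - \<rho>}"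
  have J: "finite J" "J \<noteq> {}" using fin_S S_ne by (auto simp: J_def)
  have ev_grid: "small_event \<theta>' (\<lambda>n \<omega>. \<exists>x\<in>J. \<exists>y\<in>G n.
      \<bar>\<Sum>t = 1..int n. increment t y (clipped_shift n (fst x) (snd x) t \<omega>) \<omega>\<bar> \<ge> \<epsilon> / 4 * sqrt (real n))"
  proof (rule small_event_Bex_finite[OF J])
    fix x
    have "\<bar>clipped_shift n (fst x) (snd x) t \<omega>\<bar> \<le> real n powr (- 1 / 8)" for n t \<omega>
      by (simp add: clipped_shift_def)
    moreover have "\<theta>' / real (card J) > 0" using J \<theta>' by (simp add: card_gt_0_iff)
    ultimately show "small_event (\<theta>' / real (card J)) (\<lambda>n \<omega>. \<exists>y\<in>G n.
        \<bar>\<Sum>t = 1..int n. increment t y (clipped_shift n (fst x) (snd x) t \<omega>) \<omega>\<bar> \<ge> \<epsilon> / 4 * sqrt (real n))"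
      using \<epsilon> by (intro small_event_increment_grid[OF clipped_shift_past _ fin_G card_G]) auto
  qed
  let ?bad = "\<lambda>n \<omega>. (\<exists>j\<in>{1..p}. \<bar>yw_error n j \<omega>\<bar> > b / sqrt (real n))
    \<or> mean n (\<lambda>t. abs_lags t \<omega>) > B
    \<or> (\<exists>j\<in>{1..p}. \<bar>mean n (\<lambda>t. Y (t - int j) \<omega>)\<bar> > \<kappa>)
    \<or> (\<exists>t\<in>{1..int n}. (b' + 1) * (abs_lags t \<omega> + 1) > real n powr (3 / 8))
    \<or> (\<exists>x\<in>J. \<exists>y\<in>G n. \<bar>\<Sum>t = 1..int n. increment t y (clipped_shift n (fst x) (snd x) t \<omega>) \<omega>\<bar> \<ge> \<epsilon> / 4 * sqrt (real n))"
  have "small_event (\<theta>' + (\<theta>' + (\<theta>' + (\<theta>' + \<theta>')))) ?bad"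
    using ev_yw ev_abs ev_mean ev_max ev_grid by (intro small_event_disj)
  moreover have "\<theta>' + (\<theta>' + (\<theta>' + (\<theta>' + \<theta>'))) = \<theta>" by (simp add: \<theta>'_def)
  ultimately have bad: "small_event \<theta> ?bad" by (simp only:)
  have H_lim: "\<forall>\<^sub>F n in sequentially. H * (real n powr (- 1 / 8)) powr \<beta> * ((b' + 1) * (B + 1)) \<le> \<epsilon> / 8"
  proof -
    have "(\<lambda>n. real n powr (- (\<beta> / 8))) \<longlonglongrightarrow> 0"
      by (rule tendsto_neg_powr[OF _ filterlim_real_sequentially]) (use \<beta> in simp)
    then have "(\<lambda>n. (real n powr (- 1 / 8)) powr \<beta>) \<longlonglongrightarrow> 0"
      by (simp add: powr_powr)
    then have "(\<lambda>n. H * (real n powr (- 1 / 8)) powr \<beta> * ((b' + 1) * (B + 1))) \<longlonglongrightarrow> H * 0 * ((b' + 1) * (B + 1))"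
      by (intro tendsto_intros)
    then have "\<forall>\<^sub>F n in sequentially. H * (real n powr (- 1 / 8)) powr \<beta> * ((b' + 1) * (B + 1)) < \<epsilon> / 8"
      using \<epsilon> by (intro order_tendstoD(2)) auto
    then show ?thesis by (rule eventually_mono) simp
  qed
  let ?Q = "\<lambda>n \<omega>. \<exists>y. \<bar>y\<bar> \<le> a n + 1 \<and>
     \<bar>ecdf_gap n y \<omega>\<bar> > \<epsilon> / sqrt (real n)"
  show ?thesis
    using bad
  proof (rule small_event_mono)
    show "\<forall>\<^sub>F n in sequentially. AE \<omega> in M. ?Q n \<omega> \<longrightarrow> ?bad n \<omega>"
      using eventually_ge_at_top[of 1] H_lim
    proof eventually_elim
      fix n :: nat assume n: "1 \<le> n"
        and H_le: "H * (real n powr (- 1 / 8)) powr \<beta> * ((b' + 1) * (B + 1)) \<le> \<epsilon> / 8"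
      have r: "sqrt (real n) > 0" "sqrt (real n) * sqrt (real n) = real n" using n by auto
      show "AE \<omega> in M. ?Q n \<omega> \<longrightarrow> ?bad n \<omega>"
        using ar
      proof eventually_elim
        fix \<omega> assume ar: "\<forall>t. Y t \<omega> = (\<Sum>j=1..p. \<phi> j * Y (t - int j) \<omega>) + Z t \<omega>"
        show "?Q n \<omega> \<longrightarrow> ?bad n \<omega>"
        proof (rule impI, rule ccontr)
          assume ex: "?Q n \<omega>"
            and good: "\<not> ?bad n \<omega>"
          from ex obtain y where y: "\<bar>y\<bar> \<le> a n + 1"
            "\<bar>ecdf_gap n y \<omega>\<bar> > \<epsilon> / sqrt (real n)" by blast
          let ?\<Delta> = "ecdf_gap n y \<omega>"
          from good have g1: "\<bar>yw_error n j \<omega>\<bar> \<le> b / sqrt (real n)"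
            if "j \<in> {1..p}" for j using that by (meson not_le)
          from good have g2: "mean n (\<lambda>t. abs_lags t \<omega>) \<le> B" by (meson not_le)
          from good have g3: "\<bar>mean n (\<lambda>t. Y (t - int j) \<omega>)\<bar> \<le> \<kappa>" if "j \<in> {1..p}" for j
            using that by (meson not_le)
          from good have g4: "(b' + 1) * (abs_lags t \<omega> + 1) \<le> real n powr (3 / 8)"
            if "t \<in> {1..int n}" for t using that by (meson not_le)
          from good have g5: "\<bar>\<Sum>t = 1..int n. increment t y (clipped_shift n (fst x) (snd x) t \<omega>) \<omega>\<bar> \<le> \<epsilon> / 4 * sqrt (real n)"
            if "x \<in> J" "y \<in> G n" for x y using that by (meson not_le less_imp_le)
          have "\<bar>sqrt (real n) * yw_error n j \<omega>\<bar> \<le> b" if "j \<in> {1..p}" for j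
            using g1[OF that] r(1) by (simp add: abs_mult pos_le_divide_eq mult.commute)
          from S_net[of "\<lambda>j. sqrt (real n) * yw_error n j \<omega>", OF this]
          obtain s where s: "s \<in> S" "\<And>j. j \<in> {1..p} \<Longrightarrow>
              \<bar>sqrt (real n) * yw_error n j \<omega> - s j\<bar> \<le> \<rho>"
            by blast
          obtain y0 where y0: "y0 \<in> G n" "y0 \<le> y" "y \<le> y0 + \<rho> / sqrt (real n)" "y0 + \<rho> / sqrt (real n) \<in> G n"
            using G_net[OF n y(1)] by blast
          note sandwich = ecdf_residual_sandwich[OF n less_imp_le[OF \<rho>(1)] ar[rule_format] s(2) y0(2,3) refl]
          have bound: "\<bar>(\<Sum>t = 1..int n. increment t z (residual_shift n s \<tau> t \<omega>) \<omega>) + (\<Sum>t = 1..int n. F (z + residual_shift n s \<tau> t \<omega>) - F z)\<bar>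
              \<le> \<epsilon> * (3 / 4) * sqrt (real n)" if z: "z \<in> G n" and \<tau>: "\<tau> \<in> {\<rho>, - \<rho>}" for z \<tau>
          proof -
            have abs_\<tau>: "\<bar>\<tau>\<bar> = \<rho>" using \<tau> \<rho> by auto
            have sb: "\<bar>s j\<bar> \<le> b'" if "j \<in> {1..p}" for j using S_bound[OF s(1) that] .
            \<comment> \<open>Since 3/8 - 1/2 = -1/8, the clipping is inactive on the good event and
              the grid bound for clipped shifts transfers.\<close>
            have small: "\<bar>residual_shift n s \<tau> t \<omega>\<bar> \<le> real n powr (- 1 / 8)" if t: "t \<in> {1..int n}" for t
            proof -
              have "\<bar>residual_shift n s \<tau> t \<omega>\<bar> \<le> (b' + \<rho>) * (abs_lags t \<omega> + 1) / sqrt (real n)"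
                using abs_residual_shift_le[of s b' n \<tau> t \<omega>] sb b' abs_\<tau> by simp
              also have "\<dots> \<le> (b' + 1) * (abs_lags t \<omega> + 1) / sqrt (real n)"
                using \<rho> by (intro divide_right_mono mult_right_mono add_nonneg_nonneg sum_nonneg) auto
              also have "\<dots> \<le> real n powr (3 / 8) / sqrt (real n)"
                by (intro divide_right_mono g4 t) simp
              also have "\<dots> = real n powr (3 / 8 - 1 / 2)"
                unfolding powr_diff using n by (simp add: powr_half_sqrt)
              finally show ?thesis by simp
            qed
            then have clip: "clipped_shift n s \<tau> t \<omega> = residual_shift n s \<tau> t \<omega>" if "t \<in> {1..int n}" for t
              using that by (simp add: clipped_shift_def)
            have "(s, \<tau>) \<in> J" using s(1) \<tau> by (auto simp: J_def)
            from g5[OF this z] have "\<bar>\<Sum>t = 1..int n. increment t z (clipped_shift n s \<tau> t \<omega>) \<omega>\<bar> \<le> \<epsilon> / 4 * sqrt (real n)"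
              by simp
            also have "(\<Sum>t = 1..int n. increment t z (clipped_shift n s \<tau> t \<omega>) \<omega>) = (\<Sum>t = 1..int n. increment t z (residual_shift n s \<tau> t \<omega>) \<omega>)"
              by (intro sum.cong) (simp_all add: clip)
            finally have inc: "\<bar>\<Sum>t = 1..int n. increment t z (residual_shift n s \<tau> t \<omega>) \<omega>\<bar> \<le> \<epsilon> / 4 * sqrt (real n)" .
            have H0: "H \<ge> 0" using holder[of 1 0] by simp
            have "\<bar>\<Sum>t = 1..int n. F (z + residual_shift n s \<tau> t \<omega>) - F z\<bar>
                \<le> L * \<bar>\<Sum>t = 1..int n. residual_shift n s \<tau> t \<omega>\<bar>
                  + H * (real n powr (- 1 / 8)) powr \<beta> * (\<Sum>t = 1..int n. \<bar>residual_shift n s \<tau> t \<omega>\<bar>)"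
              by (intro compensator_sum_le[OF der holder \<beta>] small) auto
            also have "\<dots> \<le> L * (sqrt (real n) * (real p * b' * \<kappa> + \<rho> * (B + 1)))
                  + H * (real n powr (- 1 / 8)) powr \<beta> * (sqrt (real n) * ((b' + \<rho>) * (B + 1)))"
              using sum_residual_shift_le[of s b' n \<omega> \<kappa> B \<tau>, OF sb less_imp_le[OF b'] n g3 g2] L_nonneg H0
              unfolding abs_\<tau> by (intro add_mono mult_left_mono) auto
            also have "\<dots> \<le> L * (sqrt (real n) * (real p * b' * \<kappa> + \<rho> * (B + 1)))
                  + H * (real n powr (- 1 / 8)) powr \<beta> * (sqrt (real n) * ((b' + 1) * (B + 1)))"
              using \<rho> B H0 by (intro add_left_mono mult_left_mono mult_right_mono) auto
            also have "\<dots> = sqrt (real n) * (L * (real p * b' * \<kappa>) + L * (\<rho> * (B + 1))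
                  + H * (real n powr (- 1 / 8)) powr \<beta> * ((b' + 1) * (B + 1)))"
              by (simp add: algebra_simps)
            also have "\<dots> \<le> sqrt (real n) * (\<epsilon> / 8 + \<epsilon> / 4 + \<epsilon> / 8)"
              using \<kappa>_le \<rho>_le H_le by (intro mult_left_mono add_mono) auto
            finally have comp: "\<bar>\<Sum>t = 1..int n. F (z + residual_shift n s \<tau> t \<omega>) - F z\<bar> \<le> \<epsilon> / 2 * sqrt (real n)"
              by (simp add: mult.commute)
            show ?thesis
              using order_trans[OF abs_triangle_ineq add_mono[OF inc comp]] by (simp add: field_simps)
          qed
          have "real n * ?\<Delta> \<le> \<epsilon> * (3 / 4) * sqrt (real n)"
          proof -
            have "\<rho> \<in> {\<rho>, - \<rho>}" by blast
            from abs_le_D1[OF bound[OF y0(1) this]] sandwich(1) show ?thesis by linarith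
          qed
          moreover have "real n * ?\<Delta> \<ge> - (\<epsilon> * (3 / 4) * sqrt (real n))"
          proof -
            have "- \<rho> \<in> {\<rho>, - \<rho>}" by blast
            from abs_le_D2[OF bound[OF y0(4) this]] sandwich(2) show ?thesis by linarith
          qed
          ultimately have le: "real n * \<bar>?\<Delta>\<bar> \<le> \<epsilon> * (3 / 4) * sqrt (real n)"
            by (auto simp: abs_if algebra_simps)
          have "\<epsilon> * sqrt (real n) = real n * (\<epsilon> / sqrt (real n))"
            using r by (simp add: field_simps)
          also have "\<dots> < real n * \<bar>?\<Delta>\<bar>"
            using y(2) n by (intro mult_strict_left_mono) auto
          also note le
          finally have "\<epsilon> * sqrt (real n) < \<epsilon> * (3 / 4) * sqrt (real n)" .
          then show False using \<epsilon> r(1) by simp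
        qed
      qed
    qed
  qed
qed

end

section \<open>The kernel estimators\<close>

lemma holder_classD:
  assumes "F \<in> holder_class 1 \<beta>"
  obtains H where "\<And>x. (F has_real_derivative deriv F x) (at x)"
    and "\<And>x y. \<bar>deriv F x - deriv F y\<bar> \<le> H * \<bar>x - y\<bar> powr \<beta>"
proof -
  have "F differentiable at x" for x using assms by (force simp: holder_class_def)
  then have der: "(F has_real_derivative deriv F x) (at x)" for x
    using DERIV_deriv_iff_real_differentiable by blast
  from assms have "bdd_above {\<bar>deriv F x - deriv F y\<bar> / \<bar>x - y\<bar> powr \<beta> | x y. x \<noteq> y}"
    by (simp add: holder_class_def)
  then obtain H where H: "\<And>x y. x \<noteq> y \<Longrightarrow> \<bar>deriv F x - deriv F y\<bar> / \<bar>x - y\<bar> powr \<beta> \<le> H"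
    unfolding bdd_above_def by blast
  have "\<bar>deriv F x - deriv F y\<bar> \<le> H * \<bar>x - y\<bar> powr \<beta>" for x y
  proof (cases "x = y")
    case False
    then show ?thesis using H[of x y] by (simp add: divide_le_eq)
  qed simp
  with der show thesis by (rule that)
qed

lemma (in prob_space) cdf_lipschitz:
  assumes X: "distributed M lborel X (\<lambda>z. ennreal (f z))"
    and C: "\<And>z. 0 < f z \<and> f z \<le> C"
  shows "\<bar>cdf (distr M borel X) x - cdf (distr M borel X) y\<bar> \<le> C * \<bar>x - y\<bar>"
proof -
  have X_meas[measurable]: "X \<in> borel_measurable M" using distributed_measurable[OF X] by simp
  interpret D: real_distribution "distr M borel X" by (rule real_distribution_distr) simp
  have *: "\<bar>cdf (distr M borel X) x - cdf (distr M borel X) y\<bar> \<le> C * (x - y)" if "y \<le> x" for x y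
  proof -
    have "cdf (distr M borel X) x - cdf (distr M borel X) y = measure (distr M borel X) {y<..x}"
    proof (cases "y = x")
      case False
      then show ?thesis using that by (intro D.cdf_diff_eq) simp
    qed simp
    also have "\<dots> = prob (X -` {y<..x} \<inter> space M)" by (subst measure_distr) auto
    also have "\<dots> \<le> C * (x - y)"
    proof -
      have "emeasure M (X -` {y<..x} \<inter> space M) = (\<integral>\<^sup>+z. ennreal (f z) * indicator {y<..x} z \<partial>lborel)"
        by (rule distributed_emeasure[OF X]) simp
      also have "\<dots> \<le> (\<integral>\<^sup>+z. ennreal C * indicator {y<..x} z \<partial>lborel)"
        using C by (intro nn_integral_mono mult_right_mono ennreal_leI) auto
      also have "\<dots> = ennreal C * emeasure lborel {y<..x}" by (rule nn_integral_cmult_indicator) simp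
      also have "\<dots> = ennreal (C * (x - y))" using that C[of 0] by (simp add: ennreal_mult')
      finally show ?thesis using that C[of 0] by (simp add: emeasure_eq_measure)
    qed
    finally have "cdf (distr M borel X) x - cdf (distr M borel X) y \<le> C * (x - y)" .
    moreover have "cdf (distr M borel X) y \<le> cdf (distr M borel X) x" using that by (rule D.cdf_nondecreasing)
    ultimately show ?thesis by simp
  qed
  show ?thesis using *[of x y] *[of y x] by (cases "y \<le> x") (auto simp: abs_minus_commute)
qed

text \<open>A vanishing second moment would put all mass at 0, a Lebesgue null set. This supplies
  the positive innovation variance that bounds the Gram matrix from below.\<close>

lemma (in prob_space) second_moment_pos:
  fixes X :: "'a \<Rightarrow> real"
  assumes X: "distributed M lborel X (\<lambda>z. ennreal (f z))" and "integrable M (\<lambda>\<omega>. (X \<omega>)\<^sup>2)"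
  shows "expectation (\<lambda>\<omega>. (X \<omega>)\<^sup>2) > 0"
proof (rule ccontr)
  have [measurable]: "X \<in> borel_measurable M" using distributed_measurable[OF X] by simp
  have [measurable]: "(\<lambda>z. ennreal (f z)) \<in> borel_measurable lborel" using X by (simp add: distributed_def)
  assume "\<not> ?thesis"
  moreover have "expectation (\<lambda>\<omega>. (X \<omega>)\<^sup>2) \<ge> 0" by (rule Bochner_Integration.integral_nonneg) simp
  ultimately have "expectation (\<lambda>\<omega>. (X \<omega>)\<^sup>2) = 0" by simp
  then have "AE \<omega> in M. (X \<omega>)\<^sup>2 = 0"
    using assms(2) by (subst (asm) integral_nonneg_eq_0_iff_AE) auto
  then have "AE \<omega> in M. \<omega> \<in> X -` {0} \<inter> space M" using AE_space by eventually_elim auto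
  then have "prob (X -` {0} \<inter> space M) = 1" by (intro prob_eq_1[THEN iffD2]) auto
  moreover have "emeasure M (X -` {0} \<inter> space M) = (\<integral>\<^sup>+z. ennreal (f z) * indicator {0} z \<partial>lborel)"
    by (rule distributed_emeasure[OF X]) simp
  moreover have "(\<integral>\<^sup>+z. ennreal (f z) * indicator {0} z \<partial>lborel) = 0"
    using AE_lborel_singleton[of 0] by (subst nn_integral_0_iff_AE) (auto elim!: eventually_mono)
  ultimately show False by (simp add: emeasure_eq_measure)
qed

lemma power4_le_1_powr:
  fixes x :: real
  assumes "q \<ge> 4"
  shows "x ^ 4 \<le> 1 + \<bar>x\<bar> powr q"
proof (cases "\<bar>x\<bar> \<le> 1")
  case True
  then have "\<bar>x\<bar> ^ 4 \<le> 1" by (intro power_le_one) auto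
  then have "x ^ 4 \<le> 1" by simp
  moreover have "0 \<le> \<bar>x\<bar> powr q" by (rule powr_ge_zero)
  ultimately show ?thesis by linarith
next
  case False
  then have "\<bar>x\<bar> powr 4 \<le> \<bar>x\<bar> powr q" using assms by (intro powr_mono) auto
  moreover have "\<bar>x\<bar> powr 4 = x ^ 4" using False by (simp add: powr_numeral power_even_abs)
  ultimately show ?thesis by simp
qed

lemma bandwidth_tendsto_0:
  assumes "seq_ll h (\<lambda>n. real n powr (- 1 / (2 * (1 + \<beta>))))" "\<beta> > 0"
  shows "h \<longlonglongrightarrow> 0"
proof -
  let ?r = "\<lambda>n. real n powr (- 1 / (2 * (1 + \<beta>)))"
  have "(\<lambda>n. h n / ?r n * ?r n) \<longlonglongrightarrow> 0"
  proof (rule tendsto_mult_zero)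
    show "(\<lambda>n. h n / ?r n) \<longlonglongrightarrow> 0" using assms(1) by (simp add: seq_ll_def)
    show "?r \<longlonglongrightarrow> 0"
      using assms(2) by (intro tendsto_neg_powr filterlim_real_sequentially) (simp add: field_simps)
  qed
  then show ?thesis
    by (rule Lim_transform_eventually) (use eventually_ge_at_top[of 1] in eventually_elim, simp)
qed

theorem theorem1:
  fixes M :: "'a measure"
    and X Z :: "int \<Rightarrow> 'a \<Rightarrow> real"
    and p :: nat
    and \<phi> :: "nat \<Rightarrow> real"
    and f F K :: "real \<Rightarrow> real"
    and h a :: "nat \<Rightarrow> real"
    and \<beta> \<sigma> \<eta> C\<^sub>f C\<^sub>1 C\<^sub>2 :: real
  assumes "prob_space M"
    and "p \<ge> 1"
    and "1 / 3 < \<beta>" and "\<beta> \<le> 1"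
    and "ar_equation M p \<phi> X Z"
    and "prob_space.indep_vars M (\<lambda>_. borel) Z UNIV"
    and "\<And>t. distributed M lborel (Z t) (\<lambda>z. ennreal (f z))"
    and "\<And>t. F = cdf (distr M borel (Z t))"
    and "\<And>t. integral\<^sup>L M (Z t) = 0"
    and "\<And>t. integral\<^sup>L M (\<lambda>\<omega>. (Z t \<omega>)\<^sup>2) = \<sigma>\<^sup>2"
    and "F \<in> holder_class 1 \<beta>"
    and "C\<^sub>f > 0" and "\<And>z. 0 < f z \<and> f z \<le> C\<^sub>f"
    and "strictly_stationary M X"
    and "causal_ar p \<phi>"
    and "sym_kernel K" and "K \<in> cont_diff_class 2"
    and "\<And>n. n \<ge> 1 \<Longrightarrow> h n > 0"
    and "seq_ll (\<lambda>n. real n powr (- 3 / 8)) h"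
    and "seq_ll h (\<lambda>n. real n powr (- 1 / (2 * (1 + \<beta>))))"
    and "\<eta> > 6 / 5"
    and "\<And>t. integrable M (\<lambda>\<omega>. \<bar>Z t \<omega>\<bar> powr (6 + 3 * \<eta>))"
    and "\<And>n. n \<ge> 1 \<Longrightarrow> a n > 0"
    and "filterlim a at_top sequentially"
    and "C\<^sub>1 > 0" and "C\<^sub>2 > 0"
    and "\<And>n. n \<ge> 1 \<Longrightarrow> a n \<le> C\<^sub>1 * real n powr C\<^sub>2"
  shows "small_o_prob M
           (\<lambda>n \<omega>. SUP z\<in>{- a n..a n}. \<bar>F_hat K (h n) p n X \<omega> z - F_tilde K (h n) n Z \<omega> z\<bar>)
           (\<lambda>n. real n powr (- 1 / 2))"
proof -
  note K = \<open>sym_kernel K\<close> and h_pos = assms(18) and Z_distr = assms(7) and a_pos = assms(23)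
  interpret prob_space M by fact
  have Zm [measurable]: "Z t \<in> borel_measurable M" for t
    using distributed_measurable[OF Z_distr, of t] by simp
  have Xm [measurable]: "X t \<in> borel_measurable M" for t
    using assms(14) by (simp add: strictly_stationary_def)
  have Z4: "integrable M (\<lambda>\<omega>. Z t \<omega> ^ 4)" for t
  proof (rule Bochner_Integration.integrable_bound)
    show "integrable M (\<lambda>\<omega>. 1 + \<bar>Z t \<omega>\<bar> powr (6 + 3 * \<eta>))" using assms(22)[of t] by simp
    show "AE \<omega> in M. norm (Z t \<omega> ^ 4) \<le> norm (1 + \<bar>Z t \<omega>\<bar> powr (6 + 3 * \<eta>))"
    proof (rule AE_I2)
      fix \<omega>
      have "Z t \<omega> ^ 4 \<le> 1 + \<bar>Z t \<omega>\<bar> powr (6 + 3 * \<eta>)"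
        using assms(21) by (intro power4_le_1_powr) simp
      then show "norm (Z t \<omega> ^ 4) \<le> norm (1 + \<bar>Z t \<omega>\<bar> powr (6 + 3 * \<eta>))"
        by (simp add: zero_le_power_eq)
    qed
  qed simp
  have Z2: "integrable M (\<lambda>\<omega>. (Z t \<omega>)\<^sup>2)" for t
    using Z4[of t] by (intro square_integrable_imp_integrable[of "\<lambda>\<omega>. (Z t \<omega>)\<^sup>2"]) auto
  have Z_law: "distr M borel (Z t) = distr M borel (Z 0)" for t
  proof -
    have "distr M borel (Z t) = distr M lborel (Z t)" for t by (rule distr_cong) auto
    then show ?thesis using Z_distr by (simp add: distributed_def)
  qed
  have Z4_eq: "expectation (\<lambda>\<omega>. Z t \<omega> ^ 4) = expectation (\<lambda>\<omega>. Z 0 \<omega> ^ 4)" for t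
  proof -
    have "expectation (\<lambda>\<omega>. Z t \<omega> ^ 4) = (\<integral>z. z ^ 4 \<partial>distr M borel (Z t))" by (subst integral_distr) auto
    also have "\<dots> = expectation (\<lambda>\<omega>. Z 0 \<omega> ^ 4)" unfolding Z_law[of t] by (subst integral_distr) auto
    finally show ?thesis .
  qed
  interpret iid_noise M Z F C\<^sub>f "expectation (\<lambda>\<omega>. Z 0 \<omega> ^ 4)" "\<sigma>\<^sup>2"
  proof
    show "prob {\<omega> \<in> space M. Z t \<omega> \<le> y} = F y" for t y
      unfolding assms(8)[of t] cdf_def by (subst measure_distr) (auto intro!: arg_cong[where f = prob])
    show "\<bar>F x - F y\<bar> \<le> C\<^sub>f * \<bar>x - y\<bar>" for x y
      unfolding assms(8)[of 0] by (rule cdf_lipschitz[OF Z_distr assms(13)])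
  qed (fact assms(6) assms(9) assms(10) Z4 Z4_eq)+
  obtain \<psi> where \<psi>: "summable (\<lambda>j. \<bar>\<psi> j\<bar>)"
    and conv: "\<And>m. (\<Sum>j\<le>m. \<psi> j * ar_coeff p \<phi> (m - j)) = (if m = 0 then 1 else 0)"
    using causal_ar_inverse_summable[OF assms(15)] by blast
  have AR: "AE \<omega> in M. \<forall>t. X t \<omega> = (\<Sum>j=1..p. \<phi> j * X (t - int j) \<omega>) + Z t \<omega>"
    using assms(5) by (simp add: ar_equation_def AE_all_countable)
  \<comment> \<open>One-dimensional laws are read off from stationarity for the index set {0} with
    shift \<open>t\<close>.\<close>
  have X_law: "distr M borel (X t) = distr M borel (X 0)" for t
  proof -
    let ?J = "\<lambda>s \<omega>. \<lambda>u\<in>{0::int}. X (u + s) \<omega>" and ?P = "\<Pi>\<^sub>M u\<in>{0::int}. (borel :: real measure)"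
    have J: "?J s \<in> measurable M ?P" for s by (intro measurable_restrict) simp
    have eq: "distr (distr M ?P (?J s)) borel (\<lambda>g. g 0) = distr M borel (X s)" for s
      by (subst distr_distr[OF measurable_component_singleton J]) (auto simp: comp_def intro!: distr_cong)
    have "distr M ?P (?J t) = distr M ?P (\<lambda>\<omega>. \<lambda>u\<in>{0::int}. X u \<omega>)"
      using assms(14) by (simp add: strictly_stationary_def)
    then have "distr M ?P (?J t) = distr M ?P (?J 0)" by simp
    then show ?thesis using eq[of t] eq[of 0] by simp
  qed
  have X_ma: "AE \<omega> in M. \<forall>t. X t \<omega> = ma \<psi> t \<omega>"
    unfolding AE_all_countable
    using stationary_ar_eq_ma[OF \<psi> conv Xm X_law AR] by blast
  interpret ar_noise M Z F C\<^sub>f "expectation (\<lambda>\<omega>. Z 0 \<omega> ^ 4)" "\<sigma>\<^sup>2" p \<phi> \<psi>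
  proof
    show "\<sigma>\<^sup>2 > 0" using second_moment_pos[OF Z_distr Z2, of 0] assms(10)[of 0] by simp
    show "AE \<omega> in M. \<forall>t. ma \<psi> t \<omega> = (\<Sum>j=1..p. \<phi> j * ma \<psi> (t - int j) \<omega>) + Z t \<omega>"
      using AR X_ma
    proof eventually_elim
      case (elim \<omega>)
      from elim(1) show ?case unfolding elim(2)[rule_format] .
    qed
  qed (fact assms(2) \<psi>)+
  obtain H where der: "\<And>x. (F has_real_derivative deriv F x) (at x)"
    and holder: "\<And>x y. \<bar>deriv F x - deriv F y\<bar> \<le> H * \<bar>x - y\<bar> powr \<beta>"
    using holder_classD[OF assms(11)] by blast
  define \<Delta> where "\<Delta> n \<omega> z = \<bar>F_hat K (h n) p n X \<omega> z - F_tilde K (h n) n Z \<omega> z\<bar>" for n \<omega> z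
  define S where "S n \<omega> = (SUP z\<in>{- a n..a n}. \<Delta> n \<omega> z)" for n \<omega>
  have meas: "S n \<in> borel_measurable M" for n
  proof (cases "n = 0")
    \<comment> \<open>The bandwidth is positive only from n = 1 on; for n = 0 both estimators are
      quotients by zero, hence 0, and the supremum is constant in \<omega>.\<close>
    case True
    then show ?thesis by (simp add: S_def[abs_def] \<Delta>_def F_hat_def F_tilde_def kernel_cdf_est_def)
  next
    case False
    then have hn: "h n > 0" by (intro h_pos) simp
    show ?thesis
      unfolding S_def[abs_def]
    proof (rule borel_measurable_cSUP_interval)
      have res: "(\<lambda>\<omega>. residual p n (\<lambda>t. X t \<omega>) t) \<in> borel_measurable M" for t
        unfolding residual_def
        by (intro borel_measurable_diff borel_measurable_sum borel_measurable_times borel_measurable_yule_walker Xm) auto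
      show "(\<lambda>\<omega>. \<Delta> n \<omega> z) \<in> borel_measurable M" for z
        unfolding \<Delta>_def F_hat_def F_tilde_def
        by (intro borel_measurable_abs borel_measurable_diff borel_measurable_kernel_cdf_est[OF K hn] res Zm)
      show "continuous_on UNIV (\<Delta> n \<omega>)" for \<omega>
        unfolding \<Delta>_def F_hat_def F_tilde_def
        by (intro continuous_on_rabs continuous_on_diff continuous_kernel_cdf_est[OF K hn])
      show "\<Delta> n \<omega> z \<le> 1" for \<omega> z
        unfolding \<Delta>_def F_hat_def F_tilde_def by (rule kernel_cdf_est_diff_le_1[OF K hn])
    qed
  qed
  have lim: "(\<lambda>n. prob {\<omega> \<in> space M. \<bar>S n \<omega>\<bar> > \<epsilon> * real n powr (- 1 / 2)}) \<longlonglongrightarrow> 0"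
    if \<epsilon>: "\<epsilon> > 0" for \<epsilon>
  proof (rule LIMSEQ_I)
    fix \<theta> :: real assume "\<theta> > 0"
    let ?Q = "\<lambda>n \<omega>. \<exists>y. \<bar>y\<bar> \<le> a n + 1 \<and>
        \<bar>ecdf_gap n y \<omega>\<bar> > \<epsilon> / sqrt (real n)"
    \<comment> \<open>The half turns the weak bound on the probability into the strict one that
      convergence asks for.\<close>
    from \<open>\<theta> > 0\<close> have "small_event (\<theta> / 2) ?Q"
      using assms(3,23,25,26,27) \<epsilon> by (intro ecdf_residual_uniform[OF der holder, where C\<^sub>1 = C\<^sub>1 and C\<^sub>2 = C\<^sub>2]) auto
    then have "small_event (\<theta> / 2) (\<lambda>n \<omega>. \<bar>S n \<omega>\<bar> > \<epsilon> * real n powr (- 1 / 2))"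
    proof (rule small_event_mono)
      have "\<forall>\<^sub>F n in sequentially. h n < 1"
        using bandwidth_tendsto_0[OF assms(20)] assms(3) by (intro order_tendstoD(2)) auto
      then show "\<forall>\<^sub>F n in sequentially. AE \<omega> in M. \<bar>S n \<omega>\<bar> > \<epsilon> * real n powr (- 1 / 2) \<longrightarrow> ?Q n \<omega>"
        using eventually_ge_at_top[of 1]
      proof eventually_elim
        fix n :: nat assume h1: "h n < 1" and n: "1 \<le> n"
        show "AE \<omega> in M. \<bar>S n \<omega>\<bar> > \<epsilon> * real n powr (- 1 / 2) \<longrightarrow> ?Q n \<omega>"
          using X_ma
        proof eventually_elim
          fix \<omega> assume X_eq: "\<forall>t. X t \<omega> = ma \<psi> t \<omega>"
          show "\<bar>S n \<omega>\<bar> > \<epsilon> * real n powr (- 1 / 2) \<longrightarrow> ?Q n \<omega>"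
          proof (rule impI, rule ccontr)
            assume gt: "\<bar>S n \<omega>\<bar> > \<epsilon> * real n powr (- 1 / 2)"
              and "\<not> ?Q n \<omega>"
            then have le: "\<bar>ecdf_gap n y \<omega>\<bar> \<le> \<epsilon> / sqrt (real n)"
              if "\<bar>y\<bar> \<le> a n + 1" for y using that by (meson not_le)
            \<comment> \<open>Once h < 1, the kernel window around any z in [-a_n, a_n] stays inside
              [-a_n - 1, a_n + 1], where the empirical distribution functions are already
              compared.\<close>
            have \<Delta>_le: "\<Delta> n \<omega> z \<le> \<epsilon> / sqrt (real n)" if z: "z \<in> {- a n..a n}" for z
              unfolding \<Delta>_def F_hat_def F_tilde_def X_eq[rule_format]
            proof (rule kernel_cdf_est_diff_le[OF K h_pos[OF n]])
              fix y assume "\<bar>y - z\<bar> \<le> h n"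
              then have "\<bar>y\<bar> \<le> a n + 1" using z h1 by auto
              then show "\<bar>ecdf_gap n y \<omega>\<bar> \<le> \<epsilon> / sqrt (real n)"
                by (rule le)
            qed
            have ne: "{- a n..a n} \<noteq> {}" and mem: "0 \<in> {- a n..a n}" using a_pos[OF n] by auto
            have "S n \<omega> \<le> \<epsilon> / sqrt (real n)"
              unfolding S_def using ne \<Delta>_le by (rule cSUP_least)
            moreover have "0 \<le> S n \<omega>"
            proof -
              have "bdd_above (\<Delta> n \<omega> ` {- a n..a n})" using \<Delta>_le by (rule bdd_aboveI2)
              from cSUP_upper[OF mem this] show ?thesis unfolding S_def by (rule order_trans[rotated]) (simp add: \<Delta>_def)
            qed
            ultimately have "\<bar>S n \<omega>\<bar> \<le> \<epsilon> / sqrt (real n)" by simp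
            moreover have "\<epsilon> * real n powr (- 1 / 2) = \<epsilon> / sqrt (real n)"
              using n by (simp add: powr_minus_divide powr_half_sqrt)
            ultimately show False using gt by simp
          qed
        qed
      qed
    qed
    then have "\<forall>\<^sub>F n in sequentially.
        prob {\<omega> \<in> space M. \<bar>S n \<omega>\<bar> > \<epsilon> * real n powr (- 1 / 2)} < \<theta>"
      unfolding small_event_def
    proof eventually_elim
      case (elim n)
      then obtain N where N: "N \<in> events" "prob N \<le> \<theta> / 2"
        "{\<omega> \<in> space M. \<bar>S n \<omega>\<bar> > \<epsilon> * real n powr (- 1 / 2)} \<subseteq> N" by blast
      have "prob {\<omega> \<in> space M. \<bar>S n \<omega>\<bar> > \<epsilon> * real n powr (- 1 / 2)} \<le> prob N"
        using N by (intro finite_measure_mono) auto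
      then show ?case using N(2) \<open>\<theta> > 0\<close> by linarith
    qed
    then show "\<exists>n0. \<forall>n\<ge>n0. norm (prob {\<omega> \<in> space M. \<bar>S n \<omega>\<bar> > \<epsilon> * real n powr (- 1 / 2)} - 0) < \<theta>"
      by (simp add: eventually_sequentially)
  qed
  show ?thesis
    unfolding small_o_prob_def
  proof (intro conjI allI impI)
    show "(\<lambda>\<omega>. SUP z\<in>{- a n..a n}. \<bar>F_hat K (h n) p n X \<omega> z - F_tilde K (h n) n Z \<omega> z\<bar>) \<in> borel_measurable M" for n
      using meas[of n] unfolding S_def[abs_def] \<Delta>_def .
    show "(\<lambda>n. prob {\<omega> \<in> space M. \<bar>SUP z\<in>{- a n..a n}. \<bar>F_hat K (h n) p n X \<omega> z - F_tilde K (h n) n Z \<omega> z\<bar>\<bar>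
        > \<epsilon> * real n powr (- 1 / 2)}) \<longlonglongrightarrow> 0" if "\<epsilon> > 0" for \<epsilon>
      using lim[OF that] unfolding S_def \<Delta>_def .
  qed
qed

end
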